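(* Let $f:M\to(N,g)$ be a pluri-harmonic map from a compact complex manifold $M$ to a Kähler manifold $(N,g)$ with non-positive Riemannian sectional curvature. If $\mathcal O_{T^*_M}(-1)$ is RC-positive, then $f$ is a constant map.
   Context: Manifolds are connected. A smooth map $f:M\to(N,g)$ from a complex manifold to a Hermitian manifold is pluri-harmonic if, in local holomorphic coordinates $z^\alpha$ on $M$ and $w^i$ on $N$, $\frac{\partial^2f^i}{\partial z^\alpha\partial\bar z^\beta}+\Gamma^i_{jk}\frac{\partial f^j}{\partial z^\alpha}\frac{\partial f^k}{\partial\bar z^\beta}=0$ for all $i,\alpha,\beta$, where $\Gamma^i_{jk}=g^{i\bar\ell}\frac{\partial g_{k\bar\ell}}{\partial w^j}$ are the Christoffel symbols of the Chern connection on $(T^{1,0}N,g)$. $\mathbb P(T_M)\to M$ is the bundle whose fiber over $p$ is the set of complex lines in $T_pM=T^{1,0}_pM$; $\mathcal O_{T^*_M}(-1)$ is the tautological line bundle on $\mathbb P(T_M)$ whose fiber at $(p,[W])$ is the line $\mathbb CW\subset T_pM$. A holomorphic line bundle $\mathscr L$ over a complex manifold $X$ is RC-positive if it admits a smooth Hermitian metric $h^{\mathscr L}$ such that its Chern curvature $-\sqrt{-1}\,\partial\bar\partial\log h^{\mathscr L}$ has at least one positive eigenvalue at every point of $X$. *)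

theory Defs
  imports "HOL-Analysis.Analysis"
begin

section \<open>Calculus on open subsets of complex coordinate space\<close>

primrec Ck_on ::
  "nat \<Rightarrow> ('a::real_normed_vector \<Rightarrow> 'b::real_normed_vector) \<Rightarrow> 'a set \<Rightarrow> bool" where
  "Ck_on 0 f S \<longleftrightarrow> continuous_on S f"
| "Ck_on (Suc k) f S \<longleftrightarrow> (\<forall>x\<in>S. f differentiable (at x)) \<and>
     (\<forall>v. Ck_on k (\<lambda>x. frechet_derivative f (at x) v) S)"

text \<open>These notions are only used on open sets of finite-dimensional spaces.\<close>

definition smooth_on ::
  "('a::real_normed_vector \<Rightarrow> 'b::real_normed_vector) \<Rightarrow> 'a set \<Rightarrow> bool" where
  "smooth_on f S \<longleftrightarrow> (\<forall>k. Ck_on k f S)"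

definition cholomorphic_on ::
  "(complex^'n \<Rightarrow> complex^'m) \<Rightarrow> (complex^'n) set \<Rightarrow> bool" where
  "cholomorphic_on f S \<longleftrightarrow> smooth_on f S \<and>
     (\<forall>x\<in>S. \<forall>a v. frechet_derivative f (at x) (a *s v) = a *s frechet_derivative f (at x) v)"

text \<open>The Wirtinger derivatives \<open>\<partial>/\<partial>z\<^sup>\<alpha>\<close> and \<open>\<partial>/\<partial>\<bar>z\<^sup>\<alpha>\<close>.\<close>

definition dz :: "'n \<Rightarrow> (complex^'n \<Rightarrow> complex) \<Rightarrow> complex^'n \<Rightarrow> complex" where
  "dz \<alpha> F z = (frechet_derivative F (at z) (axis \<alpha> 1)
              - \<i> * frechet_derivative F (at z) (axis \<alpha> \<i>)) / 2"

definition dzbar :: "'n \<Rightarrow> (complex^'n \<Rightarrow> complex) \<Rightarrow> complex^'n \<Rightarrow> complex" where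
  "dzbar \<alpha> F z = (frechet_derivative F (at z) (axis \<alpha> 1)
                 + \<i> * frechet_derivative F (at z) (axis \<alpha> \<i>)) / 2"


section \<open>Complex manifolds and their holomorphic tangent spaces\<close>

text \<open>A chart is a pair of a domain and a coordinate map.\<close>

type_synonym ('a, 'n) chart = "'a set \<times> ('a \<Rightarrow> complex^'n)"

record ('a, 'n) manifold =
  mtop :: "'a topology"
  atlas :: "('a, 'n) chart set"

abbreviation points :: "('a, 'n, 'z) manifold_scheme \<Rightarrow> 'a set" where
  "points M \<equiv> topspace (mtop M)"

definition chart_inv :: "('a, 'n) chart \<Rightarrow> complex^'n \<Rightarrow> 'a" where
  "chart_inv c = inv_into (fst c) (snd c)"

definition transition :: "('a, 'n) chart \<Rightarrow> ('a, 'n) chart \<Rightarrow> complex^'n \<Rightarrow> complex^'n" where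
  "transition c d = snd d \<circ> chart_inv c"

definition complex_manifold :: "('a, 'n::finite) manifold \<Rightarrow> bool" where
  "complex_manifold M \<longleftrightarrow>
     Hausdorff_space (mtop M) \<and> second_countable (mtop M) \<and> connected_space (mtop M) \<and>
     (\<Union>c\<in>atlas M. fst c) = points M \<and>
     (\<forall>c\<in>atlas M. openin (mtop M) (fst c) \<and> open (snd c ` fst c) \<and>
        homeomorphic_map (subtopology (mtop M) (fst c)) (top_of_set (snd c ` fst c)) (snd c)) \<and>
     (\<forall>c\<in>atlas M. \<forall>d\<in>atlas M. cholomorphic_on (transition c d) (snd c ` (fst c \<inter> fst d)))"

definition charts_at :: "('a, 'n) manifold \<Rightarrow> 'a \<Rightarrow> ('a, 'n) chart set" where
  "charts_at M p = {c \<in> atlas M. p \<in> fst c}"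

text \<open>An element of \<open>T\<^sup>1\<^sup>,\<^sup>0\<^sub>p M\<close> is the family of its component vectors
  with respect to the charts around \<open>p\<close>, related by the Jacobians of the transition maps
  (and \<open>0\<close> for all other charts, so that \<open>T\<^sup>1\<^sup>,\<^sup>0\<^sub>p M\<close> is a complex vector space under pointwise operations).\<close>

type_synonym ('a, 'n) tvector = "('a, 'n) chart \<Rightarrow> complex^'n"

definition tangent_space :: "('a, 'n::finite) manifold \<Rightarrow> 'a \<Rightarrow> ('a, 'n) tvector set" where
  "tangent_space M p = {W.
     (\<forall>c\<in>charts_at M p. \<forall>d\<in>charts_at M p.
        W d = frechet_derivative (transition c d) (at (snd c p)) (W c)) \<and>
     (\<forall>c. c \<notin> charts_at M p \<longrightarrow> W c = 0)}"

definition tscale :: "complex \<Rightarrow> ('a, 'n::finite) tvector \<Rightarrow> ('a, 'n) tvector" where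
  "tscale a W = (\<lambda>c. a *s W c)"

definition tadd :: "('a, 'n::finite) tvector \<Rightarrow> ('a, 'n) tvector \<Rightarrow> ('a, 'n) tvector" where
  "tadd V W = (\<lambda>c. V c + W c)"

text \<open>The tangent vector at \<open>p\<close> with components \<open>v\<close> in the chart \<open>c\<close>;
  for \<open>v = axis i 1\<close> this is \<open>\<partial>/\<partial>w\<^sup>i\<close>.\<close>

definition tvec ::
  "('a, 'n::finite) manifold \<Rightarrow> ('a, 'n) chart \<Rightarrow> 'a \<Rightarrow> complex^'n \<Rightarrow> ('a, 'n) tvector" where
  "tvec M c p v = (\<lambda>d. if d \<in> charts_at M p
     then frechet_derivative (transition c d) (at (snd c p)) v else 0)"

definition smooth_map ::
  "('a, 'm::finite) manifold \<Rightarrow> ('b, 'n::finite) manifold \<Rightarrow> ('a \<Rightarrow> 'b) \<Rightarrow> bool" where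
  "smooth_map M N f \<longleftrightarrow> continuous_map (mtop M) (mtop N) f \<and>
     (\<forall>c\<in>atlas M. \<forall>d\<in>atlas N.
        smooth_on (snd d \<circ> f \<circ> chart_inv c) (snd c ` (fst c \<inter> f -` fst d)))"


section \<open>Hermitian and Kaehler metrics\<close>

type_synonym ('a, 'n) metric = "'a \<Rightarrow> ('a, 'n) tvector \<Rightarrow> ('a, 'n) tvector \<Rightarrow> complex"

text \<open>The metric in a chart, at the point with coordinates \<open>w\<close>.\<close>

definition local_metric ::
  "('a, 'n::finite) manifold \<Rightarrow> ('a, 'n) metric \<Rightarrow> ('a, 'n) chart \<Rightarrow>
     complex^'n \<Rightarrow> complex^'n \<Rightarrow> complex^'n \<Rightarrow> complex" where
  "local_metric N g c w u v =
     (let p = chart_inv c w in g p (tvec N c p u) (tvec N c p v))"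

text \<open>The matrix with entry \<open>g\<^bsub>k\<bar>l\<^esub>\<close> in row \<open>k\<close> and column \<open>l\<close>.\<close>

definition metric_matrix ::
  "('a, 'n::finite) manifold \<Rightarrow> ('a, 'n) metric \<Rightarrow> ('a, 'n) chart \<Rightarrow>
     complex^'n \<Rightarrow> complex^'n^'n" where
  "metric_matrix N g c w = (\<chi> k l. local_metric N g c w (axis k 1) (axis l 1))"

definition hermitian_metric :: "('a, 'n::finite) manifold \<Rightarrow> ('a, 'n) metric \<Rightarrow> bool" where
  "hermitian_metric N g \<longleftrightarrow>
     (\<forall>p\<in>points N. \<forall>V\<in>tangent_space N p. \<forall>W\<in>tangent_space N p.
        (\<forall>V'\<in>tangent_space N p. g p (tadd V V') W = g p V W + g p V' W) \<and>
        (\<forall>a. g p (tscale a V) W = a * g p V W) \<and>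
        g p W V = cnj (g p V W) \<and>
        (V \<noteq> (\<lambda>_. 0) \<longrightarrow> Re (g p V V) > 0)) \<and>
     (\<forall>c\<in>atlas N. \<forall>k l. smooth_on (\<lambda>w. metric_matrix N g c w $ k $ l) (snd c ` fst c))"

text \<open>The real tangent space is identified with \<open>T\<^sup>1\<^sup>,\<^sup>0\<close> by \<open>X \<mapsto> (X - \<i> J X)/2\<close>, so a real tangent
  vector has components in \<open>complex^'n\<close> as well, with \<open>J\<close> acting as multiplication by \<open>\<i>\<close>. Up to
  a positive constant factor, the Riemannian metric is the real part of the Hermitian form, and
  the fundamental form \<open>(u, v) \<mapsto> g (J u) v\<close> is minus its imaginary part.\<close>

definition riemannian_local ::
  "('a, 'n::finite) manifold \<Rightarrow> ('a, 'n) metric \<Rightarrow> ('a, 'n) chart \<Rightarrow>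
     complex^'n \<Rightarrow> complex^'n \<Rightarrow> complex^'n \<Rightarrow> real" where
  "riemannian_local N g c w u v = Re (local_metric N g c w u v)"

definition fundamental_form ::
  "('a, 'n::finite) manifold \<Rightarrow> ('a, 'n) metric \<Rightarrow> ('a, 'n) chart \<Rightarrow>
     complex^'n \<Rightarrow> complex^'n \<Rightarrow> complex^'n \<Rightarrow> real" where
  "fundamental_form N g c w u v = - Im (local_metric N g c w u v)"

text \<open>The exterior derivative of a 2-form in coordinates, evaluated on constant vector fields.\<close>

definition ext_deriv2 ::
  "('e::real_normed_vector \<Rightarrow> 'e \<Rightarrow> 'e \<Rightarrow> real) \<Rightarrow> 'e \<Rightarrow> 'e \<Rightarrow> 'e \<Rightarrow> 'e \<Rightarrow> real" where
  "ext_deriv2 \<omega> w u v x =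
     frechet_derivative (\<lambda>q. \<omega> q v x) (at w) u
     + frechet_derivative (\<lambda>q. \<omega> q x u) (at w) v
     + frechet_derivative (\<lambda>q. \<omega> q u v) (at w) x"

definition kaehler_metric :: "('a, 'n::finite) manifold \<Rightarrow> ('a, 'n) metric \<Rightarrow> bool" where
  "kaehler_metric N g \<longleftrightarrow> hermitian_metric N g \<and>
     (\<forall>c\<in>atlas N. \<forall>w\<in>snd c ` fst c. \<forall>u v x. ext_deriv2 (fundamental_form N g c) w u v x = 0)"


section \<open>Riemannian sectional curvature\<close>

text \<open>The following three definitions concern a Riemannian metric \<open>G\<close> on an open subset of a
  vector space. Constant vector fields commute, so the Koszul formula for them has only
  derivative terms.\<close>

definition levi_civita ::
  "('e::real_normed_vector \<Rightarrow> 'e \<Rightarrow> 'e \<Rightarrow> real) \<Rightarrow> 'e \<Rightarrow> 'e \<Rightarrow> 'e \<Rightarrow> 'e" where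
  "levi_civita G p u v = (THE x. \<forall>w. G p x w =
     (frechet_derivative (\<lambda>q. G q v w) (at p) u
      + frechet_derivative (\<lambda>q. G q u w) (at p) v
      - frechet_derivative (\<lambda>q. G q u v) (at p) w) / 2)"

definition riemann_curvature ::
  "('e::real_normed_vector \<Rightarrow> 'e \<Rightarrow> 'e \<Rightarrow> real) \<Rightarrow> 'e \<Rightarrow> 'e \<Rightarrow> 'e \<Rightarrow> 'e \<Rightarrow> 'e" where
  "riemann_curvature G p u v w =
     frechet_derivative (\<lambda>q. levi_civita G q v w) (at p) u
     - frechet_derivative (\<lambda>q. levi_civita G q u w) (at p) v
     + levi_civita G p u (levi_civita G p v w)
     - levi_civita G p v (levi_civita G p u w)"

definition sectional_curvature ::
  "('e::real_normed_vector \<Rightarrow> 'e \<Rightarrow> 'e \<Rightarrow> real) \<Rightarrow> 'e \<Rightarrow> 'e \<Rightarrow> 'e \<Rightarrow> real" where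
  "sectional_curvature G p u v =
     G p (riemann_curvature G p u v v) u / (G p u u * G p v v - (G p u v)\<^sup>2)"

definition nonpositive_sectional_curvature ::
  "('a, 'n::finite) manifold \<Rightarrow> ('a, 'n) metric \<Rightarrow> bool" where
  "nonpositive_sectional_curvature N g \<longleftrightarrow>
     (\<forall>c\<in>atlas N. \<forall>w\<in>snd c ` fst c. \<forall>u v. u \<noteq> v \<and> independent {u, v} \<longrightarrow>
        sectional_curvature (riemannian_local N g c) w u v \<le> 0)"


section \<open>Pluri-harmonic maps\<close>

text \<open>The Chern connection coefficients \<open>\<Gamma>\<^sup>i\<^bsub>jk\<^esub>\<close>. The inverse metric satisfies
  \<open>\<Sum>l. g\<^bsub>k\<bar>l\<^esub> * g\<^bsup>i\<bar>l\<^esup> = \<delta>\<^bsub>ik\<^esub>\<close>, so \<open>g\<^bsup>i\<bar>l\<^esup>\<close> is the entry in row \<open>l\<close> and column \<open>i\<close> of the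
  inverse matrix.\<close>

definition chern_christoffel ::
  "('a, 'n::finite) manifold \<Rightarrow> ('a, 'n) metric \<Rightarrow> ('a, 'n) chart \<Rightarrow>
     'n \<Rightarrow> 'n \<Rightarrow> 'n \<Rightarrow> complex^'n \<Rightarrow> complex" where
  "chern_christoffel N g c i j k w =
     (\<Sum>l\<in>UNIV. matrix_inv (metric_matrix N g c w) $ l $ i *
        dz j (\<lambda>q. metric_matrix N g c q $ k $ l) w)"

definition pluriharmonic ::
  "('a, 'm::finite) manifold \<Rightarrow> ('b, 'n::finite) manifold \<Rightarrow> ('b, 'n) metric \<Rightarrow>
     ('a \<Rightarrow> 'b) \<Rightarrow> bool" where
  "pluriharmonic M N g f \<longleftrightarrow> smooth_map M N f \<and>
     (\<forall>c\<in>atlas M. \<forall>d\<in>atlas N. \<forall>p\<in>fst c \<inter> f -` fst d. \<forall>i \<alpha> \<beta>.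
        let F = (\<lambda>i z. snd d (f (chart_inv c z)) $ i) in
          dz \<alpha> (dzbar \<beta> (F i)) (snd c p)
          + (\<Sum>j\<in>UNIV. \<Sum>k\<in>UNIV. chern_christoffel N g d i j k (snd d (f p))
               * dz \<alpha> (F j) (snd c p) * dzbar \<beta> (F k) (snd c p)) = 0)"


section \<open>RC-positive holomorphic line bundles\<close>

text \<open>A holomorphic line bundle is given by its fibres (complex lines with scalar multiplication
  \<open>lscale\<close>) and its holomorphic structure, i.e. a family of nowhere vanishing local holomorphic
  frames \<open>(V, s)\<close> whose domains \<open>V\<close> cover the base and which differ by holomorphic functions.\<close>

record ('x, 'v) line_bundle =
  fibre :: "'x \<Rightarrow> 'v set"
  lscale :: "complex \<Rightarrow> 'v \<Rightarrow> 'v"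
  frames :: "('x set \<times> ('x \<Rightarrow> 'v)) set"

text \<open>As fibres are one-dimensional, additivity of \<open>h\<close> follows from homogeneity; \<open>lscale L 0 v\<close> is
  the zero vector.\<close>

definition bundle_metric ::
  "('x, 'd::finite) manifold \<Rightarrow> ('x, 'v) line_bundle \<Rightarrow> ('x \<Rightarrow> 'v \<Rightarrow> 'v \<Rightarrow> complex) \<Rightarrow> bool" where
  "bundle_metric X L h \<longleftrightarrow>
     (\<forall>x\<in>points X. \<forall>v\<in>fibre L x. \<forall>w\<in>fibre L x.
        (\<forall>a. h x (lscale L a v) w = a * h x v w) \<and>
        h x w v = cnj (h x v w) \<and>
        (v \<noteq> lscale L 0 v \<longrightarrow> Re (h x v v) > 0)) \<and>
     (\<forall>c\<in>atlas X. \<forall>(V, s)\<in>frames L.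
        smooth_on (\<lambda>z. let x = chart_inv c z in h x (s x) (s x)) (snd c ` (fst c \<inter> V)))"

text \<open>The coefficient matrix, at the point with coordinates \<open>z\<close>, of the Chern curvature
  \<open>- \<i> \<partial>\<partial>\<bar> log h\<close> with respect to the frame \<open>s\<close> and the chart \<open>c\<close>. It is
  independent of \<open>s\<close>, and the existence of a positive eigenvalue is independent of \<open>c\<close>
  (the matrix is Hermitian and changes by congruence).\<close>

definition chern_curvature ::
  "('x \<Rightarrow> 'v \<Rightarrow> 'v \<Rightarrow> complex) \<Rightarrow> ('x \<Rightarrow> 'v) \<Rightarrow> ('x, 'd::finite) chart \<Rightarrow>
     complex^'d \<Rightarrow> complex^'d^'d" where
  "chern_curvature h s c z = (\<chi> \<alpha> \<beta>. - dz \<alpha> (dzbar \<beta>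
     (\<lambda>z. let x = chart_inv c z in of_real (ln (Re (h x (s x) (s x)))))) z)"

definition RC_positive :: "('x, 'd::finite) manifold \<Rightarrow> ('x, 'v) line_bundle \<Rightarrow> bool" where
  "RC_positive X L \<longleftrightarrow> (\<exists>h. bundle_metric X L h \<and>
     (\<forall>c\<in>atlas X. \<forall>(V, s)\<in>frames L. \<forall>x\<in>fst c \<inter> V.
        \<exists>\<mu>>0. \<exists>v. v \<noteq> 0 \<and> chern_curvature h s c (snd c x) *v v = of_real \<mu> *s v))"


section \<open>The projectivized tangent bundle and its tautological line bundle\<close>

text \<open>An index type with \<open>2 n - 1\<close> elements, for the coordinates on \<open>\<P>(T\<^sub>M)\<close> when \<open>dim M = n\<close>: a copy
  of the index type of \<open>M\<close>, and a second copy without a chosen base index.\<close>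

definition base_index :: 'n where
  "base_index = (SOME k. True)"

typedef 'n pindex = "{i :: 'n + 'n. i \<noteq> Inr base_index}"
  by (rule exI[of _ "Inl base_index"]) simp

instance pindex :: (finite) finite
proof
  have "inj (Rep_pindex :: 'a pindex \<Rightarrow> 'a + 'a)"
    by (simp add: inj_def Rep_pindex_inject)
  then show "finite (UNIV :: 'a pindex set)"
    by (rule finite_imageD[rotated]) (rule finite_subset[OF subset_UNIV finite_class.finite_UNIV])
qed

lemma card_pindex: "CARD('n::finite pindex) = 2 * CARD('n) - 1"
proof -
  have "{i :: 'n + 'n. i \<noteq> Inr base_index} = UNIV - {Inr base_index}"
    by auto
  then show ?thesis
    by (simp add: type_definition.card[OF type_definition_pindex])
qed

text \<open>A point of \<open>\<P>(T\<^sub>M)\<close> is a pair of \<open>p\<close> and a complex line in \<open>T\<^sup>1\<^sup>,\<^sup>0\<^sub>p M\<close>.\<close>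

type_synonym ('a, 'n) ppoint = "'a \<times> ('a, 'n) tvector set"

definition PT_points :: "('a, 'n::finite) manifold \<Rightarrow> ('a, 'n) ppoint set" where
  "PT_points M = {(p, range (\<lambda>a. tscale a W)) | p W.
     p \<in> points M \<and> W \<in> tangent_space M p \<and> W \<noteq> (\<lambda>_. 0)}"

text \<open>For a chart \<open>c\<close> of \<open>M\<close> and an index \<open>k\<close>: the lines not contained in \<open>{W\<^sup>k = 0}\<close>, and on these
  the generator of the line which is normalized by \<open>W\<^sup>k = 1\<close>.\<close>

definition PT_dom ::
  "('a, 'n::finite) manifold \<Rightarrow> ('a, 'n) chart \<Rightarrow> 'n \<Rightarrow> ('a, 'n) ppoint set" where
  "PT_dom M c k = {x \<in> PT_points M. fst x \<in> fst c \<and> (\<exists>W\<in>snd x. W c $ k \<noteq> 0)}"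

definition taut_frame :: "('a, 'n::finite) chart \<Rightarrow> 'n \<Rightarrow> ('a, 'n) ppoint \<Rightarrow> ('a, 'n) tvector" where
  "taut_frame c k x = (THE W. W \<in> snd x \<and> W c $ k = 1)"

text \<open>The coordinates of \<open>(p, [W])\<close> are those of \<open>p\<close> and the inhomogeneous coordinates \<open>W\<^sup>j / W\<^sup>k\<close>
  with \<open>j \<noteq> k\<close>; the latter are indexed by \<open>j \<noteq> base_index\<close> by exchanging \<open>k\<close> and \<open>base_index\<close>.\<close>

definition PT_coord ::
  "('a, 'n::finite) chart \<Rightarrow> 'n \<Rightarrow> ('a, 'n) ppoint \<Rightarrow> complex^'n pindex" where
  "PT_coord c k x = (\<chi> i. case Rep_pindex i of
       Inl j \<Rightarrow> snd c (fst x) $ j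
     | Inr j \<Rightarrow> taut_frame c k x c $ (if j = k then base_index else j))"

definition PT_atlas ::
  "('a, 'n::finite) manifold \<Rightarrow> (('a, 'n) ppoint, 'n pindex) chart set" where
  "PT_atlas M = {(PT_dom M c k, PT_coord c k) | c k. c \<in> atlas M}"

definition PT :: "('a, 'n::finite) manifold \<Rightarrow> (('a, 'n) ppoint, 'n pindex) manifold" where
  "PT M = \<lparr> mtop = topology_generated_by
              {U \<inter> \<phi> -` S | U \<phi> S. (U, \<phi>) \<in> PT_atlas M \<and> open S},
            atlas = PT_atlas M \<rparr>"

definition taut_bundle ::
  "('a, 'n::finite) manifold \<Rightarrow> (('a, 'n) ppoint, ('a, 'n) tvector) line_bundle" where
  "taut_bundle M = \<lparr> fibre = snd, lscale = tscale,
     frames = {(PT_dom M c k, taut_frame c k) | c k. c \<in> atlas M} \<rparr>"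

lemma taut_frame_unique:
  assumes "x \<in> PT_dom M c k"
  shows "\<exists>!W. W \<in> snd x \<and> W c $ k = 1"
proof -
  obtain p V where x: "x = (p, range (\<lambda>a. tscale a V))"
    using assms by (auto simp: PT_dom_def PT_points_def)
  have V: "V c $ k \<noteq> 0"
    using assms by (auto simp: PT_dom_def x tscale_def)
  show ?thesis
  proof (rule ex1I)
    show "tscale (inverse (V c $ k)) V \<in> snd x \<and> tscale (inverse (V c $ k)) V c $ k = 1"
      using V by (simp add: x tscale_def)
  next
    fix W assume "W \<in> snd x \<and> W c $ k = 1"
    then obtain a where a: "W = tscale a V" "a * V c $ k = 1"
      by (auto simp: x tscale_def)
    then have "a = inverse (V c $ k)"
      using V by (simp add: field_simps)
    then show "W = tscale (inverse (V c $ k)) V"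
      using a by simp
  qed
qed

lemma points_PT:
  assumes "complex_manifold M"
  shows "points (PT M) = PT_points M"
proof
  have top: "points (PT M) = \<Union> {U \<inter> \<phi> -` S | U \<phi> S. (U, \<phi>) \<in> PT_atlas M \<and> open S}"
    unfolding PT_def by (simp add: topology_generated_by_topspace)
  show "points (PT M) \<subseteq> PT_points M"
    unfolding top by (auto simp: PT_atlas_def PT_dom_def)
  show "PT_points M \<subseteq> points (PT M)"
  proof
    fix x assume x: "x \<in> PT_points M"
    then obtain p W where pW: "x = (p, range (\<lambda>a. tscale a W))" "p \<in> points M"
      "W \<in> tangent_space M p" "W \<noteq> (\<lambda>_. 0)"
      by (auto simp: PT_points_def)
    obtain c where c: "c \<in> atlas M" "p \<in> fst c"
      using assms pW(2) unfolding complex_manifold_def by blast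
    have "W c \<noteq> 0"
    proof
      assume 0: "W c = 0"
      have "W d = 0" for d
      proof (cases "d \<in> charts_at M p")
        case True
        then have d: "d \<in> atlas M" "p \<in> fst d" by (auto simp: charts_at_def)
        have "Ck_on (Suc 0) (transition c d) (snd c ` (fst c \<inter> fst d))"
          using assms c(1) d(1) unfolding complex_manifold_def cholomorphic_on_def smooth_on_def
          by blast
        then have "transition c d differentiable (at (snd c p))"
          using c(2) d(2) by auto
        then have "linear (frechet_derivative (transition c d) (at (snd c p)))"
          by (rule linear_frechet_derivative)
        moreover have "W d = frechet_derivative (transition c d) (at (snd c p)) (W c)"
          using pW(3) c True unfolding tangent_space_def charts_at_def by blast
        ultimately show ?thesis
          by (simp add: 0 linear_0)
      next
        case False
        then show ?thesis using pW(3) unfolding tangent_space_def by blast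
      qed
      then show False using pW(4) by auto
    qed
    then obtain k where k: "W c $ k \<noteq> 0"
      by (auto simp: vec_eq_iff)
    have "W \<in> snd x"
      by (auto simp: pW(1) tscale_def image_iff intro!: exI[of _ 1])
    then have "x \<in> PT_dom M c k"
      using x k c(2) unfolding PT_dom_def by (auto simp only: pW(1) fst_conv mem_Collect_eq)
    moreover have "PT_dom M c k \<inter> PT_coord c k -` UNIV \<in>
        {U \<inter> \<phi> -` S | U \<phi> S. (U, \<phi>) \<in> PT_atlas M \<and> open S}"
      using c(1) unfolding PT_atlas_def by blast
    ultimately show "x \<in> points (PT M)"
      unfolding top by blast
  qed
qed

end

theory Submission
  imports Defs
begin

text \<open>If \<open>f\<close> is not constant, the quotient of the energy \<open>E = \<bar>df(W)\<bar>\<^sup>2 + \<bar>df(iW)\<bar>\<^sup>2\<close> by \<open>h(W, W)\<close>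
  is a function on \<open>\<P>(T\<^sub>M)\<close> with a positive maximum. In coordinates, \<open>P = df(W)\<close> and \<open>Q = df(iW)\<close> form a
  section \<open>P - i Q\<close> of the complexified pullback of the real tangent bundle of \<open>N\<close>, and pluriharmonicity makes it
  holomorphic. The Bochner formula for it contains a curvature term which, because holomorphic
  sections are killed by the \<open>(0,2)\<close> part of the curvature, equals a sum of four sectional curvatures;
  hence \<open>log E\<close> is plurisubharmonic. At the maximum this contradicts the positive eigenvalue of
  \<open>- \<i> \<partial>\<partial>\<bar> log h\<close>.\<close>

section \<open>Differentiation\<close>

text \<open>The map is not holomorphic, so \<open>|df(W)|^2\<close> alone does not scale by
  \<open>|a|^2\<close> when \<open>W\<close> is replaced by \<open>a W\<close>; the sum with
  \<open>|df(iW)|^2\<close> does, being the squared norm of \<open>P - i Q\<close>. The obstacle is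
  the curvature of the target. The Bochner term is, up to a constant, R(X, conj X, Y, conj Y) for X
  = df(A) - i df(iA), with A the direction of differentiation, and Y = P - i Q. Such values of the
  complexified curvature tensor are not controlled by sectional curvatures in general. What helps is
  R(conj X, conj Y) X = 0. It holds because X extends to a holomorphic section, the push-forward of
  a constant field, and because Y also comes from a direction: some tangent vector B of the
  projectivized bundle projects to \<open>W\<close>. The Kaehler condition makes the Chern
  connection torsion-free. Its coefficients are then those of the Levi-Civita connection, so that
  the equation for \<open>f\<close> and the curvature hypothesis speak of the same
  connection.\<close>

abbreviation dird :: "('a::real_normed_vector \<Rightarrow> 'b::real_normed_vector) \<Rightarrow> 'a \<Rightarrow> 'a \<Rightarrow> 'b" where
  "dird f z v \<equiv> frechet_derivative f (at z) v"

lemma dirdI: "(f has_derivative f') (at z) \<Longrightarrow> dird f z v = f' v"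
  by (metis frechet_derivative_at)

lemma has_dird: "f differentiable (at z) \<Longrightarrow> (f has_derivative dird f z) (at z)"
  by (simp add: frechet_derivative_works)

lemma dird_linear: "f differentiable (at z) \<Longrightarrow> linear (dird f z)"
  by (rule linear_frechet_derivative)

lemma dird_cong:
  assumes "open S" "z \<in> S" "\<And>x. x \<in> S \<Longrightarrow> f x = g x" "f differentiable (at z)"
  shows "dird f z v = dird g z v"
  using frechet_derivative_transform_within_open[OF assms(4,1,2,3)] by simp

lemma differentiable_cong_open:
  assumes "open S" "z \<in> S" "\<And>x. x \<in> S \<Longrightarrow> f x = g x" "f differentiable (at z)"
  shows "g differentiable (at z)"
  using assms by (meson differentiable_def has_derivative_transform_within_open)

section \<open>Closure properties of \<open>Ck_on\<close>\<close>

lemma Ck_on_cong: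
  assumes "open S" "\<And>x. x \<in> S \<Longrightarrow> f x = g x" "Ck_on k f S"
  shows "Ck_on k g S"
  using assms(2,3)
proof (induction k arbitrary: f g)
  case 0
  then show ?case by (simp cong: continuous_on_cong)
next
  case (Suc k)
  have d: "g differentiable (at x)" if "x \<in> S" for x
    using differentiable_cong_open[OF assms(1) that Suc.prems(1)] Suc.prems(2) that by auto
  have "Ck_on k (\<lambda>x. dird g x v) S" for v
  proof (rule Suc.IH)
    show "dird f x v = dird g x v" if "x \<in> S" for x
      using dird_cong[OF assms(1) that Suc.prems(1)] Suc.prems(2) that by auto
    show "Ck_on k (\<lambda>x. dird f x v) S" using Suc.prems(2) by simp
  qed
  then show ?case using d by simp
qed

lemma Ck_on_subset: "Ck_on k f S \<Longrightarrow> T \<subseteq> S \<Longrightarrow> Ck_on k f T"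
proof (induction k arbitrary: f)
  case 0 then show ?case by (simp add: continuous_on_subset)
next
  case (Suc k) then show ?case by (simp add: subset_iff)
qed

lemma Ck_on_SucD: "Ck_on (Suc k) f S \<Longrightarrow> Ck_on k f S"
proof (induction k arbitrary: f)
  case 0
  then have "f differentiable_on S"
    by (auto simp: differentiable_on_def intro: differentiable_at_withinI)
  then show ?case by (simp add: differentiable_imp_continuous_on)
next
  case (Suc k)
  then show ?case by (metis Ck_on.simps(2))
qed

lemma Ck_on_const: "Ck_on k (\<lambda>_. c) S"
  by (induction k arbitrary: c) auto

lemma Ck_on_add:
  assumes "open S" "Ck_on k f S" "Ck_on k g S" shows "Ck_on k (\<lambda>x. f x + g x) S"
  using assms(2,3)
proof (induction k arbitrary: f g)
  case 0 then show ?case by (simp add: continuous_on_add)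
next
  case (Suc k)
  have "Ck_on k (\<lambda>x. dird (\<lambda>x. f x + g x) x v) S" for v
  proof (rule Ck_on_cong[OF assms(1)])
    show "Ck_on k (\<lambda>x. dird f x v + dird g x v) S"
      using Suc by simp
    show "dird f x v + dird g x v = dird (\<lambda>x. f x + g x) x v" if "x \<in> S" for x
      by (rule dirdI[symmetric]) (use Suc.prems that in \<open>auto intro!: derivative_intros has_dird\<close>)
  qed
  then show ?case using Suc.prems by simp
qed

lemma Ck_on_sum:
  assumes "open S" "finite I" "\<And>i. i \<in> I \<Longrightarrow> Ck_on k (f i) S"
  shows "Ck_on k (\<lambda>x. \<Sum>i\<in>I. f i x) S"
  using assms(2,3) by (induction I rule: finite_induct) (auto simp: Ck_on_const Ck_on_add[OF assms(1)])

lemma Ck_on_linear_compose: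
  assumes "open S" "bounded_linear L" "Ck_on k f S" shows "Ck_on k (\<lambda>x. L (f x)) S"
  using assms(3)
proof (induction k arbitrary: f)
  case 0 then show ?case
    by (simp add: bounded_linear.continuous_on[OF assms(2)])
next
  case (Suc k)
  have h: "((\<lambda>x. L (f x)) has_derivative (\<lambda>v. L (dird f x v))) (at x)" if "x \<in> S" for x
    by (rule bounded_linear.has_derivative[OF assms(2)]) (use Suc.prems that in \<open>auto intro!: has_dird\<close>)
  have "Ck_on k (\<lambda>x. dird (\<lambda>x. L (f x)) x v) S" for v
  proof (rule Ck_on_cong[OF assms(1)])
    show "Ck_on k (\<lambda>x. L (dird f x v)) S" using Suc by simp
    show "L (dird f x v) = dird (\<lambda>x. L (f x)) x v" if "x \<in> S" for x
      using dirdI[OF h[OF that]] by simp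
  qed
  then show ?case using h by (auto simp: differentiable_def)
qed

lemma Ck_on_bilinear:
  assumes "open S" "bounded_bilinear B" "Ck_on k f S" "Ck_on k g S"
  shows "Ck_on k (\<lambda>x. B (f x) (g x)) S"
  using assms(3,4)
proof (induction k arbitrary: f g)
  case 0 then show ?case
    by (simp add: bounded_bilinear.continuous_on[OF assms(2)])
next
  case (Suc k)
  have h: "((\<lambda>x. B (f x) (g x)) has_derivative (\<lambda>v. B (f x) (dird g x v) + B (dird f x v) (g x))) (at x)"
    if "x \<in> S" for x
    by (rule bounded_bilinear.FDERIV[OF assms(2)]) (use Suc.prems that in \<open>auto intro!: has_dird\<close>)
  have "Ck_on k (\<lambda>x. dird (\<lambda>x. B (f x) (g x)) x v) S" for v
  proof (rule Ck_on_cong[OF assms(1)])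
    show "Ck_on k (\<lambda>x. B (f x) (dird g x v) + B (dird f x v) (g x)) S"
      using Suc.prems Ck_on_SucD[OF Suc.prems(1)] Ck_on_SucD[OF Suc.prems(2)]
      by (auto intro!: Ck_on_add assms(1) Suc.IH)
    show "B (f x) (dird g x v) + B (dird f x v) (g x) = dird (\<lambda>x. B (f x) (g x)) x v" if "x \<in> S" for x
      using dirdI[OF h[OF that]] by simp
  qed
  then show ?case using h by (auto simp: differentiable_def)
qed

text \<open>In the coordinates of the projectivized bundle the base point and the normalized tangent
  vector are affine functions. For an affine inner map the derivative of the composition is again of
  the form \<open>f (L x + c)\<close>, so the induction closes without product terms.\<close>

lemma Ck_on_affine_compose:
  assumes "bounded_linear L" "Ck_on k f S" "\<And>x. x \<in> T \<Longrightarrow> L x + c \<in> S" "open T"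
  shows "Ck_on k (\<lambda>x. f (L x + c)) T"
  using assms(2)
proof (induction k arbitrary: f)
  case 0
  have "continuous_on T (\<lambda>x. L x + c)"
    by (intro continuous_intros linear_continuous_on assms(1))
  then show ?case using 0 assms(3) by (auto intro: continuous_on_compose2[where g = f and t = S])
next
  case (Suc k)
  have h: "((\<lambda>x. f (L x + c)) has_derivative (\<lambda>v. dird f (L x + c) (L v))) (at x)" if "x \<in> T" for x
  proof -
    have "((\<lambda>x. L x + c) has_derivative L) (at x)"
      using bounded_linear_imp_has_derivative[OF assms(1)] by (auto intro!: derivative_eq_intros)
    moreover have "(f has_derivative dird f (L x + c)) (at (L x + c))"
      using Suc.prems that assms(3) by (auto intro!: has_dird)
    ultimately show ?thesis by (rule has_derivative_compose)
  qed
  have "Ck_on k (\<lambda>x. dird (\<lambda>x. f (L x + c)) x v) T" for v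
  proof (rule Ck_on_cong[OF assms(4)])
    show "Ck_on k (\<lambda>x. dird f (L x + c) (L v)) T"
      using Suc.IH[of "\<lambda>y. dird f y (L v)"] Suc.prems by simp
    show "dird f (L x + c) (L v) = dird (\<lambda>x. f (L x + c)) x v" if "x \<in> T" for x
      using dirdI[OF h[OF that]] by simp
  qed
  then show ?case using h by (auto simp: differentiable_def)
qed

text \<open>Young's argument: both mixed derivatives are the limit of the second difference quotient.\<close>

lemma second_difference_limit:
  fixes f :: "'a::real_normed_vector \<Rightarrow> real"
  assumes S: "open S" "x \<in> S" "\<And>y. y \<in> S \<Longrightarrow> f differentiable (at y)"
    and g: "(\<lambda>y. dird f y v) differentiable (at x)"
  shows "((\<lambda>t. (f (x + t *\<^sub>R v + t *\<^sub>R w) - f (x + t *\<^sub>R v) - f (x + t *\<^sub>R w) + f x) / t\<^sup>2)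
    \<longlongrightarrow> dird (\<lambda>y. dird f y v) x w) (at_right (0::real))"
proof (rule tendstoI)
  fix e :: real assume e: "0 < e"
  define g where "g y = dird f y v" for y
  define G where "G = dird g x"
  have gd: "(g has_derivative G) (at x)"
    using g unfolding g_def G_def by (simp add: frechet_derivative_works)
  interpret G: bounded_linear G using gd by (rule has_derivative_bounded_linear)
  \<comment> \<open>Below, two increments of \<open>g\<close> are estimated with total error
    \<open>2 * (e / (2 * K)) * t * (norm v + norm w)\<close>. It is less than \<open>e * t\<close>
    because \<open>norm v + norm w < K\<close>; the summand 1 keeps \<open>K\<close>
    positive.\<close>
  define K where "K = 2 * norm v + norm w + 1"
  have K: "K > 0" unfolding K_def by (smt (verit) norm_ge_zero)
  have "e / (2 * K) > 0" using e K by simp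
  then obtain d where d: "d > 0" "\<And>y. norm (y - x) < d \<Longrightarrow> norm (g y - g x - G (y - x)) \<le> e / (2*K) * norm (y - x)"
    using gd unfolding has_derivative_at_alt by blast
  obtain r where r: "r > 0" "ball x r \<subseteq> S" using S open_contains_ball by blast
  define \<delta> where "\<delta> = min d r / K"
  have \<delta>: "\<delta> > 0" using d r K by (simp add: \<delta>_def)
  have main: "dist ((f (x + t *\<^sub>R v + t *\<^sub>R w) - f (x + t *\<^sub>R v) - f (x + t *\<^sub>R w) + f x) / t\<^sup>2) (G w) < e"
    if t: "0 < t" "t < \<delta>" for t
  proof -
    have tK: "t * K < min d r" using t K by (simp add: \<delta>_def field_simps)
    have small: "norm (s *\<^sub>R v + u *\<^sub>R w) < min d r \<and> norm (s *\<^sub>R v + u *\<^sub>R w) \<le> t * (norm v + norm w)"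
      if "0 \<le> s" "s \<le> t" "u = 0 \<or> u = t" for s u
    proof -
      have "norm (s *\<^sub>R v + u *\<^sub>R w) \<le> \<bar>s\<bar> * norm v + \<bar>u\<bar> * norm w"
        by (metis norm_scaleR norm_triangle_ineq)
      also have "\<dots> \<le> t * norm v + t * norm w"
        using that t by (intro add_mono mult_right_mono) auto
      finally have a: "norm (s *\<^sub>R v + u *\<^sub>R w) \<le> t * (norm v + norm w)" by (simp add: algebra_simps)
      also have "\<dots> < t * K" using t by (simp add: K_def add_nonneg_pos)
      finally show ?thesis using a tK by linarith
    qed
    have inS: "x + s *\<^sub>R v + u *\<^sub>R w \<in> S" if "0 \<le> s" "s \<le> t" "u = 0 \<or> u = t" for s u
    proof -
      have "dist x (x + s *\<^sub>R v + u *\<^sub>R w) = norm (s *\<^sub>R v + u *\<^sub>R w)"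
        by (simp add: dist_norm algebra_simps norm_minus_commute)
      then show ?thesis using small[OF that] r(2) by (auto simp: subset_iff)
    qed
    \<comment> \<open>The second difference is \<open>\<phi> t - \<phi> 0\<close>. A single mean
      value step in direction \<open>v\<close> turns it into \<open>t\<close> times a difference of
      values of \<open>g\<close> at points that differ by \<open>t *\<^sub>R w\<close>. The term
      \<open>0 *\<^sub>R w\<close> is kept so that \<open>der\<close> covers both summands.\<close>
    define \<phi> where "\<phi> s = f (x + s *\<^sub>R v + t *\<^sub>R w) - f (x + s *\<^sub>R v + 0 *\<^sub>R w)" for s
    have der: "((\<lambda>s. f (x + s *\<^sub>R v + u *\<^sub>R w)) has_real_derivative g (x + s *\<^sub>R v + u *\<^sub>R w)) (at s)"
      if "0 \<le> s" "s \<le> t" "u = 0 \<or> u = t" for s u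
    proof -
      have fd: "(f has_derivative dird f (x + s *\<^sub>R v + u *\<^sub>R w)) (at (x + s *\<^sub>R v + u *\<^sub>R w))"
        using S(3)[OF inS[OF that]] by (rule has_dird)
      have "((\<lambda>s. x + s *\<^sub>R v + u *\<^sub>R w) has_derivative (\<lambda>h. h *\<^sub>R v)) (at s)"
        by (auto intro!: derivative_eq_intros)
      from has_derivative_compose[OF this fd]
      show ?thesis unfolding has_field_derivative_def g_def
        by (rule has_derivative_eq_rhs)
          (simp add: fun_eq_iff linear_scale[OF has_derivative_linear[OF fd]])
    qed
    have "\<exists>s. 0 < s \<and> s < t \<and> \<phi> t - \<phi> 0 =
        (t - 0) * (g (x + s *\<^sub>R v + t *\<^sub>R w) - g (x + s *\<^sub>R v + 0 *\<^sub>R w))"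
      unfolding \<phi>_def by (rule MVT2[OF t(1)]) (auto intro!: derivative_intros der simp del: scaleR_zero_left)
    then obtain s where s: "0 < s" "s < t" "\<phi> t - \<phi> 0 = t * (g (x + s *\<^sub>R v + t *\<^sub>R w) - g (x + s *\<^sub>R v + 0 *\<^sub>R w))"
      by auto
    have est: "\<bar>g (x + s *\<^sub>R v + u *\<^sub>R w) - g x - G (s *\<^sub>R v + u *\<^sub>R w)\<bar> \<le> e / (2*K) * (t * (norm v + norm w))"
      if "u = 0 \<or> u = t" for u
    proof -
      have "norm (s *\<^sub>R v + u *\<^sub>R w) < d" using small[of s u] s that by auto
      then have "\<bar>g (x + s *\<^sub>R v + u *\<^sub>R w) - g x - G (s *\<^sub>R v + u *\<^sub>R w)\<bar> \<le> e / (2*K) * norm (s *\<^sub>R v + u *\<^sub>R w)"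
        using d(2)[of "x + (s *\<^sub>R v + u *\<^sub>R w)"] by (simp add: add.assoc)
      also have "\<dots> \<le> e / (2*K) * (t * (norm v + norm w))"
        using small[of s u] s that e K by (intro mult_left_mono) auto
      finally show ?thesis .
    qed
    have Gs: "G (s *\<^sub>R v + t *\<^sub>R w) - G (s *\<^sub>R v + 0 *\<^sub>R w) = t * G w"
      by (simp add: G.add G.scaleR)
    have "\<bar>(g (x + s *\<^sub>R v + t *\<^sub>R w) - g (x + s *\<^sub>R v + 0 *\<^sub>R w)) - t * G w\<bar> \<le> 2 * (e / (2*K) * (t * (norm v + norm w)))"
      using est[of 0] est[of t] Gs by linarith
    also have "\<dots> = e * t * ((norm v + norm w) / K)" using K by (simp add: field_simps)
    also have "\<dots> < e * t * 1"
    proof (rule mult_strict_left_mono)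
      show "(norm v + norm w) / K < 1" using K by (simp add: K_def divide_less_eq) (smt (verit) norm_ge_zero)
    qed (use e t in simp)
    finally have b: "\<bar>(g (x + s *\<^sub>R v + t *\<^sub>R w) - g (x + s *\<^sub>R v + 0 *\<^sub>R w)) - t * G w\<bar> < e * t" by simp
    have q: "(f (x + t *\<^sub>R v + t *\<^sub>R w) - f (x + t *\<^sub>R v) - f (x + t *\<^sub>R w) + f x) / t\<^sup>2 - G w
       = ((g (x + s *\<^sub>R v + t *\<^sub>R w) - g (x + s *\<^sub>R v + 0 *\<^sub>R w)) - t * G w) / t"
    proof -
      have n: "f (x + t *\<^sub>R v + t *\<^sub>R w) - f (x + t *\<^sub>R v) - f (x + t *\<^sub>R w) + f x
          = t * (g (x + s *\<^sub>R v + t *\<^sub>R w) - g (x + s *\<^sub>R v + 0 *\<^sub>R w))"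
        using s(3) unfolding \<phi>_def by simp
      show ?thesis unfolding n power2_eq_square using t(1) by (simp add: diff_divide_distrib)
    qed
    show ?thesis unfolding dist_real_def q using b t(1) by (simp add: abs_divide divide_less_eq)
  qed
  have "dist ((f (x + t *\<^sub>R v + t *\<^sub>R w) - f (x + t *\<^sub>R v) - f (x + t *\<^sub>R w) + f x) / t\<^sup>2)
      (dird (\<lambda>y. dird f y v) x w) < e" if "0 < t" "t < \<delta>" for t
    using main[OF that] unfolding G_def g_def[abs_def] .
  then show "\<forall>\<^sub>F t in at_right 0. dist ((f (x + t *\<^sub>R v + t *\<^sub>R w) - f (x + t *\<^sub>R v) - f (x + t *\<^sub>R w) + f x) / t\<^sup>2)
      (dird (\<lambda>y. dird f y v) x w) < e"
    unfolding eventually_at_right_field using \<delta> by blast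
qed

lemma second_derivative_symmetric:
  fixes f :: "'a::real_normed_vector \<Rightarrow> 'b::euclidean_space"
  assumes S: "open S" "x \<in> S" "\<And>y. y \<in> S \<Longrightarrow> f differentiable (at y)"
    and g: "\<And>v. (\<lambda>y. dird f y v) differentiable (at x)"
  shows "dird (\<lambda>y. dird f y v) x w = dird (\<lambda>y. dird f y w) x v"
proof (rule euclidean_eqI)
  fix b :: 'b assume "b \<in> Basis"
  define h where "h y = f y \<bullet> b" for y
  have hd: "(h has_derivative (\<lambda>v. dird f y v \<bullet> b)) (at y)" if "y \<in> S" for y
    unfolding h_def by (intro derivative_intros has_dird S(3) that)
  have hv: "dird h y v = dird f y v \<bullet> b" if "y \<in> S" for y v
    using dirdI[OF hd[OF that]] .
  have h2: "((\<lambda>y. dird h y v) has_derivative (\<lambda>w. dird (\<lambda>y. dird f y v) x w \<bullet> b)) (at x)" for v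
    by (rule has_derivative_transform_within_open[OF _ S(1,2), where f = "\<lambda>y. dird f y v \<bullet> b"])
      (auto simp: hv intro!: derivative_intros has_dird g)
  have h2': "(\<lambda>y. dird h y v) differentiable (at x)" for v
    using h2 by (auto simp: differentiable_def)
  have hdiff: "h differentiable (at y)" if "y \<in> S" for y
    using hd[OF that] by (auto simp: differentiable_def)
  have "dird (\<lambda>y. dird h y v) x w = dird (\<lambda>y. dird h y w) x v"
  proof (rule tendsto_unique[OF _ second_difference_limit[OF S(1,2) hdiff h2']])
    show "((\<lambda>t. (h (x + t *\<^sub>R v + t *\<^sub>R w) - h (x + t *\<^sub>R v) - h (x + t *\<^sub>R w) + h x) / t\<^sup>2)
      \<longlongrightarrow> dird (\<lambda>y. dird h y w) x v) (at_right (0::real))"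
      using second_difference_limit[OF S(1,2) hdiff h2', of w v] by (simp add: algebra_simps)
  qed auto
  then show "dird (\<lambda>y. dird f y v) x w \<bullet> b = dird (\<lambda>y. dird f y w) x v \<bullet> b"
    using dirdI[OF h2] by simp
qed

text \<open>If the second derivative along \<open>v\<close> were negative, the first derivative,
  which vanishes at \<open>x\<close>, would be negative shortly after \<open>x\<close> on the line,
  and the mean value theorem would give a smaller value of \<open>f\<close>. Continuity of second
  derivatives does not enter.\<close>

lemma second_derivative_local_min:
  fixes f :: "'a::real_normed_vector \<Rightarrow> real"
  assumes S: "open S" "x \<in> S" "\<And>y. y \<in> S \<Longrightarrow> f differentiable (at y)"
    and g: "(\<lambda>y. dird f y v) differentiable (at x)" and min: "\<And>y. y \<in> S \<Longrightarrow> f x \<le> f y"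
  shows "dird (\<lambda>y. dird f y v) x v \<ge> 0"
proof (rule ccontr)
  assume neg: "\<not> ?thesis"
  obtain r where r: "r > 0" "ball x r \<subseteq> S" using S open_contains_ball by blast
  define R where "R = r / (norm v + 1)"
  have R: "R > 0" using r by (simp add: R_def add_nonneg_pos)
  have inS: "x + t *\<^sub>R v \<in> S" if "\<bar>t\<bar> < R" for t
  proof -
    have "\<bar>t\<bar> * norm v \<le> \<bar>t\<bar> * (norm v + 1)" by (intro mult_left_mono) auto
    also have "\<dots> < r" using that r by (simp add: R_def pos_less_divide_eq add_nonneg_pos)
    finally show ?thesis using r(2) by (auto simp: subset_iff dist_norm)
  qed
  define \<phi> where "\<phi> t = f (x + t *\<^sub>R v)" for t
  have line: "((\<lambda>s. x + s *\<^sub>R v) has_derivative (\<lambda>h. h *\<^sub>R v)) (at s)" for s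
    by (auto intro!: derivative_eq_intros)
  have d1: "(\<phi> has_real_derivative dird f (x + t *\<^sub>R v) v) (at t)" if "\<bar>t\<bar> < R" for t
  proof -
    have fd: "(f has_derivative dird f (x + t *\<^sub>R v)) (at (x + t *\<^sub>R v))"
      using S(3)[OF inS[OF that]] by (rule has_dird)
    from has_derivative_compose[OF line fd]
    show ?thesis unfolding has_field_derivative_def \<phi>_def
      by (rule has_derivative_eq_rhs)
        (simp add: fun_eq_iff linear_scale[OF has_derivative_linear[OF fd]])
  qed
  have d2: "((\<lambda>t. dird f (x + t *\<^sub>R v) v) has_real_derivative dird (\<lambda>y. dird f y v) x v) (at 0)"
  proof -
    have fd: "((\<lambda>y. dird f y v) has_derivative dird (\<lambda>y. dird f y v) x) (at (x + 0 *\<^sub>R v))"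
      using has_dird[OF g] by simp
    from has_derivative_compose[OF line fd]
    show ?thesis unfolding has_field_derivative_def
      by (rule has_derivative_eq_rhs)
        (simp add: fun_eq_iff linear_scale[OF has_derivative_linear[OF fd]])
  qed
  have "dird f (x + 0 *\<^sub>R v) v = 0"
  proof (rule DERIV_local_min[OF d1 R])
    show "\<forall>y. \<bar>0 - y\<bar> < R \<longrightarrow> \<phi> 0 \<le> \<phi> y" using inS min by (auto simp: \<phi>_def)
  qed (use R in simp)
  moreover obtain d where d: "d > 0" "\<And>h. 0 < h \<Longrightarrow> h < d \<Longrightarrow> dird f (x + h *\<^sub>R v) v < dird f (x + 0 *\<^sub>R v) v"
    using DERIV_neg_dec_right[OF d2] neg by auto
  ultimately have n: "dird f (x + h *\<^sub>R v) v < 0" if "0 < h" "h < d" for h using that by simp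
  define b where "b = min d R / 2"
  have b: "0 < b" "b < d" "b < R" using d(1) R by (auto simp: b_def)
  obtain s where "0 < s" "s < b" "\<phi> b - \<phi> 0 = (b - 0) * dird f (x + s *\<^sub>R v) v"
    using MVT2[OF b(1), of \<phi> "\<lambda>t. dird f (x + t *\<^sub>R v) v"] d1 b by force
  then have "\<phi> b < \<phi> 0" using n[of s] b by (simp add: mult_less_0_iff) (smt (verit) mult_pos_neg)
  moreover have "\<phi> 0 \<le> \<phi> b" unfolding \<phi>_def using min inS[of b] b by simp
  ultimately show False by simp
qed


section \<open>Covariant differentiation along a map\<close>

lemma bilinear_expand:
  fixes B :: "'v::euclidean_space \<Rightarrow> 'v \<Rightarrow> 'w::real_normed_vector"
  assumes "bilinear B"
  shows "B u v = (\<Sum>b\<in>Basis. \<Sum>c\<in>Basis. ((u \<bullet> b) * (v \<bullet> c)) *\<^sub>R B b c)"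
proof -
  have "B u v = B (\<Sum>b\<in>Basis. (u \<bullet> b) *\<^sub>R b) (\<Sum>c\<in>Basis. (v \<bullet> c) *\<^sub>R c)"
    by (simp only: euclidean_representation)
  also have "\<dots> = (\<Sum>(b,c)\<in>Basis\<times>Basis. B ((u \<bullet> b) *\<^sub>R b) ((v \<bullet> c) *\<^sub>R c))"
    by (rule bilinear_sum[OF assms])
  also have "\<dots> = (\<Sum>b\<in>Basis. \<Sum>c\<in>Basis. ((u \<bullet> b) * (v \<bullet> c)) *\<^sub>R B b c)"
    by (simp add: sum.cartesian_product bilinear_lmul[OF assms] bilinear_rmul[OF assms] mult.commute)
  finally show ?thesis .
qed

text \<open>A product rule with three factors. Differentiability of \<open>B\<close> in the base
  point is available for fixed arguments only; expansion in a basis reduces the claim to finitely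
  many scalar coefficients times fields \<open>B q b c\<close> with fixed \<open>b\<close> and
  \<open>c\<close>.\<close>

lemma has_derivative_bilinear_field:
  fixes B :: "'v::euclidean_space \<Rightarrow> 'v \<Rightarrow> 'v \<Rightarrow> 'w::real_normed_vector"
    and \<gamma> :: "'e::real_normed_vector \<Rightarrow> 'v"
  assumes S: "open S" "\<gamma> z \<in> S" "\<And>q. q \<in> S \<Longrightarrow> bilinear (B q)"
    and B: "\<And>u v. (\<lambda>q. B q u v) differentiable (at (\<gamma> z))"
    and d: "\<gamma> differentiable (at z)" "P differentiable (at z)" "Q differentiable (at z)"
  shows "((\<lambda>z. B (\<gamma> z) (P z) (Q z)) has_derivative
    (\<lambda>a. dird (\<lambda>q. B q (P z) (Q z)) (\<gamma> z) (dird \<gamma> z a)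
       + B (\<gamma> z) (dird P z a) (Q z) + B (\<gamma> z) (P z) (dird Q z a))) (at z)"
proof -
  have "continuous (at z) \<gamma>" using d(1) by (rule differentiable_imp_continuous_within)
  then have "\<forall>\<^sub>F y in at z. \<gamma> y \<in> S" using S by (simp add: continuous_at topological_tendstoD)
  then obtain U where U: "open U" "z \<in> U" "\<And>y. y \<in> U \<Longrightarrow> \<gamma> y \<in> S"
    using S(2) unfolding eventually_at_topological by (metis UNIV_I)
  have fold: "dird (\<lambda>q. B q u v) (\<gamma> z) w =
      (\<Sum>b\<in>Basis. \<Sum>c\<in>Basis. ((u \<bullet> b) * (v \<bullet> c)) *\<^sub>R dird (\<lambda>q. B q b c) (\<gamma> z) w)" for u v w
  proof (rule dirdI, rule has_derivative_transform_within_open[OF _ S(1,2)])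
    show "((\<lambda>q. \<Sum>b\<in>Basis. \<Sum>c\<in>Basis. ((u \<bullet> b) * (v \<bullet> c)) *\<^sub>R B q b c) has_derivative
      (\<lambda>w. \<Sum>b\<in>Basis. \<Sum>c\<in>Basis. ((u \<bullet> b) * (v \<bullet> c)) *\<^sub>R dird (\<lambda>q. B q b c) (\<gamma> z) w)) (at (\<gamma> z))"
      by (intro derivative_intros has_dird B)
    show "(\<Sum>b\<in>Basis. \<Sum>c\<in>Basis. ((u \<bullet> b) * (v \<bullet> c)) *\<^sub>R B q b c) = B q u v" if "q \<in> S" for q
      by (rule bilinear_expand[OF S(3)[OF that], symmetric])
  qed
  have comp: "((\<lambda>z. B (\<gamma> z) b c) has_derivative (\<lambda>a. dird (\<lambda>q. B q b c) (\<gamma> z) (dird \<gamma> z a))) (at z)" for b c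
    by (rule has_derivative_compose[OF has_dird[OF d(1)] has_dird[OF B]])
  note ex = bilinear_expand[OF S(3)[OF S(2)]]
  have ex1: "B (\<gamma> z) (dird P z a) (Q z) =
      (\<Sum>b\<in>Basis. \<Sum>c\<in>Basis. ((dird P z a \<bullet> b) * (Q z \<bullet> c)) *\<^sub>R B (\<gamma> z) b c)" for a
    by (rule ex)
  have ex2: "B (\<gamma> z) (P z) (dird Q z a) =
      (\<Sum>b\<in>Basis. \<Sum>c\<in>Basis. ((P z \<bullet> b) * (dird Q z a \<bullet> c)) *\<^sub>R B (\<gamma> z) b c)" for a
    by (rule ex)
  show ?thesis
  proof (rule has_derivative_transform_within_open[OF _ U(1,2)])
    show "(\<Sum>b\<in>Basis. \<Sum>c\<in>Basis. ((P y \<bullet> b) * (Q y \<bullet> c)) *\<^sub>R B (\<gamma> y) b c) = B (\<gamma> y) (P y) (Q y)"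
      if "y \<in> U" for y
      by (rule bilinear_expand[OF S(3)[OF U(3)[OF that]], symmetric])
    have "((\<lambda>y. \<Sum>b\<in>Basis. \<Sum>c\<in>Basis. ((P y \<bullet> b) * (Q y \<bullet> c)) *\<^sub>R B (\<gamma> y) b c) has_derivative
       (\<lambda>a. \<Sum>b\<in>Basis. \<Sum>c\<in>Basis. ((P z \<bullet> b) * (Q z \<bullet> c)) *\<^sub>R dird (\<lambda>q. B q b c) (\<gamma> z) (dird \<gamma> z a)
         + ((P z \<bullet> b) * (dird Q z a \<bullet> c) + (dird P z a \<bullet> b) * (Q z \<bullet> c)) *\<^sub>R B (\<gamma> z) b c)) (at z)"
      by (intro derivative_intros has_dird d comp)
    then show "((\<lambda>y. \<Sum>b\<in>Basis. \<Sum>c\<in>Basis. ((P y \<bullet> b) * (Q y \<bullet> c)) *\<^sub>R B (\<gamma> y) b c) has_derivative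
       (\<lambda>a. dird (\<lambda>q. B q (P z) (Q z)) (\<gamma> z) (dird \<gamma> z a)
       + B (\<gamma> z) (dird P z a) (Q z) + B (\<gamma> z) (P z) (dird Q z a))) (at z)"
      by (rule has_derivative_eq_rhs)
        (simp add: fun_eq_iff fold[of "P z" "Q z"] ex1 ex2 sum.distrib scaleR_add_left)
  qed
qed

text \<open>Weaker than \<open>Ck_on\<close> of order 2, as second derivatives need not be
  continuous. It suffices for their symmetry and for their sign at a minimum, and it is what the
  covariant calculus yields directly for the energy.\<close>

definition twice_differentiable_on ::
  "('e::real_normed_vector \<Rightarrow> 'v::real_normed_vector) \<Rightarrow> 'e set \<Rightarrow> bool" where
  "twice_differentiable_on f U \<longleftrightarrow>
     (\<forall>z\<in>U. f differentiable (at z) \<and> (\<forall>v. (\<lambda>z. dird f z v) differentiable (at z)))"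

lemma twice_differentiable_onD:
  assumes "twice_differentiable_on f U" "z \<in> U"
  shows "f differentiable (at z)" "(\<lambda>z. dird f z v) differentiable (at z)"
  using assms by (auto simp: twice_differentiable_on_def)

lemma twice_differentiable_on_sym:
  fixes f :: "'e::real_normed_vector \<Rightarrow> 'v::euclidean_space"
  assumes "twice_differentiable_on f U" "open U" "z \<in> U"
  shows "dird (\<lambda>y. dird f y v) z w = dird (\<lambda>y. dird f y w) z v"
  using assms by (auto intro!: second_derivative_symmetric simp: twice_differentiable_on_def)

lemma Ck_on_twice_differentiable: "Ck_on (Suc (Suc k)) f U \<Longrightarrow> twice_differentiable_on f U"
  by (simp add: twice_differentiable_on_def)

text \<open>The connection is a parameter, characterized by symmetry and compatibility, because
  \<open>levi_civita\<close> is a definite description; see \<open>levi_civita_eq\<close>.\<close>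

locale riemannian_domain =
  fixes Om :: "'v::euclidean_space set" and G :: "'v \<Rightarrow> 'v \<Rightarrow> 'v \<Rightarrow> real"
    and \<Gamma> :: "'v \<Rightarrow> 'v \<Rightarrow> 'v \<Rightarrow> 'v"
  assumes open_Om: "open Om"
    and G_bilinear: "q \<in> Om \<Longrightarrow> bilinear (G q)"
    and G_sym: "q \<in> Om \<Longrightarrow> G q u v = G q v u"
    and G_pos: "q \<in> Om \<Longrightarrow> u \<noteq> 0 \<Longrightarrow> G q u u > 0"
    and G_twice: "twice_differentiable_on (\<lambda>q. G q u v) Om"
    and \<Gamma>_bilinear: "q \<in> Om \<Longrightarrow> bilinear (\<Gamma> q)"
    and \<Gamma>_sym: "q \<in> Om \<Longrightarrow> \<Gamma> q u v = \<Gamma> q v u"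
    and \<Gamma>_diff: "q \<in> Om \<Longrightarrow> (\<lambda>q. \<Gamma> q u v) differentiable (at q)"
    and compatible: "q \<in> Om \<Longrightarrow> dird (\<lambda>q. G q u v) q w = G q (\<Gamma> q w u) v + G q u (\<Gamma> q w v)"
begin

lemma G_diff: "q \<in> Om \<Longrightarrow> (\<lambda>q. G q u v) differentiable (at q)"
  using G_twice by (rule twice_differentiable_onD)

lemma G_simps:
  assumes "q \<in> Om"
  shows "G q (u + v) w = G q u w + G q v w" "G q w (u + v) = G q w u + G q w v"
    "G q (u - v) w = G q u w - G q v w" "G q w (u - v) = G q w u - G q w v"
    "G q (- u) w = - G q u w" "G q w (- u) = - G q w u"
    "G q (c *\<^sub>R u) w = c * G q u w" "G q w (c *\<^sub>R u) = c * G q w u"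
    "G q 0 w = 0" "G q w 0 = 0"
  using G_bilinear[OF assms]
  by (simp_all add: bilinear_ladd bilinear_radd bilinear_lsub bilinear_rsub bilinear_lneg bilinear_rneg
      bilinear_lmul bilinear_rmul bilinear_lzero bilinear_rzero)

lemma \<Gamma>_simps:
  assumes "q \<in> Om"
  shows "\<Gamma> q (u + v) w = \<Gamma> q u w + \<Gamma> q v w" "\<Gamma> q w (u + v) = \<Gamma> q w u + \<Gamma> q w v"
    "\<Gamma> q (- u) w = - \<Gamma> q u w" "\<Gamma> q w (- u) = - \<Gamma> q w u" "\<Gamma> q 0 w = 0" "\<Gamma> q w 0 = 0"
  using \<Gamma>_bilinear[OF assms]
  by (simp_all add: bilinear_ladd bilinear_radd bilinear_lneg bilinear_rneg bilinear_lzero bilinear_rzero)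

lemma G_nonneg: "q \<in> Om \<Longrightarrow> G q u u \<ge> 0"
  using G_pos[of q u] G_simps(9)[of q 0] by (cases "u = 0") (auto simp: less_imp_le)

lemma G_eqI:
  assumes "q \<in> Om" "\<And>w. G q x w = G q y w" shows "x = y"
  using G_pos[OF assms(1), of "x - y"] assms by (auto simp: G_simps)

text \<open>Compatibility expands the Koszul expression into six terms, which collapse to one by the
  symmetry of \<open>\<Gamma>\<close>; positive definiteness of \<open>G\<close> makes the solution
  unique.\<close>

lemma levi_civita_eq:
  assumes q: "q \<in> Om" shows "levi_civita G q u v = \<Gamma> q u v"
  unfolding levi_civita_def
proof (rule the_equality)
  show *: "\<forall>w. G q (\<Gamma> q u v) w = (dird (\<lambda>q. G q v w) q u + dird (\<lambda>q. G q u w) q v - dird (\<lambda>q. G q u v) q w) / 2"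
    using G_sym[OF q] \<Gamma>_sym[OF q] by (auto simp: compatible[OF q])
  show "x = \<Gamma> q u v"
    if "\<forall>w. G q x w = (dird (\<lambda>q. G q v w) q u + dird (\<lambda>q. G q u w) q v - dird (\<lambda>q. G q u v) q w) / 2" for x
    by (rule G_eqI[OF q]) (metis that *)
qed

definition curv :: "'v \<Rightarrow> 'v \<Rightarrow> 'v \<Rightarrow> 'v \<Rightarrow> 'v" where
  "curv q u v w = dird (\<lambda>q. \<Gamma> q v w) q u - dird (\<lambda>q. \<Gamma> q u w) q v
     + \<Gamma> q u (\<Gamma> q v w) - \<Gamma> q v (\<Gamma> q u w)"

lemma riemann_curvature_eq:
  assumes q: "q \<in> Om" shows "riemann_curvature G q u v w = curv q u v w"
proof -
  have "dird (\<lambda>q. levi_civita G q v w) q u = dird (\<lambda>q. \<Gamma> q v w) q u" for u v w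
    by (rule dird_cong[OF open_Om q, symmetric]) (simp_all add: levi_civita_eq \<Gamma>_diff q)
  then show ?thesis unfolding riemann_curvature_def curv_def by (simp add: levi_civita_eq q)
qed

text \<open>The pullback connection on vector fields along \<open>\<gamma>\<close>, in a chart of
  the target.\<close>

definition cov :: "('e::real_normed_vector \<Rightarrow> 'v) \<Rightarrow> ('e \<Rightarrow> 'v) \<Rightarrow> 'e \<Rightarrow> 'e \<Rightarrow> 'v" where
  "cov \<gamma> P z A = dird P z A + \<Gamma> (\<gamma> z) (dird \<gamma> z A) (P z)"

lemma has_derivative_G:
  assumes "\<gamma> z \<in> Om" "\<gamma> differentiable (at z)" "P differentiable (at z)" "Q differentiable (at z)"
  shows "((\<lambda>z. G (\<gamma> z) (P z) (Q z)) has_derivative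
    (\<lambda>a. G (\<gamma> z) (cov \<gamma> P z a) (Q z) + G (\<gamma> z) (P z) (cov \<gamma> Q z a))) (at z)"
  by (rule has_derivative_eq_rhs[OF has_derivative_bilinear_field[OF open_Om _ G_bilinear G_diff]])
    (use assms in \<open>auto simp: fun_eq_iff cov_def compatible G_simps\<close>)

lemma cov_linear:
  assumes "\<gamma> z \<in> Om" "\<gamma> differentiable (at z)" "P differentiable (at z)"
  shows "cov \<gamma> P z (A + B) = cov \<gamma> P z A + cov \<gamma> P z B" "cov \<gamma> P z (- A) = - cov \<gamma> P z A"
  using linear_add[OF dird_linear[OF assms(2)]] linear_add[OF dird_linear[OF assms(3)]]
    linear_neg[OF dird_linear[OF assms(2)]] linear_neg[OF dird_linear[OF assms(3)]]
  by (simp_all add: cov_def \<Gamma>_simps assms(1))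

lemma dird_uminus: "P differentiable (at z) \<Longrightarrow> dird (\<lambda>z. - P z) z A = - dird P z A"
  by (rule dirdI) (intro derivative_intros has_dird)

lemma cov_uminus:
  assumes "\<gamma> z \<in> Om" "P differentiable (at z)"
  shows "cov \<gamma> (\<lambda>z. - P z) z A = - cov \<gamma> P z A"
  using assms by (simp add: cov_def dird_uminus \<Gamma>_simps)

lemma cov_cong:
  assumes "open U" "z \<in> U" "\<And>y. y \<in> U \<Longrightarrow> P y = Q y" "P differentiable (at z)"
  shows "cov \<gamma> P z A = cov \<gamma> Q z A"
  unfolding cov_def using dird_cong[OF assms] assms(2,3) by simp

lemma cov_has_derivative:
  assumes "open U" "z \<in> U" "\<forall>y\<in>U. \<gamma> y \<in> Om"
    and t: "twice_differentiable_on \<gamma> U" "twice_differentiable_on P U"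
  shows "((\<lambda>z. cov \<gamma> P z B) has_derivative
    (\<lambda>A. dird (\<lambda>z. dird P z B) z A + (dird (\<lambda>q. \<Gamma> q (dird \<gamma> z B) (P z)) (\<gamma> z) (dird \<gamma> z A)
      + \<Gamma> (\<gamma> z) (dird (\<lambda>z. dird \<gamma> z B) z A) (P z) + \<Gamma> (\<gamma> z) (dird \<gamma> z B) (dird P z A)))) (at z)"
  unfolding cov_def
  by (intro has_derivative_add has_derivative_bilinear_field[OF open_Om _ \<Gamma>_bilinear \<Gamma>_diff]
      has_dird assms(2) bspec[OF assms(3,2)] twice_differentiable_onD[OF t(1)] twice_differentiable_onD[OF t(2)])

text \<open>The second derivatives of \<open>P\<close> and of \<open>\<gamma>\<close> cancel by
  symmetry, as do the terms with one derivative of \<open>P\<close>. The derivatives of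
  \<open>\<Gamma>\<close> and its quadratic terms remain. There is no bracket term because
  \<open>A\<close> and \<open>B\<close> are constant fields.\<close>

lemma cov_commute:
  assumes U: "open U" "z \<in> U" "\<forall>y\<in>U. \<gamma> y \<in> Om"
    and t: "twice_differentiable_on \<gamma> U" "twice_differentiable_on P U"
  shows "cov \<gamma> (\<lambda>z. cov \<gamma> P z B) z A - cov \<gamma> (\<lambda>z. cov \<gamma> P z A) z B
    = curv (\<gamma> z) (dird \<gamma> z A) (dird \<gamma> z B) (P z)"
proof -
  have c: "cov \<gamma> (\<lambda>z. cov \<gamma> P z B) z A =
     dird (\<lambda>z. dird P z B) z A + (dird (\<lambda>q. \<Gamma> q (dird \<gamma> z B) (P z)) (\<gamma> z) (dird \<gamma> z A)
      + \<Gamma> (\<gamma> z) (dird (\<lambda>z. dird \<gamma> z B) z A) (P z) + \<Gamma> (\<gamma> z) (dird \<gamma> z B) (dird P z A))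
      + \<Gamma> (\<gamma> z) (dird \<gamma> z A) (dird P z B) + \<Gamma> (\<gamma> z) (dird \<gamma> z A) (\<Gamma> (\<gamma> z) (dird \<gamma> z B) (P z))" for A B
  proof -
    have "cov \<gamma> (\<lambda>z. cov \<gamma> P z B) z A = dird (\<lambda>z. cov \<gamma> P z B) z A + \<Gamma> (\<gamma> z) (dird \<gamma> z A) (cov \<gamma> P z B)"
      by (simp only: cov_def[of \<gamma> "\<lambda>z. cov \<gamma> P z B"])
    then show ?thesis
      using dirdI[OF cov_has_derivative[OF U t], of B A] by (simp add: cov_def[of \<gamma> P z B] \<Gamma>_simps U)
  qed
  show ?thesis
    unfolding c curv_def
    using twice_differentiable_on_sym[OF t(1) U(1,2), of A B] twice_differentiable_on_sym[OF t(2) U(1,2), of A B]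
    by simp
qed

section \<open>Symmetries and sign of the curvature tensor\<close>

lemma curv_anti: "curv q u v w = - curv q v u w"
  by (simp add: curv_def)

lemma curv_bianchi:
  assumes q: "q \<in> Om" shows "curv q u v w + curv q v w u + curv q w u v = 0"
proof -
  have "dird (\<lambda>q. \<Gamma> q u v) q w = dird (\<lambda>q. \<Gamma> q v u) q w" for u v w
    by (rule dird_cong[OF open_Om q]) (simp_all add: \<Gamma>_sym \<Gamma>_diff q)
  then show ?thesis
    by (simp add: curv_def \<Gamma>_sym[OF q, of w] \<Gamma>_sym[OF q, of v u])
qed

text \<open>The function \<open>G q w x\<close> with constant \<open>w\<close> and \<open>x\<close>
  has symmetric second derivatives. Applying compatibility twice expresses them through
  \<open>\<Gamma>\<close>, and their antisymmetric part is the curvature acting on \<open>w\<close>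
  plus the curvature acting on \<open>x\<close>. The covariant derivative is taken along the
  identity map.\<close>

lemma curv_skew:
  assumes q: "q \<in> Om" shows "G q (curv q u v w) x = - G q (curv q u v x) w"
proof -
  have id: "dird (\<lambda>q::'v. q) z A = A" for z A by simp
  have c: "cov (\<lambda>q. q) (\<lambda>q. \<Gamma> q v w) q u = dird (\<lambda>q. \<Gamma> q v w) q u + \<Gamma> q u (\<Gamma> q v w)"
     "cov (\<lambda>q. q) (\<lambda>q. x) q u = \<Gamma> q u x" for u v w x
    by (simp_all add: cov_def)
  have "dird (\<lambda>y. dird (\<lambda>q. G q w x) y v) q u =
     G q (dird (\<lambda>q. \<Gamma> q v w) q u + \<Gamma> q u (\<Gamma> q v w)) x + G q (\<Gamma> q v w) (\<Gamma> q u x)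
     + (G q (\<Gamma> q u w) (\<Gamma> q v x) + G q w (dird (\<lambda>q. \<Gamma> q v x) q u + \<Gamma> q u (\<Gamma> q v x)))" for u v
  proof (rule dirdI, rule has_derivative_transform_within_open[OF _ open_Om q])
    show "G y (\<Gamma> y v w) x + G y w (\<Gamma> y v x) = dird (\<lambda>q. G q w x) y v" if "y \<in> Om" for y
      using compatible[OF that] by simp
    show "((\<lambda>y. G y (\<Gamma> y v w) x + G y w (\<Gamma> y v x)) has_derivative (\<lambda>u.
       G q (dird (\<lambda>q. \<Gamma> q v w) q u + \<Gamma> q u (\<Gamma> q v w)) x + G q (\<Gamma> q v w) (\<Gamma> q u x)
     + (G q (\<Gamma> q u w) (\<Gamma> q v x) + G q w (dird (\<lambda>q. \<Gamma> q v x) q u + \<Gamma> q u (\<Gamma> q v x))))) (at q)"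
      using has_derivative_add[OF
          has_derivative_G[of "\<lambda>q. q" q "\<lambda>q. \<Gamma> q v w" "\<lambda>_. x"] has_derivative_G[of "\<lambda>q. q" q "\<lambda>_. w" "\<lambda>q. \<Gamma> q v x"]]
      by (simp add: c q \<Gamma>_diff)
  qed
  from this[of u v] this[of v u] twice_differentiable_on_sym[OF G_twice open_Om q, of w x u v]
  show ?thesis
    by (simp add: curv_def G_simps[OF q] G_sym[OF q, of w])
qed

text \<open>The classical combination of four Bianchi identities, one for each cyclic shift of the
  arguments; skew-symmetry in either pair cancels all other terms.\<close>

lemma curv_pair:
  assumes q: "q \<in> Om" shows "G q (curv q u v w) x = G q (curv q w x u) v"
proof -
  have b: "G q (curv q u v w) x + G q (curv q v w u) x + G q (curv q w u v) x = 0" for u v w x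
    using arg_cong[OF curv_bianchi[OF q, of u v w], of "\<lambda>y. G q y x"] by (simp add: G_simps[OF q])
  have a: "G q (curv q u v w) x = - G q (curv q v u w) x" for u v w x
    using curv_anti[of q u v w] by (simp add: G_simps[OF q])
  show ?thesis
    using b[of u v w x] b[of v w x u] b[of w x u v] b[of x u v w]
      a[of w u v x] curv_skew[OF q, of v w x u] curv_skew[OF q, of w x v u]
      a[of x v w u] curv_skew[OF q, of v x w u] a[of x u w v] curv_skew[OF q, of u x w v]
      curv_skew[OF q, of u w x v] a[of x u v w] curv_skew[OF q, of u v x w]
    by linarith
qed

text \<open>The sectional curvature is this number divided by the Gram determinant, which is
  positive for independent vectors. For dependent vectors skew-symmetry makes the number itself
  zero, so the bound holds for all pairs.\<close>

lemma curv_nonpositive: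
  assumes q: "q \<in> Om" and s: "u \<noteq> v \<Longrightarrow> independent {u, v} \<Longrightarrow> sectional_curvature G q u v \<le> 0"
  shows "G q (curv q u v v) u \<le> 0"
proof (cases "\<exists>c. u = c *\<^sub>R v \<or> v = c *\<^sub>R u")
  case True
  moreover have "G q (curv q u v x) x = 0" for x
    using curv_skew[OF q, of u v x x] by simp
  moreover have "G q (curv q u v v) u = - G q (curv q u v u) v" by (rule curv_skew[OF q])
  ultimately show ?thesis by (metis G_simps(8)[OF q] mult_zero_right neg_equal_zero order_refl)
next
  case False
  have uv: "u \<noteq> v" "u \<noteq> 0" "v \<noteq> 0" using False by (metis scaleR_one scaleR_zero_left)+
  have "independent {u, v}"
    using uv False by (auto simp: independent_insert span_singleton)
  then have s: "sectional_curvature G q u v \<le> 0" using s uv by blast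
  \<comment> \<open>This is \<open>G q v v\<close> times the component of \<open>u\<close>
    orthogonal to \<open>v\<close>; its squared length is \<open>G q v v\<close> times the Gram
    determinant.\<close>
  define w where "w = (G q v v) *\<^sub>R u - (G q u v) *\<^sub>R v"
  have vv: "G q v v > 0" using G_pos[OF q uv(3)] .
  have "w \<noteq> 0"
  proof
    assume "w = 0"
    then have e: "G q v v *\<^sub>R u = G q u v *\<^sub>R v" by (simp add: w_def)
    have "u = inverse (G q v v) *\<^sub>R (G q v v *\<^sub>R u)" using vv by simp
    then have "u = (inverse (G q v v) * G q u v) *\<^sub>R v" unfolding e by simp
    then show False using False by blast
  qed
  then have "0 < G q w w" by (rule G_pos[OF q])
  also have "G q w w = G q v v * (G q u u * G q v v - (G q u v)\<^sup>2)"
    by (simp add: w_def G_simps[OF q] G_sym[OF q, of v u] algebra_simps power2_eq_square)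
  finally have "G q u u * G q v v - (G q u v)\<^sup>2 > 0" using vv by (simp add: zero_less_mult_iff)
  then show ?thesis using s unfolding sectional_curvature_def riemann_curvature_eq[OF q]
    by (simp add: divide_le_0_iff)
qed

text \<open>The fields \<open>P\<close> and \<open>Q\<close> are the two components of a section of the complexified pullback
  bundle which is annihilated by all \<open>\<nabla>\<^bsub>A + i J A\<^esub>\<close>.\<close>

definition holomorphic_pair ::
  "('e::real_normed_vector \<Rightarrow> 'e) \<Rightarrow> 'e set \<Rightarrow> ('e \<Rightarrow> 'v) \<Rightarrow> ('e \<Rightarrow> 'v) \<Rightarrow> ('e \<Rightarrow> 'v) \<Rightarrow> bool" where
  "holomorphic_pair J U \<gamma> P Q \<longleftrightarrow>
     twice_differentiable_on P U \<and> twice_differentiable_on Q U \<and>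
     (\<forall>z\<in>U. \<forall>A. cov \<gamma> P z A + cov \<gamma> Q z (J A) = 0)"

text \<open>The two Cauchy-Riemann equations; the second is the defining condition at
  \<open>J A\<close>.\<close>

lemma holomorphic_pairD:
  assumes h: "holomorphic_pair J U \<gamma> P Q" and J: "\<And>A. J (J A) = - A"
    and U: "\<forall>y\<in>U. \<gamma> y \<in> Om" "twice_differentiable_on \<gamma> U" and z: "z \<in> U"
  shows "cov \<gamma> Q z (J A) = - cov \<gamma> P z A" "cov \<gamma> Q z A = cov \<gamma> P z (J A)"
proof -
  have *: "cov \<gamma> P z A + cov \<gamma> Q z (J A) = 0" for A using h z by (simp add: holomorphic_pair_def)
  show "cov \<gamma> Q z (J A) = - cov \<gamma> P z A" using *[of A] by (simp add: add_eq_0_iff)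
  have "cov \<gamma> Q z (J (J A)) = - cov \<gamma> Q z A" unfolding J
    using h z U by (intro cov_linear) (auto simp: holomorphic_pair_def twice_differentiable_on_def)
  then show "cov \<gamma> Q z A = cov \<gamma> P z (J A)" using *[of "J A"] by simp
qed

lemma twice_differentiable_on_uminus:
  assumes "twice_differentiable_on P U" "open U" shows "twice_differentiable_on (\<lambda>z. - P z) U"
proof -
  have "(\<lambda>z. dird (\<lambda>z. - P z) z v) differentiable (at z)" if "z \<in> U" for z v
    by (rule differentiable_cong_open[OF assms(2) that, of "\<lambda>z. - dird P z v"])
      (use assms that in \<open>auto simp: twice_differentiable_on_def dird_uminus\<close>)
  then show ?thesis using assms by (auto simp: twice_differentiable_on_def)
qed

text \<open>Multiplication of \<open>P - i Q\<close> by \<open>i\<close> gives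
  \<open>Q - i (- P)\<close>. Through this rotation, a statement about the real part of a complex
  identity also yields its imaginary part.\<close>

lemma holomorphic_pair_rotate:
  assumes h: "holomorphic_pair J U \<gamma> P Q" and J: "\<And>A. J (J A) = - A" and "open U"
    and U: "\<forall>y\<in>U. \<gamma> y \<in> Om" "twice_differentiable_on \<gamma> U"
  shows "holomorphic_pair J U \<gamma> Q (\<lambda>z. - P z)"
  using h holomorphic_pairD[OF h J U] U assms(3)
  by (auto simp: holomorphic_pair_def twice_differentiable_on_uminus cov_uminus twice_differentiable_onD)

text \<open>The operators \<open>\<nabla>\<^bsub>A + i J A\<^esub>\<close> and \<open>\<nabla>\<^bsub>B + i J B\<^esub>\<close> both kill \<open>P - i Q\<close>, hence so does the
  curvature in these two directions; this is its real part.\<close>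

lemma holomorphic_pair_curv:
  assumes h: "holomorphic_pair J U \<gamma> P Q" and J: "\<And>A. J (J A) = - A"
    and U: "open U" "\<forall>y\<in>U. \<gamma> y \<in> Om" "twice_differentiable_on \<gamma> U" and z: "z \<in> U"
  shows "curv (\<gamma> z) (dird \<gamma> z A) (dird \<gamma> z B) (P z) + curv (\<gamma> z) (dird \<gamma> z (J A)) (dird \<gamma> z B) (Q z)
    + curv (\<gamma> z) (dird \<gamma> z A) (dird \<gamma> z (J B)) (Q z) - curv (\<gamma> z) (dird \<gamma> z (J A)) (dird \<gamma> z (J B)) (P z) = 0"
proof -
  have P: "twice_differentiable_on P U" and Q: "twice_differentiable_on Q U"
    using h by (auto simp: holomorphic_pair_def)
  have cd: "(\<lambda>y. cov \<gamma> P y A) differentiable (at z)" for A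
    using cov_has_derivative[OF U(1) z U(2,3) P] by (auto simp: differentiable_def)
  have c1: "cov \<gamma> (\<lambda>y. cov \<gamma> Q y (J A)) z B = - cov \<gamma> (\<lambda>y. cov \<gamma> P y A) z B" for A B
  proof -
    have "cov \<gamma> (\<lambda>y. - cov \<gamma> P y A) z B = cov \<gamma> (\<lambda>y. cov \<gamma> Q y (J A)) z B"
      by (rule cov_cong[OF U(1) z]) (use cd holomorphic_pairD[OF h J U(2,3)] in auto)
    then show ?thesis using cov_uminus[of \<gamma> z "\<lambda>y. cov \<gamma> P y A"] U z cd by simp
  qed
  have c2: "cov \<gamma> (\<lambda>y. cov \<gamma> Q y A) z B = cov \<gamma> (\<lambda>y. cov \<gamma> P y (J A)) z B" for A B
    by (rule cov_cong[OF U(1) z, symmetric]) (use cd holomorphic_pairD[OF h J U(2,3)] in auto)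
  \<comment> \<open>Each curvature term is a commutator of second covariant derivatives. The
    Cauchy-Riemann equations express all of them by second derivatives of \<open>P\<close>, which
    cancel in pairs.\<close>
  show ?thesis
    unfolding cov_commute[OF U(1) z U(2,3) P, of B A, symmetric] cov_commute[OF U(1) z U(2,3) Q, of B "J A", symmetric]
      cov_commute[OF U(1) z U(2,3) Q, of "J B" A, symmetric] cov_commute[OF U(1) z U(2,3) P, of "J B" "J A", symmetric]
      c1[of A B] c1[of B A] c2[of B "J A"] c2[of A "J B"]
    by simp
qed

section \<open>The energy of a pair of fields and its Bochner inequality\<close>

definition energy :: "('e::real_normed_vector \<Rightarrow> 'v) \<Rightarrow> ('e \<Rightarrow> 'v) \<Rightarrow> ('e \<Rightarrow> 'v) \<Rightarrow> 'e \<Rightarrow> real" where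
  "energy \<gamma> P Q z = G (\<gamma> z) (P z) (P z) + G (\<gamma> z) (Q z) (Q z)"

lemma energy_has_derivative:
  assumes "\<gamma> z \<in> Om" "\<gamma> differentiable (at z)" "P differentiable (at z)" "Q differentiable (at z)"
  shows "(energy \<gamma> P Q has_derivative
     (\<lambda>A. 2 * (G (\<gamma> z) (cov \<gamma> P z A) (P z) + G (\<gamma> z) (cov \<gamma> Q z A) (Q z)))) (at z)"
  unfolding energy_def[abs_def]
  by (rule has_derivative_eq_rhs[OF has_derivative_add[OF has_derivative_G[OF assms(1,2,3,3)] has_derivative_G[OF assms(1,2,4,4)]]])
    (simp add: fun_eq_iff G_sym[OF assms(1), of "P z"] G_sym[OF assms(1), of "Q z"])

lemma energy_second_derivative:
  assumes U: "open U" "\<forall>y\<in>U. \<gamma> y \<in> Om" "twice_differentiable_on \<gamma> U"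
    and P: "twice_differentiable_on P U" and Q: "twice_differentiable_on Q U" and z: "z \<in> U"
  shows "((\<lambda>y. dird (energy \<gamma> P Q) y A) has_derivative
     (\<lambda>B. 2 * (G (\<gamma> z) (cov \<gamma> (\<lambda>y. cov \<gamma> P y A) z B) (P z) + G (\<gamma> z) (cov \<gamma> P z A) (cov \<gamma> P z B)
       + (G (\<gamma> z) (cov \<gamma> (\<lambda>y. cov \<gamma> Q y A) z B) (Q z) + G (\<gamma> z) (cov \<gamma> Q z A) (cov \<gamma> Q z B))))) (at z)"
proof (rule has_derivative_transform_within_open[OF _ U(1) z])
  show "2 * (G (\<gamma> y) (cov \<gamma> P y A) (P y) + G (\<gamma> y) (cov \<gamma> Q y A) (Q y)) = dird (energy \<gamma> P Q) y A"
    if "y \<in> U" for y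
    by (rule dirdI[symmetric], rule energy_has_derivative)
      (use that U P Q in \<open>auto simp: twice_differentiable_on_def\<close>)
  have cd: "(\<lambda>y. cov \<gamma> P y A) differentiable (at z)" "(\<lambda>y. cov \<gamma> Q y A) differentiable (at z)"
    using cov_has_derivative[OF U(1) z U(2,3) P] cov_has_derivative[OF U(1) z U(2,3) Q]
    by (auto simp: differentiable_def)
  show "((\<lambda>y. 2 * (G (\<gamma> y) (cov \<gamma> P y A) (P y) + G (\<gamma> y) (cov \<gamma> Q y A) (Q y))) has_derivative
     (\<lambda>B. 2 * (G (\<gamma> z) (cov \<gamma> (\<lambda>y. cov \<gamma> P y A) z B) (P z) + G (\<gamma> z) (cov \<gamma> P z A) (cov \<gamma> P z B)
       + (G (\<gamma> z) (cov \<gamma> (\<lambda>y. cov \<gamma> Q y A) z B) (Q z) + G (\<gamma> z) (cov \<gamma> Q z A) (cov \<gamma> Q z B))))) (at z)"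
    by (intro derivative_intros has_derivative_G cd)
      (use z U P Q in \<open>auto simp: twice_differentiable_on_def\<close>)
qed

lemma energy_twice_differentiable:
  assumes U: "open U" "\<forall>y\<in>U. \<gamma> y \<in> Om" "twice_differentiable_on \<gamma> U"
    and P: "twice_differentiable_on P U" and Q: "twice_differentiable_on Q U"
  shows "twice_differentiable_on (energy \<gamma> P Q) U"
  unfolding twice_differentiable_on_def
proof (intro ballI conjI allI)
  fix z assume z: "z \<in> U"
  show "energy \<gamma> P Q differentiable (at z)"
    using energy_has_derivative[of \<gamma> z P Q] z U P Q
    by (auto simp: twice_differentiable_on_def differentiable_def)
  show "(\<lambda>z. dird (energy \<gamma> P Q) z v) differentiable at z" for v
    using energy_second_derivative[OF U P Q z] by (auto simp: differentiable_def)
qed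

text \<open>The complex vectors are \<open>p - i q\<close> and \<open>P - i Q\<close>.\<close>

lemma hermitian_cauchy_schwarz:
  assumes x: "x \<in> Om"
  shows "(G x p P + G x q Q)\<^sup>2 + (G x q P - G x p Q)\<^sup>2
    \<le> (G x p p + G x q q) * (G x P P + G x Q Q)"
proof (cases "P = 0 \<and> Q = 0")
  case True
  then show ?thesis by (simp add: G_simps[OF x])
next
  case False
  define E where "E = G x P P + G x Q Q"
  define a where "a = G x p P + G x q Q"
  define b where "b = G x q P - G x p Q"
  have E: "E > 0"
    unfolding E_def using False G_pos[OF x, of P] G_pos[OF x, of Q] G_nonneg[OF x, of P] G_nonneg[OF x, of Q] by linarith
  \<comment> \<open>With the Hermitian product \<open>a - i b\<close> of \<open>p - i q\<close> and
    \<open>P - i Q\<close>, the vector \<open>p' - i q'\<close> is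
    \<open>E (p - i q) - (a - i b) (P - i Q)\<close>, that is, \<open>E\<close> times the component
    orthogonal to \<open>P - i Q\<close>.\<close>
  define p' where "p' = E *\<^sub>R p - a *\<^sub>R P + b *\<^sub>R Q"
  define q' where "q' = E *\<^sub>R q - a *\<^sub>R Q - b *\<^sub>R P"
  have "G x p' p' + G x q' q' = E * (E * (G x p p + G x q q)) - 2 * E * (a * (G x p P + G x q Q))
      - 2 * E * (b * (G x q P - G x p Q)) + (a * a + b * b) * (G x P P + G x Q Q)"
    unfolding p'_def q'_def
    by (simp add: G_simps[OF x] G_sym[OF x, of P p] G_sym[OF x, of P q] G_sym[OF x, of Q P] G_sym[OF x, of Q p] G_sym[OF x, of Q q]) (simp add: algebra_simps)
  also have "\<dots> = E * (E * (G x p p + G x q q) - (a\<^sup>2 + b\<^sup>2))"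
    unfolding a_def[symmetric] b_def[symmetric] E_def[symmetric] by (simp add: algebra_simps power2_eq_square)
  finally have "0 \<le> E * (E * (G x p p + G x q q) - (a\<^sup>2 + b\<^sup>2))"
    using G_nonneg[OF x, of p'] G_nonneg[OF x, of q'] by linarith
  then have "0 \<le> E * (G x p p + G x q q) - (a\<^sup>2 + b\<^sup>2)" using E by (simp add: zero_le_mult_iff)
  then show ?thesis unfolding a_def b_def E_def by (simp add: algebra_simps)
qed

text \<open>The curvature term is the sum of four sectional curvatures: the part
  \<open>R(X, Y, \<bar>X, \<bar>Y)\<close> of the polarization vanishes by the curvature constraint for \<open>X = X1 - i X2\<close>.\<close>

lemma curvature_term:
  assumes x: "x \<in> Om" and nonpos: "\<And>u v. G x (curv x u v v) u \<le> 0"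
    and c1: "curv x X1 P X1 + curv x X2 P X2 + curv x X1 Q X2 - curv x X2 Q X1 = 0"
    and c2: "curv x X1 P X2 + curv x X2 P (- X1) + curv x X1 Q (- X1) - curv x X2 Q X2 = 0"
  shows "G x (curv x X1 X2 P) Q \<ge> 0"
proof -
  define r where "r u v w y = G x (curv x u v w) y" for u v w y
  have skew: "r u v w y = - r u v y w" for u v w y unfolding r_def by (rule curv_skew[OF x])
  have anti: "r u v w y = - r v u w y" for u v w y
    unfolding r_def using curv_anti[of x u v w] by (simp add: G_simps[OF x])
  have pair: "r u v w y = r w y u v" for u v w y unfolding r_def by (rule curv_pair[OF x])
  have bi: "r u v w y + r v w u y + r w u v y = 0" for u v w y
    unfolding r_def using arg_cong[OF curv_bianchi[OF x, of u v w], of "\<lambda>z. G x z y"] by (simp add: G_simps[OF x])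
  \<comment> \<open>The sign is moved by skew-symmetry into the last slot, where linearity is that
    of \<open>G\<close>; linearity of \<open>curv\<close> in its third argument is thereby
    avoided.\<close>
  have neg: "r u v (- w) y = - r u v w y" for u v w y
    using skew[of u v "- w" y] skew[of u v w y] by (simp add: r_def G_simps[OF x])
  \<comment> \<open>For X = X1 - i X2 and Y = P - i Q, the hypotheses \<open>c1\<close> and
    \<open>c2\<close> are the real part and the negative imaginary part of R(conj X, conj Y) X = 0.
    The difference of \<open>e1\<close> and \<open>e2\<close> is the real part of its pairing with
    Y.\<close>
  have e1: "r X1 P X1 P + r X2 P X2 P + r X1 Q X2 P - r X2 Q X1 P = 0"
    using arg_cong[OF c1, of "\<lambda>z. G x z P"] by (simp add: G_simps[OF x] r_def)
  have e2: "r X1 P X2 Q - r X2 P X1 Q - r X1 Q X1 Q - r X2 Q X2 Q = 0"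
    using arg_cong[OF c2, of "\<lambda>z. G x z Q"] neg[unfolded r_def] by (simp add: G_simps[OF x] r_def)
  have "r u v u v \<ge> 0" for u v using nonpos[of u v] skew[of u v u v] by (simp add: r_def)
  then have "0 \<le> r X1 P X1 P + r X2 P X2 P + r X1 Q X1 Q + r X2 Q X2 Q" by (simp add: add_nonneg_nonneg)
  \<comment> \<open>By the Bianchi identity \<open>r X1 X2 P Q\<close> is a difference of mixed
    terms. Substituted into the difference of \<open>e1\<close> and \<open>e2\<close>, it shows that
    the four sectional terms add up to twice \<open>r X1 X2 P Q\<close>.\<close>
  moreover have "r X1 X2 P Q = - r X2 P X1 Q - r P X1 X2 Q" using bi[of X1 X2 P Q] by linarith
  ultimately have "0 \<le> r X1 X2 P Q"
    using e1 e2 anti[of P X1 X2 Q] pair[of X2 P X1 Q] pair[of X2 Q X1 P] by linarith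
  then show ?thesis by (simp add: r_def)
qed

text \<open>This is \<open>E * \<Delta>E \<ge> \<bar>\<nabla>E\<bar>\<^sup>2\<close> for the energy \<open>E\<close> on the plane spanned by \<open>A\<close> and \<open>J A\<close>, i.e. the
  subharmonicity of \<open>log E\<close>.\<close>

lemma energy_log_subharmonic:
  assumes h: "holomorphic_pair J U \<gamma> P Q" and J: "\<And>A. J (J A) = - A"
    and U: "open U" "\<forall>y\<in>U. \<gamma> y \<in> Om" "twice_differentiable_on \<gamma> U" and z: "z \<in> U"
    and nonpos: "\<And>u v. G (\<gamma> z) (curv (\<gamma> z) u v v) u \<le> 0"
    and h': "holomorphic_pair J U \<gamma> P' Q'" "P' z = dird \<gamma> z A" "Q' z = dird \<gamma> z (J A)"
    and B: "dird \<gamma> z B = P z" "dird \<gamma> z (J B) = Q z"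
  defines "E \<equiv> energy \<gamma> P Q"
  shows "(dird E z A)\<^sup>2 + (dird E z (J A))\<^sup>2 \<le>
    E z * (dird (\<lambda>y. dird E y A) z A + dird (\<lambda>y. dird E y (J A)) z (J A))"
proof -
  define x where "x = \<gamma> z"
  define p where "p = cov \<gamma> P z A"
  define q where "q = cov \<gamma> P z (J A)"
  have x: "x \<in> Om" unfolding x_def using U z by simp
  have P: "twice_differentiable_on P U" and Q: "twice_differentiable_on Q U"
    using h by (auto simp: holomorphic_pair_def)
  have cQ: "cov \<gamma> Q z A = q" "cov \<gamma> Q z (J A) = - p"
    unfolding p_def q_def using holomorphic_pairD[OF h J U(2,3) z] by auto
  have cd: "(\<lambda>y. cov \<gamma> P y A) differentiable (at z)" for A
    using cov_has_derivative[OF U(1) z U(2,3) P] by (auto simp: differentiable_def)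
  have cc1: "cov \<gamma> (\<lambda>y. cov \<gamma> Q y (J A)) z B = - cov \<gamma> (\<lambda>y. cov \<gamma> P y A) z B" for B
  proof -
    have "cov \<gamma> (\<lambda>y. - cov \<gamma> P y A) z B = cov \<gamma> (\<lambda>y. cov \<gamma> Q y (J A)) z B"
      by (rule cov_cong[OF U(1) z]) (use cd holomorphic_pairD[OF h J U(2,3)] in auto)
    then show ?thesis using cov_uminus[of \<gamma> z "\<lambda>y. cov \<gamma> P y A"] U z cd by simp
  qed
  have cc2: "cov \<gamma> (\<lambda>y. cov \<gamma> Q y A) z B = cov \<gamma> (\<lambda>y. cov \<gamma> P y (J A)) z B" for B
    by (rule cov_cong[OF U(1) z, symmetric]) (use cd holomorphic_pairD[OF h J U(2,3)] in auto)
  define X1 where "X1 = dird \<gamma> z A"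
  define X2 where "X2 = dird \<gamma> z (J A)"
  note com = cov_commute[OF U(1) z U(2,3)]
  have k1: "cov \<gamma> (\<lambda>y. cov \<gamma> P y (J A)) z A - cov \<gamma> (\<lambda>y. cov \<gamma> P y A) z (J A) = curv x X1 X2 (P z)"
    unfolding x_def X1_def X2_def by (rule com[OF P])
  \<comment> \<open>By the Cauchy-Riemann equations the Laplacian of \<open>P\<close> over this
    plane is a commutator of second derivatives of \<open>Q\<close>, hence a pure curvature
    term.\<close>
  have k2: "cov \<gamma> (\<lambda>y. cov \<gamma> P y A) z A + cov \<gamma> (\<lambda>y. cov \<gamma> P y (J A)) z (J A) = - curv x X1 X2 (Q z)"
    using arg_cong[OF com[OF Q, of "J A" A], of uminus]
    unfolding cc1[of A] cc2[of "J A"] x_def X1_def X2_def by (simp add: add.commute)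
  have d1: "dird E z A = 2 * (G x p (P z) + G x q (Q z))" "dird E z (J A) = 2 * (G x q (P z) - G x p (Q z))"
    unfolding E_def
    using dirdI[OF energy_has_derivative[of \<gamma> z P Q]] U(2,3) P Q z cQ
    by (auto simp: twice_differentiable_on_def G_simps[OF x] x_def[symmetric] p_def[symmetric] q_def[symmetric])
  note e2 = dirdI[OF energy_second_derivative[OF U P Q z], folded E_def x_def]
  have "dird (\<lambda>y. dird E y A) z A + dird (\<lambda>y. dird E y (J A)) z (J A)
    = 4 * (G x p p + G x q q) + 2 * (G x (cov \<gamma> (\<lambda>y. cov \<gamma> P y A) z A + cov \<gamma> (\<lambda>y. cov \<gamma> P y (J A)) z (J A)) (P z)
      + G x (cov \<gamma> (\<lambda>y. cov \<gamma> P y (J A)) z A - cov \<gamma> (\<lambda>y. cov \<gamma> P y A) z (J A)) (Q z))"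
    unfolding e2 cQ cc1[of "J A"] cc2[of A] cc1[of "J A"] p_def[symmetric] q_def[symmetric]
    by (simp add: G_simps[OF x])
  also have "\<dots> = 4 * (G x p p + G x q q) + 4 * G x (curv x X1 X2 (P z)) (Q z)"
    unfolding k1 k2 using curv_skew[OF x, of X1 X2 "Q z" "P z"] by (simp add: G_simps[OF x])
  finally have lap: "dird (\<lambda>y. dird E y A) z A + dird (\<lambda>y. dird E y (J A)) z (J A)
    = 4 * (G x p p + G x q q) + 4 * G x (curv x X1 X2 (P z)) (Q z)" .
  have "G x (curv x X1 X2 (P z)) (Q z) \<ge> 0"
  proof (rule curvature_term[OF x])
    show "G x (curv x u v v) u \<le> 0" for u v using nonpos unfolding x_def .
    show "curv x X1 (P z) X1 + curv x X2 (P z) X2 + curv x X1 (Q z) X2 - curv x X2 (Q z) X1 = 0"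
      using holomorphic_pair_curv[OF h'(1) J U z, of A B] unfolding h' B x_def X1_def X2_def .
    show "curv x X1 (P z) X2 + curv x X2 (P z) (- X1) + curv x X1 (Q z) (- X1) - curv x X2 (Q z) X2 = 0"
      using holomorphic_pair_curv[OF holomorphic_pair_rotate[OF h'(1) J U] J U z, of A B]
      unfolding h' B x_def X1_def X2_def .
  qed
  \<comment> \<open>Without the nonnegative curvature term the Laplacian of the energy is four times
    the squared norm of \<open>p - i q\<close>. The squared gradient is four times the squared
    modulus of its Hermitian product with \<open>P - i Q\<close>, so that Cauchy-Schwarz finishes
    the estimate.\<close>
  then have "4 * ((G x p p + G x q q) * (G x (P z) (P z) + G x (Q z) (Q z)))
     \<le> E z * (dird (\<lambda>y. dird E y A) z A + dird (\<lambda>y. dird E y (J A)) z (J A))"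
    unfolding lap using G_nonneg[OF x, of "P z"] G_nonneg[OF x, of "Q z"]
    by (simp add: E_def energy_def x_def[symmetric] algebra_simps)
  with hermitian_cauchy_schwarz[OF x, of p "P z" q "Q z"] show ?thesis
    unfolding d1 power_mult_distrib by simp
qed

end


section \<open>Wirtinger derivatives\<close>

lemma scaleR_eq_smult: "r *\<^sub>R (v::complex^'n) = complex_of_real r *s v"
  by (simp add: vec_eq_iff scaleR_conv_of_real[where 'a=complex])

lemma smult_i_i: "\<i> *s (\<i> *s v) = - (v::complex^'n)"
  by (simp add: vec_eq_iff)

lemma smult_complex_split: "a *s (v::complex^'n) = Re a *\<^sub>R v + Im a *\<^sub>R (\<i> *s v)"
  by (simp add: vec_eq_iff scaleR_conv_of_real[where 'a=complex] complex_eq_iff)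

lemma smult_i_axis: "\<i> *s axis j 1 = axis j \<i>"
  by (simp add: vec_eq_iff axis_def)

lemma bounded_linear_smult: "bounded_linear (\<lambda>v::complex^'n. a *s v)"
  by (intro linear_conv_bounded_linear[THEN iffD1] linearI)
    (simp_all add: vector_add_ldistrib scaleR_eq_smult vector_smult_assoc mult.commute)

lemma bounded_linear_smult_left: "bounded_linear (\<lambda>a. a *s (v::complex^'n))"
  by (intro linear_conv_bounded_linear[THEN iffD1] linearI)
    (simp_all add: vector_sadd_rdistrib scaleR_eq_smult vector_smult_assoc scaleR_conv_of_real[where 'a=complex])

text \<open>Up to their values on coordinate vectors, \<open>wirt\<close> and \<open>wirtbar\<close>
  are \<open>dz\<close> and \<open>dzbar\<close>. For real-linear \<open>L\<close> they are its
  complex-linear and conjugate-linear parts, which allows calculation with arbitrary vectors in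
  place of indices.\<close>

definition wirt :: "(complex^'n \<Rightarrow> complex) \<Rightarrow> complex^'n \<Rightarrow> complex" where
  "wirt L v = (L v - \<i> * L (\<i> *s v)) / 2"

definition wirtbar :: "(complex^'n \<Rightarrow> complex) \<Rightarrow> complex^'n \<Rightarrow> complex" where
  "wirtbar L v = (L v + \<i> * L (\<i> *s v)) / 2"

lemma dz_eq_wirt: "dz \<alpha> F z = wirt (dird F z) (axis \<alpha> 1)"
  by (simp add: dz_def wirt_def smult_i_axis)

lemma dzbar_eq_wirtbar: "dzbar \<alpha> F z = wirtbar (dird F z) (axis \<alpha> 1)"
  by (simp add: dzbar_def wirtbar_def smult_i_axis)

lemma linear_smult_split:
  assumes "linear (L :: complex^'n \<Rightarrow> complex)"
  shows "L (a *s v) = of_real (Re a) * L v + of_real (Im a) * L (\<i> *s v)"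
  by (subst smult_complex_split)
    (simp add: linear_add[OF assms] linear_scale[OF assms] scaleR_conv_of_real[where 'a=complex])

lemma linear_smult_i_split:
  assumes "linear (L :: complex^'n \<Rightarrow> complex)"
  shows "L (\<i> *s (a *s v)) = of_real (Re a) * L (\<i> *s v) - of_real (Im a) * L v"
  using linear_smult_split[OF assms, of "\<i> * a" v] by (simp add: vector_smult_assoc)

lemma wirt_smult:
  assumes "linear L" shows "wirt L (a *s v) = a * wirt L v"
  unfolding wirt_def linear_smult_split[OF assms, of a] linear_smult_i_split[OF assms, of a]
  by (subst (3) complex_eq[of a]) (simp add: algebra_simps)

lemma wirtbar_smult:
  assumes "linear L" shows "wirtbar L (a *s v) = cnj a * wirtbar L v"
proof -
  have e: "cnj a = of_real (Re a) - \<i> * of_real (Im a)" by (simp add: complex_eq_iff)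
  show ?thesis
    unfolding wirtbar_def linear_smult_split[OF assms, of a] linear_smult_i_split[OF assms, of a] e
    by (simp add: algebra_simps)
qed

lemma wirt_add:
  assumes "linear L" shows "wirt L (u + v) = wirt L u + wirt L v"
  by (simp add: wirt_def vector_add_ldistrib linear_add[OF assms] field_simps)

lemma wirtbar_add:
  assumes "linear L" shows "wirtbar L (u + v) = wirtbar L u + wirtbar L v"
  by (simp add: wirtbar_def vector_add_ldistrib linear_add[OF assms] field_simps)

lemma additive_sum:
  assumes "\<And>u v. h (u + v) = h u + h v" "h 0 = 0" "finite I"
  shows "h (sum f I) = (\<Sum>i\<in>I. h (f i))"
  using assms(3) by (induction I rule: finite_induct) (simp_all add: assms)

lemma wirt_expand:
  assumes "linear (L :: complex^'n \<Rightarrow> complex)"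
  shows "wirt L v = (\<Sum>j\<in>UNIV. v $ j * wirt L (axis j 1))"
proof -
  have "wirt L (\<Sum>j\<in>UNIV. v $ j *s axis j 1) = (\<Sum>j\<in>UNIV. wirt L (v $ j *s axis j 1))"
    by (rule additive_sum) (simp_all add: wirt_add assms, simp add: wirt_def linear_0[OF assms])
  then show ?thesis by (simp only: basis_expansion wirt_smult[OF assms])
qed

lemma wirtbar_expand:
  assumes "linear (L :: complex^'n \<Rightarrow> complex)"
  shows "wirtbar L v = (\<Sum>j\<in>UNIV. cnj (v $ j) * wirtbar L (axis j 1))"
proof -
  have "wirtbar L (\<Sum>j\<in>UNIV. v $ j *s axis j 1) = (\<Sum>j\<in>UNIV. wirtbar L (v $ j *s axis j 1))"
    by (rule additive_sum) (simp_all add: wirtbar_add assms, simp add: wirtbar_def linear_0[OF assms])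
  then show ?thesis by (simp only: basis_expansion wirtbar_smult[OF assms])
qed

lemma wirt_cmult_sum: "wirt (\<lambda>u. \<Sum>i\<in>I. c i * L i u) v = (\<Sum>i\<in>I. c i * wirt (L i) v)"
proof -
  have "wirt (\<lambda>u. \<Sum>i\<in>I. c i * L i u) v = (\<Sum>i\<in>I. (c i * L i v - \<i> * (c i * L i (\<i> *s v))) / 2)"
    unfolding wirt_def by (simp add: sum_distrib_left sum_subtractf sum_divide_distrib diff_divide_distrib)
  also have "\<dots> = (\<Sum>i\<in>I. c i * wirt (L i) v)"
    by (intro sum.cong refl) (simp add: wirt_def algebra_simps)
  finally show ?thesis .
qed

text \<open>The complex Hessian in terms of the real one. For \<open>w = v\<close> the last bracket
  vanishes by symmetry of \<open>H\<close>, and a quarter of the Laplacian on the complex line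
  through \<open>v\<close> is left.\<close>

lemma sum_dz_dzbar:
  fixes F :: "complex^'n \<Rightarrow> complex"
  assumes t: "twice_differentiable_on F U" and U: "open U" "z \<in> U"
  defines "H \<equiv> \<lambda>u v. dird (\<lambda>y. dird F y v) z u"
  shows "(\<Sum>\<alpha>\<in>UNIV. \<Sum>\<beta>\<in>UNIV. v $ \<alpha> * cnj (w $ \<beta>) * dz \<alpha> (dzbar \<beta> F) z) =
    (H v w + H (\<i> *s v) (\<i> *s w) + \<i> * (H v (\<i> *s w) - H (\<i> *s v) w)) / 4"
proof -
  note d1 = twice_differentiable_onD(1)[OF t] and d2 = twice_differentiable_onD(2)[OF t]
  have db: "((\<lambda>y. wirtbar (dird F y) x) has_derivative (\<lambda>u. (H u x + \<i> * H u (\<i> *s x)) / 2)) (at z)" for x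
    unfolding wirtbar_def H_def
    by (intro bounded_linear.has_derivative[OF bounded_linear_divide] derivative_intros has_dird d2 U)
  have dbl: "linear (dird (\<lambda>y. wirtbar (dird F y) x) z)" for x
    by (rule dird_linear) (use db in \<open>auto simp: differentiable_def\<close>)
  have "(\<Sum>\<alpha>\<in>UNIV. \<Sum>\<beta>\<in>UNIV. v $ \<alpha> * cnj (w $ \<beta>) * dz \<alpha> (dzbar \<beta> F) z)
    = (\<Sum>\<beta>\<in>UNIV. cnj (w $ \<beta>) * (\<Sum>\<alpha>\<in>UNIV. v $ \<alpha> * wirt (dird (\<lambda>y. wirtbar (dird F y) (axis \<beta> 1)) z) (axis \<alpha> 1)))"
    unfolding dz_eq_wirt dzbar_eq_wirtbar[abs_def]
    by (subst sum.swap) (simp add: sum_distrib_left mult_ac)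
  also have "\<dots> = (\<Sum>\<beta>\<in>UNIV. cnj (w $ \<beta>) * wirt (dird (\<lambda>y. wirtbar (dird F y) (axis \<beta> 1)) z) v)"
    by (simp only: wirt_expand[OF dbl, symmetric])
  also have "\<dots> = wirt (\<lambda>u. \<Sum>\<beta>\<in>UNIV. cnj (w $ \<beta>) * dird (\<lambda>y. wirtbar (dird F y) (axis \<beta> 1)) z u) v"
    by (rule wirt_cmult_sum[symmetric])
  also have "(\<lambda>u. \<Sum>\<beta>\<in>UNIV. cnj (w $ \<beta>) * dird (\<lambda>y. wirtbar (dird F y) (axis \<beta> 1)) z u)
    = dird (\<lambda>y. wirtbar (dird F y) w) z"
  proof
    fix u
    have "((\<lambda>y. \<Sum>\<beta>\<in>UNIV. cnj (w $ \<beta>) * wirtbar (dird F y) (axis \<beta> 1)) has_derivative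
        (\<lambda>u. \<Sum>\<beta>\<in>UNIV. cnj (w $ \<beta>) * dird (\<lambda>y. wirtbar (dird F y) (axis \<beta> 1)) z u)) (at z)"
      by (intro derivative_intros has_dird) (use db in \<open>auto simp: differentiable_def\<close>)
    then have "((\<lambda>y. wirtbar (dird F y) w) has_derivative
        (\<lambda>u. \<Sum>\<beta>\<in>UNIV. cnj (w $ \<beta>) * dird (\<lambda>y. wirtbar (dird F y) (axis \<beta> 1)) z u)) (at z)"
      by (rule has_derivative_transform_within_open[OF _ U])
        (rule wirtbar_expand[symmetric], rule dird_linear, rule d1)
    from dirdI[OF this]
    show "(\<Sum>\<beta>\<in>UNIV. cnj (w $ \<beta>) * dird (\<lambda>y. wirtbar (dird F y) (axis \<beta> 1)) z u)
      = dird (\<lambda>y. wirtbar (dird F y) w) z u" by simp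
  qed
  also have "wirt \<dots> v = (H v w + H (\<i> *s v) (\<i> *s w) + \<i> * (H v (\<i> *s w) - H (\<i> *s v) w)) / 4"
    unfolding wirt_def dirdI[OF db] by (simp add: field_simps)
  finally show ?thesis .
qed


section \<open>Differentiability of matrix inverses\<close>

lemma differentiable_det:
  fixes A :: "'e::real_normed_vector \<Rightarrow> complex^'n^'n"
  assumes "\<And>i j. (\<lambda>q. A q $ i $ j) differentiable (at p)"
  shows "(\<lambda>q. det (A q)) differentiable (at p)"
proof -
  have pr: "(\<lambda>q. \<Prod>i\<in>UNIV. A q $ i $ s i) differentiable (at p)" for s
    using has_derivative_prod[of UNIV "\<lambda>i q. A q $ i $ s i" "\<lambda>i. dird (\<lambda>q. A q $ i $ s i) p" p UNIV]
      has_dird[OF assms] unfolding differentiable_def by blast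
  show ?thesis unfolding det_def
    by (intro differentiable_sum ballI differentiable_mult differentiable_const pr) (simp add: finite_permutations)
qed

text \<open>Presents the entries of the inverse as quotients of determinants, which are polynomials
  in the entries of \<open>A\<close>; their differentiability is then immediate.\<close>

lemma matrix_inv_cramer:
  fixes A :: "complex^'n^'n"
  assumes "invertible A"
  shows "matrix_inv A $ l $ i = det (\<chi> r c. if c = l then axis i 1 $ r else A $ r $ c) / det A"
proof -
  have "A ** matrix_inv A = mat 1"
    using assms unfolding invertible_def matrix_inv_def by (rule someI2_ex) blast
  then have "A *v (matrix_inv A *v axis i 1) = axis i 1" by (simp add: matrix_vector_mul_assoc)
  then have "matrix_inv A *v axis i 1 = (\<chi> k. det (\<chi> r c. if c = k then axis i 1 $ r else A $ r $ c) / det A)"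
    using cramer[of A "matrix_inv A *v axis i 1" "axis i 1"] assms by (simp add: invertible_det_nz)
  moreover have "(matrix_inv A *v axis i 1) $ l = matrix_inv A $ l $ i"
    by (simp add: matrix_vector_mult_def axis_def if_distrib cong: if_cong)
  ultimately show ?thesis by simp
qed

lemma differentiable_matrix_inv:
  fixes A :: "'e::real_normed_vector \<Rightarrow> complex^'n^'n"
  assumes A: "\<And>i j. (\<lambda>q. A q $ i $ j) differentiable (at p)"
    and S: "open S" "p \<in> S" "\<And>q. q \<in> S \<Longrightarrow> invertible (A q)"
  shows "(\<lambda>q. matrix_inv (A q) $ l $ i) differentiable (at p)"
proof (rule differentiable_cong_open[OF S(1,2)])
  show "det (\<chi> r c. if c = l then axis i 1 $ r else A q $ r $ c) / det (A q) = matrix_inv (A q) $ l $ i"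
    if "q \<in> S" for q using matrix_inv_cramer[OF S(3)[OF that]] by simp
  show "(\<lambda>q. det (\<chi> r c. if c = l then axis i 1 $ r else A q $ r $ c) / det (A q)) differentiable at p"
  proof (intro differentiable_divide differentiable_det)
    show "(\<lambda>q. (\<chi> r c. if c = l then axis i 1 $ r else A q $ r $ c) $ r' $ c') differentiable at p" for r' c'
      by (cases "c' = l") (simp_all add: A)
    show "det (A p) \<noteq> 0" using S(2,3) invertible_det_nz by blast
  qed (rule A)
qed

lemma differentiable_vec_lambda:
  fixes f :: "'n::finite \<Rightarrow> 'e::real_normed_vector \<Rightarrow> complex"
  assumes "\<And>i. f i differentiable (at p)"
  shows "(\<lambda>q. \<chi> i. f i q) differentiable (at p)"
proof -
  have "(\<lambda>q. \<chi> i. f i q) = (\<lambda>q. \<Sum>i\<in>UNIV. f i q *s axis i 1)"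
    using basis_expansion[of "\<chi> i. f i _"] by (simp add: fun_eq_iff)
  moreover have "(\<lambda>q. f i q *s axis i 1) differentiable (at p)" for i
    using bounded_linear.has_derivative[OF bounded_linear_smult_left has_dird[OF assms]]
    unfolding differentiable_def by blast
  ultimately show ?thesis by simp
qed


section \<open>Push-forward of vector fields\<close>

lemma linear_basis_expand:
  fixes f :: "'a::euclidean_space \<Rightarrow> 'b::real_vector"
  assumes "linear f" shows "f w = (\<Sum>b\<in>Basis. (w \<bullet> b) *\<^sub>R f b)"
  by (subst euclidean_representation[of w, symmetric]) (simp only: linear_sum[OF assms] linear_scale[OF assms])

lemma second_derivative_expand:
  fixes F :: "'a::euclidean_space \<Rightarrow> 'b::real_normed_vector"
  assumes F: "twice_differentiable_on F V" "open V" "z \<in> V"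
  shows "dird (\<lambda>y. dird F y w) z a = (\<Sum>b\<in>Basis. (w \<bullet> b) *\<^sub>R dird (\<lambda>y. dird F y b) z a)"
proof (rule dirdI, rule has_derivative_transform_within_open[OF _ F(2,3)])
  show "((\<lambda>y. \<Sum>b\<in>Basis. (w \<bullet> b) *\<^sub>R dird F y b) has_derivative
      (\<lambda>a. \<Sum>b\<in>Basis. (w \<bullet> b) *\<^sub>R dird (\<lambda>y. dird F y b) z a)) (at z)"
    by (intro derivative_intros has_dird twice_differentiable_onD(2)[OF F(1,3)])
  show "(\<Sum>b\<in>Basis. (w \<bullet> b) *\<^sub>R dird F y b) = dird F y w" if "y \<in> V" for y
    by (rule linear_basis_expand[symmetric, OF dird_linear[OF twice_differentiable_onD(1)[OF F(1) that]]])
qed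

text \<open>Again a basis expansion: \<open>dird F z w\<close> is linear in \<open>w\<close> and is
  known to be differentiable in \<open>z\<close> for fixed \<open>w\<close>.\<close>

lemma pushforward_has_derivative:
  fixes F :: "'a::euclidean_space \<Rightarrow> 'b::real_normed_vector" and Z W :: "'e::real_normed_vector \<Rightarrow> 'a"
  assumes F: "twice_differentiable_on F V" "open V" and U: "open U" "x \<in> U" "\<And>y. y \<in> U \<Longrightarrow> Z y \<in> V"
    and Z: "(Z has_derivative LZ) (at x)" and W: "(W has_derivative LW) (at x)"
  shows "((\<lambda>x. dird F (Z x) (W x)) has_derivative
    (\<lambda>A. dird (\<lambda>y. dird F y (W x)) (Z x) (LZ A) + dird F (Z x) (LW A))) (at x)"
proof (rule has_derivative_transform_within_open[OF _ U(1,2)])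
  note e = linear_basis_expand[OF dird_linear[OF twice_differentiable_onD(1)[OF F(1) U(3)]]]
  have c: "((\<lambda>x. dird F (Z x) b) has_derivative (\<lambda>A. dird (\<lambda>y. dird F y b) (Z x) (LZ A))) (at x)" for b
    by (rule has_derivative_compose[OF Z has_dird[OF twice_differentiable_onD(2)[OF F(1) U(3)[OF U(2)]]]])
  have "((\<lambda>y. \<Sum>b\<in>Basis. (W y \<bullet> b) *\<^sub>R dird F (Z y) b) has_derivative
    (\<lambda>A. \<Sum>b\<in>Basis. (W x \<bullet> b) *\<^sub>R dird (\<lambda>y. dird F y b) (Z x) (LZ A) + (LW A \<bullet> b) *\<^sub>R dird F (Z x) b)) (at x)"
    by (intro derivative_intros c W)
  then show "((\<lambda>y. \<Sum>b\<in>Basis. (W y \<bullet> b) *\<^sub>R dird F (Z y) b) has_derivative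
    (\<lambda>A. dird (\<lambda>y. dird F y (W x)) (Z x) (LZ A) + dird F (Z x) (LW A))) (at x)"
    by (rule has_derivative_eq_rhs)
      (simp add: fun_eq_iff sum.distrib second_derivative_expand[OF F U(3)[OF U(2)], of "W x"] e[OF U(2), of "LW _"])
  show "(\<Sum>b\<in>Basis. (W y \<bullet> b) *\<^sub>R dird F (Z y) b) = dird F (Z y) (W y)" if "y \<in> U" for y
    by (rule e[OF that, symmetric])
qed

lemma pushforward_Ck:
  fixes F :: "'a::euclidean_space \<Rightarrow> 'b::real_normed_vector" and LZ LW :: "'e::real_normed_vector \<Rightarrow> 'a"
  assumes F: "Ck_on (Suc k) F V" and U: "open U" "\<And>x. x \<in> U \<Longrightarrow> LZ x + c \<in> V"
    and L: "bounded_linear LZ" "bounded_linear LW"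
  shows "Ck_on k (\<lambda>x. dird F (LZ x + c) (LW x + d)) U"
proof (rule Ck_on_cong[OF U(1)])
  show "(\<Sum>b\<in>Basis. ((LW x + d) \<bullet> b) *\<^sub>R dird F (LZ x + c) b) = dird F (LZ x + c) (LW x + d)" if "x \<in> U" for x
  proof -
    have "F differentiable (at (LZ x + c))" using F U(2)[OF that] by simp
    from linear_basis_expand[OF dird_linear[OF this], symmetric] show ?thesis .
  qed
  have id: "Ck_on k (\<lambda>x::'a. x \<bullet> b) UNIV" for b
  proof (cases k)
    case (Suc j)
    have h: "((\<lambda>x::'a. x \<bullet> b) has_derivative (\<lambda>v. v \<bullet> b)) (at x)" for x by (auto intro!: derivative_eq_intros)
    then have "dird (\<lambda>x::'a. x \<bullet> b) x v = v \<bullet> b" "(\<lambda>x::'a. x \<bullet> b) differentiable (at x)" for x v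
      using dirdI[OF h] by (auto simp: differentiable_def)
    then show ?thesis by (simp add: Suc Ck_on_const)
  qed (auto intro!: continuous_intros)
  show "Ck_on k (\<lambda>x. \<Sum>b\<in>Basis. ((LW x + d) \<bullet> b) *\<^sub>R dird F (LZ x + c) b) U"
    using F
    by (intro Ck_on_sum U(1) Ck_on_bilinear[OF _ bounded_bilinear_scaleR] finite_Basis
        Ck_on_affine_compose[OF L(2) id] Ck_on_affine_compose[OF L(1) _ U(2)]) auto
qed

text \<open>Where \<open>E\<close> is positive, hypothesis \<open>sub\<close> says that the
  Laplacian of \<open>ln E\<close> in the directions \<open>A\<close> and \<open>B\<close> is
  nonnegative at \<open>x\<close>, while that of \<open>\<phi> - ln E\<close> is nonnegative at a
  minimum. Elsewhere \<open>E\<close> may vanish, so the comparison is restricted to the open set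
  where it is positive.\<close>

lemma log_minimum_laplacian:
  fixes E \<phi> :: "'e::real_normed_vector \<Rightarrow> real"
  assumes E: "twice_differentiable_on E U" and \<phi>: "twice_differentiable_on \<phi> U" and U: "open U" "x \<in> U"
    and pos: "E x > 0" and min: "\<And>y. y \<in> U \<Longrightarrow> E y > 0 \<Longrightarrow> \<phi> x - ln (E x) \<le> \<phi> y - ln (E y)"
    and sub: "(dird E x A)\<^sup>2 + (dird E x B)\<^sup>2 \<le> E x * (dird (\<lambda>y. dird E y A) x A + dird (\<lambda>y. dird E y B) x B)"
  shows "dird (\<lambda>y. dird \<phi> y A) x A + dird (\<lambda>y. dird \<phi> y B) x B \<ge> 0"
proof -
  have "continuous_on U E"
    using E by (intro differentiable_imp_continuous_on)
      (auto simp: differentiable_on_def twice_differentiable_on_def intro: differentiable_at_withinI)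
  then have S: "open (U \<inter> E -` {0<..})" using U(1) by (intro continuous_open_preimage) auto
  define S where "S = U \<inter> E -` {0<..}"
  have S: "open S" "x \<in> S" "S \<subseteq> U" "\<And>y. y \<in> S \<Longrightarrow> E y > 0" using S U pos by (auto simp: S_def)
  define \<psi> where "\<psi> y = \<phi> y - ln (E y)" for y
  have d: "(\<psi> has_derivative (\<lambda>v. dird \<phi> y v - dird E y v / E y)) (at y)" if "y \<in> S" for y
    unfolding \<psi>_def
    by (rule has_derivative_eq_rhs[OF has_derivative_diff[OF has_dird has_derivative_ln[OF _ has_dird]]])
      (use that S E \<phi> in \<open>auto simp: twice_differentiable_on_def fun_eq_iff divide_inverse mult.commute\<close>)
  have d2: "((\<lambda>y. dird \<psi> y v) has_derivative (\<lambda>u. dird (\<lambda>y. dird \<phi> y v) x u -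
      (dird (\<lambda>y. dird E y v) x u * E x - dird E x v * dird E x u) / (E x * E x))) (at x)" for v
  proof (rule has_derivative_transform_within_open[OF _ S(1,2)])
    show "dird \<phi> y v - dird E y v / E y = dird \<psi> y v" if "y \<in> S" for y
      using dirdI[OF d[OF that]] by simp
    show "((\<lambda>y. dird \<phi> y v - dird E y v / E y) has_derivative (\<lambda>u. dird (\<lambda>y. dird \<phi> y v) x u -
      (dird (\<lambda>y. dird E y v) x u * E x - dird E x v * dird E x u) / (E x * E x))) (at x)"
      by (intro has_derivative_diff has_derivative_divide' has_dird twice_differentiable_onD[OF E U(2)] twice_differentiable_onD[OF \<phi> U(2)])
        (use pos in auto)
  qed
  have "dird (\<lambda>y. dird \<psi> y v) x v \<ge> 0" for v
  proof (rule second_derivative_local_min[OF S(1,2)])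
    show "\<psi> differentiable at y" if "y \<in> S" for y using d[OF that] by (auto simp: differentiable_def)
    show "(\<lambda>y. dird \<psi> y v) differentiable at x" using d2 by (auto simp: differentiable_def)
    show "\<psi> x \<le> \<psi> y" if "y \<in> S" for y using min S that by (auto simp: \<psi>_def)
  qed
  then have *: "dird (\<lambda>y. dird \<phi> y v) x v \<ge>
      (dird (\<lambda>y. dird E y v) x v * E x - (dird E x v)\<^sup>2) / (E x * E x)" for v
    using dirdI[OF d2] by (simp add: power2_eq_square)
  have "0 \<le> (E x * (dird (\<lambda>y. dird E y A) x A + dird (\<lambda>y. dird E y B) x B) - ((dird E x A)\<^sup>2 + (dird E x B)\<^sup>2)) / (E x * E x)"
    using sub pos by simp
  also have "\<dots> = (dird (\<lambda>y. dird E y A) x A * E x - (dird E x A)\<^sup>2) / (E x * E x)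
      + (dird (\<lambda>y. dird E y B) x B * E x - (dird E x B)\<^sup>2) / (E x * E x)"
    unfolding add_divide_distrib[symmetric] by (simp add: algebra_simps)
  finally show ?thesis using *[of A] *[of B] by linarith
qed


section \<open>Kaehler metrics in a coordinate domain\<close>

text \<open>A Kaehler metric in one chart, linear in the first slot and conjugate-linear in the
  second. Two derivatives of the coefficients suffice, as the curvature contains no more.\<close>

locale kaehler_domain =
  fixes Om :: "(complex^'n) set" and H :: "complex^'n \<Rightarrow> complex^'n \<Rightarrow> complex^'n \<Rightarrow> complex"
  assumes open_Om: "open Om"
    and H_add: "q \<in> Om \<Longrightarrow> H q (u + v) w = H q u w + H q v w"
    and H_smult: "q \<in> Om \<Longrightarrow> H q (a *s u) w = a * H q u w"
    and H_cnj: "q \<in> Om \<Longrightarrow> H q v u = cnj (H q u v)"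
    and H_pos: "q \<in> Om \<Longrightarrow> u \<noteq> 0 \<Longrightarrow> Re (H q u u) > 0"
    and H_twice: "twice_differentiable_on (\<lambda>q. H q u v) Om"
    and H_closed: "q \<in> Om \<Longrightarrow> ext_deriv2 (\<lambda>q u v. - Im (H q u v)) q u v x = 0"
begin

lemma H_add_right: "q \<in> Om \<Longrightarrow> H q w (u + v) = H q w u + H q w v"
  by (metis H_add H_cnj complex_cnj_add)

lemma H_smult_right: "q \<in> Om \<Longrightarrow> H q w (a *s u) = cnj a * H q w u"
  by (metis H_smult H_cnj complex_cnj_mult)

lemma H_zero: "q \<in> Om \<Longrightarrow> H q 0 w = 0" "q \<in> Om \<Longrightarrow> H q w 0 = 0"
  using H_smult[of q 0 0 w] H_smult_right[of q w 0 0] by simp_all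

lemma H_diff_left: "q \<in> Om \<Longrightarrow> H q (u - v) w = H q u w - H q v w"
  using H_add[of q "u - v" v w] by simp

lemma H_expand: "q \<in> Om \<Longrightarrow> H q u w = (\<Sum>k\<in>UNIV. u $ k * H q (axis k 1) w)"
  using additive_sum[of "\<lambda>u. H q u w" UNIV "\<lambda>k. u $ k *s axis k 1"]
  by (simp add: basis_expansion H_add H_zero H_smult)

lemma H_expand_right: "q \<in> Om \<Longrightarrow> H q w u = (\<Sum>k\<in>UNIV. cnj (u $ k) * H q w (axis k 1))"
  using additive_sum[of "\<lambda>u. H q w u" UNIV "\<lambda>k. u $ k *s axis k 1"]
  by (simp add: basis_expansion H_add_right H_zero H_smult_right)

lemma H_eqI:
  assumes "q \<in> Om" "\<And>w. H q x w = H q y w" shows "x = y"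
proof (rule ccontr)
  assume "x \<noteq> y"
  then have "Re (H q (x - y) (x - y)) > 0" using H_pos[OF assms(1), of "x - y"] by simp
  then show False using assms(2)[of "x - y"] by (simp add: H_diff_left assms(1))
qed

lemma H_differentiable: "q \<in> Om \<Longrightarrow> (\<lambda>q. H q u v) differentiable (at q)"
  using H_twice by (rule twice_differentiable_onD)

definition D :: "complex^'n \<Rightarrow> complex^'n \<Rightarrow> complex^'n \<Rightarrow> complex^'n \<Rightarrow> complex" where
  "D q u v w = dird (\<lambda>q. H q v w) q u"

lemma H_has_derivative: "q \<in> Om \<Longrightarrow> ((\<lambda>q. H q v w) has_derivative (\<lambda>u. D q u v w)) (at q)"
  unfolding D_def by (intro has_dird H_differentiable)

lemma D_eqI:
  assumes "q \<in> Om" "\<And>q. q \<in> Om \<Longrightarrow> H q v w = h q" "(h has_derivative h') (at q)"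
  shows "D q u v w = h' u"
  unfolding D_def
  by (rule dirdI, rule has_derivative_transform_within_open[OF assms(3) open_Om assms(1)])
    (simp add: assms(2))

lemma D_linear: "q \<in> Om \<Longrightarrow> linear (\<lambda>u. D q u v w)"
  unfolding D_def by (intro dird_linear H_differentiable)

lemma D_smult: "q \<in> Om \<Longrightarrow> D q u (a *s v) w = a * D q u v w"
  by (rule D_eqI[where h = "\<lambda>q. a * H q v w"]) (auto simp: H_smult intro!: derivative_intros H_has_derivative)

lemma D_cnj: "q \<in> Om \<Longrightarrow> D q u w v = cnj (D q u v w)"
  by (rule D_eqI[where h = "\<lambda>q. cnj (H q v w)"]) (auto simp: H_cnj[of _ v w] intro!: derivative_intros H_has_derivative)

lemma D_smult_right: "q \<in> Om \<Longrightarrow> D q u v (a *s w) = cnj a * D q u v w"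
  by (metis D_smult D_cnj complex_cnj_mult)

lemma D_expand: "q \<in> Om \<Longrightarrow> D q u v w = (\<Sum>k\<in>UNIV. v $ k * D q u (axis k 1) w)"
  by (rule D_eqI[where h = "\<lambda>q. \<Sum>k\<in>UNIV. v $ k * H q (axis k 1) w"])
    (auto simp: H_expand[of _ v w] intro!: derivative_intros H_has_derivative)

lemma D_expand_right: "q \<in> Om \<Longrightarrow> D q u w v = (\<Sum>k\<in>UNIV. cnj (v $ k) * D q u w (axis k 1))"
  by (rule D_eqI[where h = "\<lambda>q. \<Sum>k\<in>UNIV. cnj (v $ k) * H q w (axis k 1)"])
    (auto simp: H_expand_right[of _ w v] intro!: derivative_intros H_has_derivative)

text \<open>Closedness of the fundamental form, evaluated on \<open>(1,0), (1,0), (0,1)\<close> vectors.\<close>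

lemma wirt_D_sym:
  assumes q: "q \<in> Om"
  shows "wirt (\<lambda>x. D q x v w) u = wirt (\<lambda>x. D q x u w) v"
proof -
  have im: "dird (\<lambda>q. - Im (H q a b)) q c = - Im (D q c a b)" for a b c
    by (rule dirdI) (intro derivative_intros H_has_derivative q)
  have e: "Im (D q a b c) + Im (D q b c a) + Im (D q c a b) = 0" for a b c
    using H_closed[OF q, of a b c] unfolding ext_deriv2_def im by simp
  \<comment> \<open>Closedness gives relations between imaginary parts only. Inserting
    \<open>\<i>\<close> into the arguments exchanges real and imaginary parts, so all eight choices
    of factors 1 and \<open>\<i>\<close> are used.\<close>
  show ?thesis
    unfolding wirt_def complex_eq_iff
    using e[of u v w] e[of "\<i> *s u" v w] e[of u "\<i> *s v" w] e[of u v "\<i> *s w"]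
      e[of "\<i> *s u" "\<i> *s v" w] e[of "\<i> *s u" v "\<i> *s w"] e[of u "\<i> *s v" "\<i> *s w"]
      e[of "\<i> *s u" "\<i> *s v" "\<i> *s w"]
    by (simp add: D_smult[OF q] D_smult_right[OF q] D_cnj[OF q, of _ w u] D_cnj[OF q, of _ v u] D_cnj[OF q, of _ w v])
qed

section \<open>The Chern connection and its agreement with the Levi-Civita connection\<close>

definition gm :: "complex^'n \<Rightarrow> complex^'n^'n" where
  "gm q = (\<chi> k l. H q (axis k 1) (axis l 1))"

lemma gm_invertible: assumes q: "q \<in> Om" shows "invertible (gm q)"
proof -
  have "x = 0" if "gm q *v x = 0" for x
  proof (rule ccontr)
    assume x: "x \<noteq> 0"
    \<comment> \<open>Multiplication by \<open>gm q\<close> contracts the conjugate-linear slot, so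
      the kernel vector has to be conjugated before it is inserted into \<open>H\<close>.\<close>
    define y where "y = (\<chi> l. cnj (x $ l))"
    have "H q (axis k 1) y = 0" for k
    proof -
      have "cnj (y $ l) = x $ l" for l by (simp add: y_def)
      then have "H q (axis k 1) y = (gm q *v x) $ k"
        by (subst H_expand_right[OF q]) (simp add: matrix_vector_mult_def gm_def mult.commute)
      then show ?thesis using that by simp
    qed
    then have "H q y y = 0" by (subst H_expand[OF q]) simp
    moreover have "y \<noteq> 0" using x by (auto simp: y_def vec_eq_iff)
    ultimately show False using H_pos[OF q, of y] by simp
  qed
  then obtain B where "B ** gm q = mat 1" using matrix_left_invertible_ker by blast
  then show ?thesis using matrix_left_right_inverse unfolding invertible_def by blast
qed

text \<open>The complex bilinear map with coefficients \<open>christoffel\<close>. Its invariant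
  meaning is \<open>H_chern\<close>: paired with the metric it is the (1,0) part of the derivative
  of \<open>H\<close>.\<close>

definition chern :: "complex^'n \<Rightarrow> complex^'n \<Rightarrow> complex^'n \<Rightarrow> complex^'n" where
  "chern q u v = (\<chi> i. \<Sum>l\<in>UNIV. matrix_inv (gm q) $ l $ i * wirt (\<lambda>u. D q u v (axis l 1)) u)"

lemma H_chern:
  assumes q: "q \<in> Om" shows "H q (chern q u v) w = wirt (\<lambda>u. D q u v w) u"
proof -
  have inv: "matrix_inv (gm q) ** gm q = mat 1"
    using gm_invertible[OF q] unfolding invertible_def matrix_inv_def by (rule someI2_ex) blast
  have b: "H q (chern q u v) (axis m 1) = wirt (\<lambda>u. D q u v (axis m 1)) u" for m
  proof -
    have "H q (chern q u v) (axis m 1) =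
      (\<Sum>i\<in>UNIV. \<Sum>l\<in>UNIV. matrix_inv (gm q) $ l $ i * wirt (\<lambda>u. D q u v (axis l 1)) u * gm q $ i $ m)"
      by (subst H_expand[OF q]) (simp add: chern_def gm_def sum_distrib_right)
    also have "\<dots> = (\<Sum>l\<in>UNIV. (\<Sum>i\<in>UNIV. matrix_inv (gm q) $ l $ i * gm q $ i $ m) * wirt (\<lambda>u. D q u v (axis l 1)) u)"
      by (subst sum.swap) (simp add: sum_distrib_left sum_distrib_right mult_ac)
    also have "\<dots> = (\<Sum>l\<in>UNIV. (if l = m then 1 else 0) * wirt (\<lambda>u. D q u v (axis l 1)) u)"
    proof (rule sum.cong[OF refl])
      fix l
      have "(\<Sum>i\<in>UNIV. matrix_inv (gm q) $ l $ i * gm q $ i $ m) = (if l = m then 1 else 0)"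
        using arg_cong[OF inv, of "\<lambda>A. A $ l $ m"] by (simp add: matrix_matrix_mult_def mat_def)
      then show "(\<Sum>i\<in>UNIV. matrix_inv (gm q) $ l $ i * gm q $ i $ m) * wirt (\<lambda>u. D q u v (axis l 1)) u
        = (if l = m then 1 else 0) * wirt (\<lambda>u. D q u v (axis l 1)) u" by simp
    qed
    also have "\<dots> = wirt (\<lambda>u. D q u v (axis m 1)) u" by (simp add: if_distrib[of "\<lambda>x. x * _"] cong: if_cong)
    finally show ?thesis .
  qed
  have "H q (chern q u v) w = (\<Sum>k\<in>UNIV. cnj (w $ k) * wirt (\<lambda>u. D q u v (axis k 1)) u)"
    by (subst H_expand_right[OF q]) (simp add: b)
  also have "\<dots> = wirt (\<lambda>u. D q u v w) u"
    by (subst D_expand_right[OF q, of _ v w]) (rule wirt_cmult_sum[symmetric])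
  finally show ?thesis .
qed

text \<open>The Chern connection is torsion-free. This is the step at which the Kaehler condition is
  turned into a property of the connection.\<close>

lemma chern_sym: "q \<in> Om \<Longrightarrow> chern q u v = chern q v u"
  by (rule H_eqI, assumption) (simp add: H_chern, rule wirt_D_sym)

lemma chern_add: "q \<in> Om \<Longrightarrow> chern q (u + u') v = chern q u v + chern q u' v"
  by (rule H_eqI) (auto simp: H_chern H_add wirt_add[OF D_linear])

lemma chern_smult: "q \<in> Om \<Longrightarrow> chern q (a *s u) v = a *s chern q u v"
  by (rule H_eqI) (auto simp: H_chern H_smult wirt_smult[OF D_linear])

lemma chern_bilinear: "q \<in> Om \<Longrightarrow> bilinear (chern q)"
  unfolding bilinear_def
  by (intro conjI allI linearI)
   (metis chern_sym chern_add, metis chern_sym chern_smult scaleR_eq_smult, metis chern_add, metis chern_smult scaleR_eq_smult)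

lemma chern_smult_right: "q \<in> Om \<Longrightarrow> chern q u (a *s v) = a *s chern q u v"
  by (metis chern_sym chern_smult)

lemma chern_differentiable:
  assumes q: "q \<in> Om" shows "(\<lambda>q. chern q u v) differentiable (at q)"
  unfolding chern_def wirt_def
proof (intro differentiable_vec_lambda differentiable_sum ballI differentiable_mult differentiable_divide
    differentiable_diff differentiable_const differentiable_matrix_inv[OF _ open_Om q] gm_invertible)
  show "(\<lambda>q. gm q $ i $ j) differentiable at q" for i j
    unfolding gm_def using H_differentiable[OF q] by simp
  have "(\<lambda>q. D q w v z) differentiable at q" for w v z
    unfolding D_def using H_twice q by (rule twice_differentiable_onD)
  then show "(\<lambda>q. D q u v (axis l 1)) differentiable at q" "(\<lambda>q. D q (\<i> *s u) v (axis l 1)) differentiable at q" for l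
    by blast+
qed auto

definition G :: "complex^'n \<Rightarrow> complex^'n \<Rightarrow> complex^'n \<Rightarrow> real" where
  "G q u v = Re (H q u v)"

lemma G_dird: "q \<in> Om \<Longrightarrow> dird (\<lambda>q. G q u v) q w = Re (D q w u v)"
  unfolding G_def by (rule dirdI) (intro derivative_intros H_has_derivative)

text \<open>Compatibility holds because the (1,0) part of the derivative of \<open>H\<close> at
  \<open>(u, v)\<close> and the conjugate of the one at \<open>(v, u)\<close> add up to the full
  derivative. Together with \<open>chern_sym\<close> this makes \<open>chern\<close> the Levi-Civita
  connection of \<open>G\<close>, so the real calculus applies to it.\<close>

sublocale riemannian_domain Om G chern
proof
  show "open Om" by (rule open_Om)
  fix q u v w assume q: "q \<in> Om"
  show "bilinear (G q)" unfolding bilinear_def G_def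
    by (intro conjI allI linearI) (simp_all add: H_add H_add_right H_smult H_smult_right scaleR_eq_smult q)
  show "G q u v = G q v u" by (simp add: G_def H_cnj[OF q, of u v])
  show "u \<noteq> 0 \<Longrightarrow> 0 < G q u u" using H_pos[OF q] by (simp add: G_def)
  show "bilinear (chern q)" by (rule chern_bilinear[OF q])
  show "chern q u v = chern q v u" by (rule chern_sym[OF q])
  show "(\<lambda>q. chern q u v) differentiable (at q)" by (rule chern_differentiable[OF q])
  have "wirt (\<lambda>w. D q w u v) w + cnj (wirt (\<lambda>w. D q w v u) w) = D q w u v"
    by (simp add: wirt_def D_cnj[OF q, of _ v u] field_simps)
  then have "H q (chern q w u) v + H q u (chern q w v) = D q w u v"
    by (simp add: H_chern[OF q] H_cnj[OF q, of u "chern q w v"])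
  then show "dird (\<lambda>q. G q u v) q w = G q (chern q w u) v + G q u (chern q w v)"
    by (metis G_dird[OF q] G_def plus_complex.simps(1))
next
  fix u v
  show "twice_differentiable_on (\<lambda>q. G q u v) Om"
    unfolding twice_differentiable_on_def
  proof (intro ballI conjI allI)
    fix q w assume q: "q \<in> Om"
    show "(\<lambda>q. G q u v) differentiable at q"
      unfolding G_def differentiable_def
      using bounded_linear.has_derivative[OF bounded_linear_Re H_has_derivative[OF q]] by blast
    have "((\<lambda>q. Re (dird (\<lambda>q. H q u v) q w)) has_derivative (\<lambda>x. Re (dird (\<lambda>q. dird (\<lambda>q. H q u v) q w) q x))) (at q)"
      by (intro derivative_intros has_dird twice_differentiable_onD(2)[OF H_twice q])
    then have "(\<lambda>q. Re (D q w u v)) differentiable at q" unfolding D_def differentiable_def by blast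
    then show "(\<lambda>q. dird (\<lambda>q. G q u v) q w) differentiable at q"
      by (rule differentiable_cong_open[OF open_Om q, rotated]) (simp add: G_dird)
  qed
qed

section \<open>The pluriharmonic equation in real form\<close>

definition christoffel :: "'n \<Rightarrow> 'n \<Rightarrow> 'n \<Rightarrow> complex^'n \<Rightarrow> complex" where
  "christoffel i j k q = (\<Sum>l\<in>UNIV. matrix_inv (gm q) $ l $ i * dz j (\<lambda>q. gm q $ k $ l) q)"

lemma chern_nth:
  assumes q: "q \<in> Om"
  shows "chern q a b $ i = (\<Sum>j\<in>UNIV. \<Sum>k\<in>UNIV. christoffel i j k q * a $ j * b $ k)"
proof -
  have dz: "dz j (\<lambda>q. gm q $ k $ l) q = wirt (\<lambda>u. D q u (axis k 1) (axis l 1)) (axis j 1)" for j k l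
    by (simp add: dz_eq_wirt gm_def D_def)
  have "wirt (\<lambda>u. D q u b (axis l 1)) a = (\<Sum>j\<in>UNIV. \<Sum>k\<in>UNIV. a $ j * b $ k * dz j (\<lambda>q. gm q $ k $ l) q)" for l
  proof -
    have "wirt (\<lambda>u. D q u b (axis l 1)) a = (\<Sum>k\<in>UNIV. b $ k * wirt (\<lambda>u. D q u (axis k 1) (axis l 1)) a)"
      by (subst D_expand[OF q, of _ b]) (rule wirt_cmult_sum)
    also have "\<dots> = (\<Sum>k\<in>UNIV. b $ k * (\<Sum>j\<in>UNIV. a $ j * dz j (\<lambda>q. gm q $ k $ l) q))"
      by (subst wirt_expand[OF D_linear[OF q]]) (simp add: dz)
    also have "\<dots> = (\<Sum>j\<in>UNIV. \<Sum>k\<in>UNIV. a $ j * b $ k * dz j (\<lambda>q. gm q $ k $ l) q)"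
      by (subst sum.swap) (simp add: sum_distrib_left mult_ac)
    finally show ?thesis .
  qed
  then have "chern q a b $ i = (\<Sum>l\<in>UNIV. \<Sum>j\<in>UNIV. \<Sum>k\<in>UNIV.
      matrix_inv (gm q) $ l $ i * dz j (\<lambda>q. gm q $ k $ l) q * a $ j * b $ k)"
    by (simp add: chern_def sum_distrib_left mult_ac)
  also have "\<dots> = (\<Sum>j\<in>UNIV. \<Sum>l\<in>UNIV. \<Sum>k\<in>UNIV.
      matrix_inv (gm q) $ l $ i * dz j (\<lambda>q. gm q $ k $ l) q * a $ j * b $ k)"
    by (rule sum.swap)
  also have "\<dots> = (\<Sum>j\<in>UNIV. \<Sum>k\<in>UNIV. \<Sum>l\<in>UNIV.
      matrix_inv (gm q) $ l $ i * dz j (\<lambda>q. gm q $ k $ l) q * a $ j * b $ k)"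
    by (intro sum.cong refl sum.swap)
  finally show ?thesis by (simp add: christoffel_def sum_distrib_right)
qed

text \<open>The equation in terms of the real second fundamental form: \<open>\<nabla>dF(v, w) + \<nabla>dF(iv, iw) = 0\<close>.\<close>

lemma pluriharmonic_real:
  fixes F :: "complex^'m \<Rightarrow> complex^'n"
  assumes F: "twice_differentiable_on F V" "open V" "z \<in> V" and q: "F z \<in> Om"
    and ph: "\<And>i \<alpha> \<beta>. dz \<alpha> (dzbar \<beta> (\<lambda>y. F y $ i)) z + (\<Sum>j\<in>UNIV. \<Sum>k\<in>UNIV. christoffel i j k (F z)
      * dz \<alpha> (\<lambda>y. F y $ j) z * dzbar \<beta> (\<lambda>y. F y $ k) z) = 0"
  shows "dird (\<lambda>y. dird F y w) z v + dird (\<lambda>y. dird F y (\<i> *s w)) z (\<i> *s v)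
    + chern (F z) (dird F z v) (dird F z w) + chern (F z) (dird F z (\<i> *s v)) (dird F z (\<i> *s w)) = 0"
proof -
  define H where "H u v = dird (\<lambda>y. dird F y v) z u" for u v
  define L where "L = dird F z"
  define \<Gamma> where "\<Gamma> = chern (F z)"
  have d: "dird (\<lambda>y. F y $ i) y u = dird F y u $ i" "(\<lambda>y. F y $ i) differentiable (at y)" if "y \<in> V" for i y u
  proof -
    have "((\<lambda>y. F y $ i) has_derivative (\<lambda>u. dird F y u $ i)) (at y)"
      by (rule bounded_linear.has_derivative[OF bounded_linear_vec_nth has_dird[OF twice_differentiable_onD(1)[OF F(1) that]]])
    then show "dird (\<lambda>y. F y $ i) y u = dird F y u $ i" "(\<lambda>y. F y $ i) differentiable (at y)"
      by (auto simp: dirdI differentiable_def)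
  qed
  have d2: "((\<lambda>y. dird (\<lambda>y. F y $ i) y v) has_derivative (\<lambda>u. dird (\<lambda>y. dird F y v) y u $ i)) (at y)" if "y \<in> V" for i v y
    by (rule has_derivative_transform_within_open[OF
          bounded_linear.has_derivative[OF bounded_linear_vec_nth has_dird[OF twice_differentiable_onD(2)[OF F(1) that]]] F(2) that])
      (simp add: d)
  have t: "twice_differentiable_on (\<lambda>y. F y $ i) V" for i
    using d(2) d2 unfolding twice_differentiable_on_def differentiable_def by blast
  have sum2: "(\<Sum>\<alpha>\<in>UNIV. \<Sum>\<beta>\<in>UNIV. v $ \<alpha> * cnj (w $ \<beta>) * dz \<alpha> (dzbar \<beta> (\<lambda>y. F y $ i)) z)
    = (H v w $ i + H (\<i> *s v) (\<i> *s w) $ i + \<i> * (H v (\<i> *s w) $ i - H (\<i> *s v) w $ i)) / 4" for v w i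
    unfolding sum_dz_dzbar[OF t F(2,3)] H_def using dirdI[OF d2[OF F(3)]] by simp
  \<comment> \<open>The complex-linear and conjugate-linear parts of \<open>L\<close>, i.e. the
    vector forms of \<partial>F and of its conjugate counterpart, evaluated at \<open>v\<close> and
    \<open>w\<close>.\<close>
  define a where "a v = (1/2) *s (L v - \<i> *s L (\<i> *s v))" for v
  define b where "b w = (1/2) *s (L w + \<i> *s L (\<i> *s w))" for w
  have a: "(\<Sum>\<alpha>\<in>UNIV. v $ \<alpha> * dz \<alpha> (\<lambda>y. F y $ j) z) = a v $ j" for v j
    unfolding dz_eq_wirt wirt_expand[OF dird_linear[OF d(2)[OF F(3)]], symmetric]
    by (simp add: wirt_def d(1)[OF F(3)] a_def L_def)
  have b: "(\<Sum>\<beta>\<in>UNIV. cnj (w $ \<beta>) * dzbar \<beta> (\<lambda>y. F y $ j) z) = b w $ j" for w j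
    unfolding dzbar_eq_wirtbar wirtbar_expand[OF dird_linear[OF d(2)[OF F(3)]], symmetric]
    by (simp add: wirtbar_def d(1)[OF F(3)] b_def L_def)
  have c: "(\<Sum>\<alpha>\<in>UNIV. \<Sum>\<beta>\<in>UNIV. v $ \<alpha> * cnj (w $ \<beta>) * (\<Sum>j\<in>UNIV. \<Sum>k\<in>UNIV. christoffel i j k (F z)
      * dz \<alpha> (\<lambda>y. F y $ j) z * dzbar \<beta> (\<lambda>y. F y $ k) z)) = \<Gamma> (a v) (b w) $ i" for v w i
  proof -
    have "(\<Sum>\<alpha>\<in>UNIV. \<Sum>\<beta>\<in>UNIV. v $ \<alpha> * cnj (w $ \<beta>) * (\<Sum>j\<in>UNIV. \<Sum>k\<in>UNIV. christoffel i j k (F z)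
      * dz \<alpha> (\<lambda>y. F y $ j) z * dzbar \<beta> (\<lambda>y. F y $ k) z)) =
      (\<Sum>\<alpha>\<in>UNIV. \<Sum>\<beta>\<in>UNIV. \<Gamma> ((v $ \<alpha>) *s (\<chi> j. dz \<alpha> (\<lambda>y. F y $ j) z)) (cnj (w $ \<beta>) *s (\<chi> k. dzbar \<beta> (\<lambda>y. F y $ k) z)) $ i)"
      by (simp add: \<Gamma>_def chern_smult[OF q] chern_smult_right[OF q] chern_nth[OF q] sum_distrib_left mult_ac)
    also have "\<dots> = \<Gamma> (\<Sum>\<alpha>\<in>UNIV. (v $ \<alpha>) *s (\<chi> j. dz \<alpha> (\<lambda>y. F y $ j) z)) (\<Sum>\<beta>\<in>UNIV. cnj (w $ \<beta>) *s (\<chi> k. dzbar \<beta> (\<lambda>y. F y $ k) z)) $ i"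
      using bilinear_sum[OF chern_bilinear[OF q], of "\<lambda>\<alpha>. (v $ \<alpha>) *s (\<chi> j. dz \<alpha> (\<lambda>y. F y $ j) z)" UNIV
          "\<lambda>\<beta>. cnj (w $ \<beta>) *s (\<chi> k. dzbar \<beta> (\<lambda>y. F y $ k) z)" UNIV]
      by (simp add: \<Gamma>_def sum.cartesian_product[symmetric] sum_component del: UNIV_Times_UNIV)
    also have "(\<Sum>\<alpha>\<in>UNIV. (v $ \<alpha>) *s (\<chi> j. dz \<alpha> (\<lambda>y. F y $ j) z)) = a v"
      by (simp add: vec_eq_iff sum_component a)
    also have "(\<Sum>\<beta>\<in>UNIV. cnj (w $ \<beta>) *s (\<chi> k. dzbar \<beta> (\<lambda>y. F y $ k) z)) = b w"
      by (simp add: vec_eq_iff sum_component b)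
    finally show ?thesis .
  qed
  have \<Gamma>ab: "\<Gamma> (a v) (b w) $ i = (\<Gamma> (L v) (L w) $ i + \<Gamma> (L (\<i> *s v)) (L (\<i> *s w)) $ i
     + \<i> * (\<Gamma> (L v) (L (\<i> *s w)) $ i - \<Gamma> (L (\<i> *s v)) (L w) $ i)) / 4" for v w i
    unfolding a_def b_def \<Gamma>_def chern_smult[OF q] chern_smult_right[OF q] diff_conv_add_uminus
      \<Gamma>_simps[OF q]
    by (simp add: chern_smult[OF q] chern_smult_right[OF q] field_simps)
  have eq: "H v w $ i + H (\<i> *s v) (\<i> *s w) $ i + \<i> * (H v (\<i> *s w) $ i - H (\<i> *s v) w $ i)
      + (\<Gamma> (L v) (L w) $ i + \<Gamma> (L (\<i> *s v)) (L (\<i> *s w)) $ i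
        + \<i> * (\<Gamma> (L v) (L (\<i> *s w)) $ i - \<Gamma> (L (\<i> *s v)) (L w) $ i)) = 0" for v w i
  proof -
    have "(\<Sum>\<alpha>\<in>UNIV. \<Sum>\<beta>\<in>UNIV. v $ \<alpha> * cnj (w $ \<beta>) * (dz \<alpha> (dzbar \<beta> (\<lambda>y. F y $ i)) z
      + (\<Sum>j\<in>UNIV. \<Sum>k\<in>UNIV. christoffel i j k (F z)
      * dz \<alpha> (\<lambda>y. F y $ j) z * dzbar \<beta> (\<lambda>y. F y $ k) z))) = 0"
      unfolding ph by simp
    then show ?thesis
      unfolding distrib_left sum.distrib sum2 c \<Gamma>ab by (simp add: add_divide_distrib[symmetric])
  qed
  \<comment> \<open>The components are complex, so real and imaginary parts of \<open>eq\<close>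
    cannot be compared. Exchanging \<open>v\<close> and \<open>w\<close> keeps the first group of
    terms and reverses the sign of the group multiplied by \<open>\<i>\<close>, because
    \<open>H\<close> and \<open>\<Gamma>\<close> are symmetric; hence both groups vanish.\<close>
  have "H v w $ i + H (\<i> *s v) (\<i> *s w) $ i + \<Gamma> (L v) (L w) $ i + \<Gamma> (L (\<i> *s v)) (L (\<i> *s w)) $ i = 0" for i
  proof -
    have Hs: "H x y = H y x" for x y
      unfolding H_def by (rule twice_differentiable_on_sym[OF F])
    have Gs: "\<Gamma> x y = \<Gamma> y x" for x y unfolding \<Gamma>_def by (rule chern_sym[OF q])
    have z: "x = 0" if "x + \<i> * y = 0" "x - \<i> * y = 0" for x y :: complex
      using that by (simp add: complex_eq_iff)
    show ?thesis
      by (rule z[of _ "H v (\<i> *s w) $ i - H (\<i> *s v) w $ i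
          + \<Gamma> (L v) (L (\<i> *s w)) $ i - \<Gamma> (L (\<i> *s v)) (L w) $ i"]) (use eq[of v w i] eq[of w v i] in \<open>simp_all add: Hs[of w v] Hs[of "\<i> *s w" "\<i> *s v"]
        Hs[of w "\<i> *s v"] Hs[of "\<i> *s w" v] Gs[of "L w" "L v"] Gs[of "L (\<i> *s w)" "L (\<i> *s v)"]
        Gs[of "L w" "L (\<i> *s v)"] Gs[of "L (\<i> *s w)" "L v"] algebra_simps\<close>)
  qed
  then show ?thesis unfolding H_def L_def \<Gamma>_def by (simp add: vec_eq_iff)
qed

text \<open>The covariant derivative of dF(W) is the second fundamental form at the moving point and
  \<open>W\<close>, plus dF of the derivative of \<open>W\<close>. In the sum the first
  contributions cancel by the pluriharmonic equation, the second by complex linearity of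
  \<open>LW\<close> and \<open>\<i>\<close> squared being -1.\<close>

lemma pushforward_holomorphic_pair:
  fixes F :: "complex^'m \<Rightarrow> complex^'n" and LZ LW :: "complex^'d \<Rightarrow> complex^'m"
  assumes F: "Ck_on (Suc (Suc (Suc 0))) F V" "open V" "\<And>z. z \<in> V \<Longrightarrow> F z \<in> Om"
    and eq: "\<And>z v w. z \<in> V \<Longrightarrow> dird (\<lambda>y. dird F y w) z v + dird (\<lambda>y. dird F y (\<i> *s w)) z (\<i> *s v)
    + chern (F z) (dird F z v) (dird F z w) + chern (F z) (dird F z (\<i> *s v)) (dird F z (\<i> *s w)) = 0"
    and L: "bounded_linear LZ" "bounded_linear LW" "\<And>v. LZ (\<i> *s v) = \<i> *s LZ v" "\<And>v. LW (\<i> *s v) = \<i> *s LW v"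
    and U: "open U" "\<And>x. x \<in> U \<Longrightarrow> LZ x + c \<in> V"
  shows "holomorphic_pair ((*s) \<i>) U (\<lambda>x. F (LZ x + c))
    (\<lambda>x. dird F (LZ x + c) (LW x + d)) (\<lambda>x. dird F (LZ x + c) (\<i> *s (LW x + d)))"
  unfolding holomorphic_pair_def
proof (intro conjI ballI allI)
  have Li: "bounded_linear (\<lambda>v. \<i> *s LW v)"
    by (rule bounded_linear_compose[OF bounded_linear_smult L(2)])
  have t: "twice_differentiable_on F V" by (rule Ck_on_twice_differentiable[OF F(1)])
  show "twice_differentiable_on (\<lambda>x. dird F (LZ x + c) (LW x + d)) U"
    by (rule Ck_on_twice_differentiable[OF pushforward_Ck[OF F(1) U L(1,2)]])
  show "twice_differentiable_on (\<lambda>x. dird F (LZ x + c) (\<i> *s (LW x + d))) U"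
    unfolding vector_add_ldistrib
    by (rule Ck_on_twice_differentiable[OF pushforward_Ck[OF F(1) U L(1) Li]])
  fix x A assume x: "x \<in> U"
  have Z: "((\<lambda>x. LZ x + c) has_derivative LZ) (at x)" "((\<lambda>x. LW x + d) has_derivative LW) (at x)"
    using bounded_linear_imp_has_derivative[OF L(1)] bounded_linear_imp_has_derivative[OF L(2)]
    by (auto intro!: derivative_eq_intros)
  have iW: "((\<lambda>x. \<i> *s (LW x + d)) has_derivative (\<lambda>v. \<i> *s LW v)) (at x)"
    by (rule bounded_linear.has_derivative[OF bounded_linear_smult Z(2)])
  have P: "dird (\<lambda>x. dird F (LZ x + c) (LW x + d)) x A =
      dird (\<lambda>y. dird F y (LW x + d)) (LZ x + c) (LZ A) + dird F (LZ x + c) (LW A)" for A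
    by (rule dirdI, rule pushforward_has_derivative[OF t F(2) U(1) x U(2) Z])
  have Q: "dird (\<lambda>x. dird F (LZ x + c) (\<i> *s (LW x + d))) x A =
      dird (\<lambda>y. dird F y (\<i> *s (LW x + d))) (LZ x + c) (LZ A) + dird F (LZ x + c) (\<i> *s LW A)" for A
    by (rule dirdI, rule pushforward_has_derivative[OF t F(2) U(1) x U(2) Z(1) iW])
  have \<gamma>: "dird (\<lambda>x. F (LZ x + c)) x A = dird F (LZ x + c) (LZ A)" for A
    by (rule dirdI, rule has_derivative_compose[OF Z(1)])
      (use U x t in \<open>auto intro!: has_dird simp: twice_differentiable_on_def\<close>)
  have neg: "dird F (LZ x + c) (- u) = - dird F (LZ x + c) u" for u
    by (rule linear_neg, rule dird_linear, rule twice_differentiable_onD[OF t], rule U, rule x)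
  show "cov (\<lambda>x. F (LZ x + c)) (\<lambda>x. dird F (LZ x + c) (LW x + d)) x A +
       cov (\<lambda>x. F (LZ x + c)) (\<lambda>x. dird F (LZ x + c) (\<i> *s (LW x + d))) x (\<i> *s A) = 0"
    unfolding cov_def P Q \<gamma> L smult_i_i neg
    using eq[OF U(2)[OF x], of "LW x + d" "LZ A"] by (simp add: add_ac)
qed

text \<open>Two sections occur: dF(W), whose energy is estimated, and dF of the constant field
  \<open>LZ A\<close>, on which the curvature constraint acts. The direction \<open>B\<close> lifts
  the vector \<open>W\<close> at the point, as the constraint needs dF(W) as the derivative of the
  map in some direction.\<close>

lemma pushforward_energy_log_subharmonic:
  fixes F :: "complex^'m \<Rightarrow> complex^'n" and LZ LW :: "complex^'d \<Rightarrow> complex^'m"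
  assumes F: "Ck_on (Suc (Suc (Suc 0))) F V" "open V" "\<And>z. z \<in> V \<Longrightarrow> F z \<in> Om"
    and eq: "\<And>z v w. z \<in> V \<Longrightarrow> dird (\<lambda>y. dird F y w) z v + dird (\<lambda>y. dird F y (\<i> *s w)) z (\<i> *s v)
    + chern (F z) (dird F z v) (dird F z w) + chern (F z) (dird F z (\<i> *s v)) (dird F z (\<i> *s w)) = 0"
    and L: "bounded_linear LZ" "bounded_linear LW" "\<And>v. LZ (\<i> *s v) = \<i> *s LZ v" "\<And>v. LW (\<i> *s v) = \<i> *s LW v"
    and U: "open U" "\<And>x. x \<in> U \<Longrightarrow> LZ x + c \<in> V" and x: "x \<in> U"
    and B: "LZ B = LW x + d"
    and nonpos: "\<And>u v. u \<noteq> v \<Longrightarrow> independent {u, v} \<Longrightarrow> sectional_curvature G (F (LZ x + c)) u v \<le> 0"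
  defines "E \<equiv> energy (\<lambda>x. F (LZ x + c)) (\<lambda>x. dird F (LZ x + c) (LW x + d)) (\<lambda>x. dird F (LZ x + c) (\<i> *s (LW x + d)))"
  shows "twice_differentiable_on E U"
    and "(dird E x A)\<^sup>2 + (dird E x (\<i> *s A))\<^sup>2 \<le>
      E x * (dird (\<lambda>y. dird E y A) x A + dird (\<lambda>y. dird E y (\<i> *s A)) x (\<i> *s A))"
proof -
  define \<gamma> where "\<gamma> x = F (LZ x + c)" for x
  have hp: "holomorphic_pair ((*s) \<i>) U \<gamma> (\<lambda>x. dird F (LZ x + c) (LW x + d)) (\<lambda>x. dird F (LZ x + c) (\<i> *s (LW x + d)))"
    unfolding \<gamma>_def by (rule pushforward_holomorphic_pair[OF F eq L U])
  have t: "twice_differentiable_on F V" by (rule Ck_on_twice_differentiable[OF F(1)])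
  have \<gamma>: "twice_differentiable_on \<gamma> U" unfolding \<gamma>_def
    by (rule Ck_on_twice_differentiable[OF Ck_on_affine_compose[OF L(1) F(1) U(2,1)]])
  have Om: "\<forall>y\<in>U. \<gamma> y \<in> Om" unfolding \<gamma>_def using F U by blast
  show "twice_differentiable_on E U"
    unfolding E_def \<gamma>_def[symmetric]
    using energy_twice_differentiable[OF U(1) Om \<gamma>] hp unfolding holomorphic_pair_def by blast
  have d\<gamma>: "dird \<gamma> x A = dird F (LZ x + c) (LZ A)" for A
  proof -
    have Z: "((\<lambda>x. LZ x + c) has_derivative LZ) (at x)"
      using bounded_linear_imp_has_derivative[OF L(1)] by (auto intro!: derivative_eq_intros)
    show ?thesis unfolding \<gamma>_def
      by (rule dirdI, rule has_derivative_compose[OF Z])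
        (use U x t in \<open>auto intro!: has_dird simp: twice_differentiable_on_def\<close>)
  qed
  \<comment> \<open>The constant field: linear part 0 and constant part \<open>LZ A\<close>.\<close>
  have hp': "holomorphic_pair ((*s) \<i>) U \<gamma> (\<lambda>x. dird F (LZ x + c) (0 + LZ A)) (\<lambda>x. dird F (LZ x + c) (\<i> *s (0 + LZ A)))"
    unfolding \<gamma>_def by (rule pushforward_holomorphic_pair[OF F eq L(1) _ L(3) _ U]) auto
  show "(dird E x A)\<^sup>2 + (dird E x (\<i> *s A))\<^sup>2 \<le>
      E x * (dird (\<lambda>y. dird E y A) x A + dird (\<lambda>y. dird E y (\<i> *s A)) x (\<i> *s A))"
    unfolding E_def \<gamma>_def[symmetric]
  proof (rule energy_log_subharmonic[OF hp smult_i_i U(1) Om \<gamma> x _ hp'])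
    show "G (\<gamma> x) (curv (\<gamma> x) u v v) u \<le> 0" for u v
      using Om x nonpos by (intro curv_nonpositive) (auto simp: \<gamma>_def)
    show "dird \<gamma> x B = dird F (LZ x + c) (LW x + d)" by (simp add: d\<gamma> B)
    show "dird \<gamma> x (\<i> *s B) = dird F (LZ x + c) (\<i> *s (LW x + d))" by (simp add: d\<gamma> B L)
  qed (simp_all add: d\<gamma> L)
qed

end


section \<open>Charts and tangent vectors\<close>

locale complex_manifold_charts =
  fixes M :: "('a, 'n::finite) manifold"
  assumes complex_manifold: "complex_manifold M"
begin

lemma chart_subset: "c \<in> atlas M \<Longrightarrow> fst c \<subseteq> points M"
  using complex_manifold unfolding complex_manifold_def by (metis openin_subset)

lemma chart_openin: "c \<in> atlas M \<Longrightarrow> openin (mtop M) (fst c)"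
  using complex_manifold unfolding complex_manifold_def by blast

lemma chart_image_open: "c \<in> atlas M \<Longrightarrow> open (snd c ` fst c)"
  using complex_manifold unfolding complex_manifold_def by blast

lemma chart_homeomorphic:
  "c \<in> atlas M \<Longrightarrow> homeomorphic_map (subtopology (mtop M) (fst c)) (top_of_set (snd c ` fst c)) (snd c)"
  using complex_manifold unfolding complex_manifold_def by blast

lemma chart_inj: assumes "c \<in> atlas M" shows "inj_on (snd c) (fst c)"
  using homeomorphic_imp_injective_map[OF chart_homeomorphic[OF assms]] chart_subset[OF assms]
  by (simp add: inf_absorb2)

lemma ex_chart: "p \<in> points M \<Longrightarrow> \<exists>c\<in>atlas M. p \<in> fst c"
  using complex_manifold unfolding complex_manifold_def by blast

lemma chart_inv_left [simp]: "c \<in> atlas M \<Longrightarrow> p \<in> fst c \<Longrightarrow> chart_inv c (snd c p) = p"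
  unfolding chart_inv_def by (rule inv_into_f_f[OF chart_inj])

lemma chart_inv_right [simp]: "z \<in> snd c ` fst c \<Longrightarrow> snd c (chart_inv c z) = z"
  unfolding chart_inv_def by (rule f_inv_into_f)

lemma chart_inv_in: "z \<in> snd c ` fst c \<Longrightarrow> chart_inv c z \<in> fst c"
  unfolding chart_inv_def by (rule inv_into_into)

lemma chart_open_image:
  assumes c: "c \<in> atlas M" and S: "openin (mtop M) S" shows "open (snd c ` (fst c \<inter> S))"
proof -
  have "openin (subtopology (mtop M) (fst c)) (fst c \<inter> S)"
    using S by (metis openin_subtopology_Int2)
  then have "openin (top_of_set (snd c ` fst c)) (snd c ` (fst c \<inter> S))"
    using homeomorphic_imp_open_map[OF chart_homeomorphic[OF c]] unfolding open_map_def by blast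
  then show ?thesis using chart_image_open[OF c] openin_open_eq by blast
qed

lemma chart_open_preimage:
  assumes c: "c \<in> atlas M" and T: "open T" shows "openin (mtop M) (fst c \<inter> snd c -` T)"
proof -
  have "openin (top_of_set (snd c ` fst c)) (snd c ` fst c \<inter> T)" using T by (simp add: openin_open_Int)
  from openin_continuous_map_preimage[OF homeomorphic_imp_continuous_map[OF chart_homeomorphic[OF c]] this]
  moreover have "{x \<in> topspace (subtopology (mtop M) (fst c)). snd c x \<in> snd c ` fst c \<inter> T} = fst c \<inter> snd c -` T"
    using chart_subset[OF c] by auto
  ultimately show ?thesis using openin_open_subtopology[OF chart_openin[OF c]] by simp
qed

lemma transition_apply: "c \<in> atlas M \<Longrightarrow> p \<in> fst c \<Longrightarrow> transition c d (snd c p) = snd d p"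
  by (simp add: transition_def)

lemma transition_holomorphic:
  "c \<in> atlas M \<Longrightarrow> d \<in> atlas M \<Longrightarrow> cholomorphic_on (transition c d) (snd c ` (fst c \<inter> fst d))"
  using complex_manifold unfolding complex_manifold_def by blast

lemma transition_differentiable:
  assumes "c \<in> atlas M" "d \<in> atlas M" "p \<in> fst c" "p \<in> fst d"
  shows "transition c d differentiable (at (snd c p))"
proof -
  have "Ck_on (Suc 0) (transition c d) (snd c ` (fst c \<inter> fst d))"
    using transition_holomorphic[OF assms(1,2)] unfolding cholomorphic_on_def smooth_on_def by blast
  then show ?thesis using assms by auto
qed

lemma transition_smult:
  assumes "c \<in> atlas M" "d \<in> atlas M" "p \<in> fst c" "p \<in> fst d"
  shows "dird (transition c d) (snd c p) (a *s v) = a *s dird (transition c d) (snd c p) v"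
  using transition_holomorphic[OF assms(1,2)] assms(3,4) unfolding cholomorphic_on_def by blast

lemma transition_add:
  assumes "c \<in> atlas M" "d \<in> atlas M" "p \<in> fst c" "p \<in> fst d"
  shows "dird (transition c d) (snd c p) (u + v) = dird (transition c d) (snd c p) u + dird (transition c d) (snd c p) v"
  by (rule linear_add[OF dird_linear[OF transition_differentiable[OF assms]]])

lemma local_expression_chain:
  fixes h :: "'a \<Rightarrow> 'w::real_normed_vector"
  assumes cd: "c \<in> atlas M" "d \<in> atlas M" "p \<in> fst c" "p \<in> fst d"
    and h: "(h \<circ> chart_inv d) differentiable (at (snd d p))"
  shows "dird (h \<circ> chart_inv c) (snd c p) v = dird (h \<circ> chart_inv d) (snd d p) (dird (transition c d) (snd c p) v)"
    and "(h \<circ> chart_inv c) differentiable (at (snd c p))"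
proof -
  have S: "open (snd c ` (fst c \<inter> fst d))" "snd c p \<in> snd c ` (fst c \<inter> fst d)"
    using chart_open_image[OF cd(1) chart_openin[OF cd(2)]] cd by auto
  have "(h \<circ> chart_inv d has_derivative dird (h \<circ> chart_inv d) (snd d p)) (at (transition c d (snd c p)))"
    using has_dird[OF h] by (simp add: transition_apply cd)
  from diff_chain_at[OF has_dird[OF transition_differentiable[OF cd]] this]
  have "(h \<circ> chart_inv d \<circ> transition c d has_derivative
      dird (h \<circ> chart_inv d) (snd d p) \<circ> dird (transition c d) (snd c p)) (at (snd c p))" .
  then have *: "(h \<circ> chart_inv c has_derivative
      dird (h \<circ> chart_inv d) (snd d p) \<circ> dird (transition c d) (snd c p)) (at (snd c p))"
    by (rule has_derivative_transform_within_open[OF _ S]) (auto simp: transition_apply cd)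
  show "dird (h \<circ> chart_inv c) (snd c p) v = dird (h \<circ> chart_inv d) (snd d p) (dird (transition c d) (snd c p) v)"
    using dirdI[OF *] by simp
  show "(h \<circ> chart_inv c) differentiable (at (snd c p))" using * by (auto simp: differentiable_def)
qed

lemma transition_chain:
  assumes "c \<in> atlas M" "d \<in> atlas M" "e \<in> atlas M" "p \<in> fst c" "p \<in> fst d" "p \<in> fst e"
  shows "dird (transition d e) (snd d p) (dird (transition c d) (snd c p) v) = dird (transition c e) (snd c p) v"
  using local_expression_chain(1)[of c d p "snd e"] transition_differentiable[of d e p] assms
  by (simp add: transition_def)

lemma transition_same:
  assumes "c \<in> atlas M" "p \<in> fst c" shows "dird (transition c c) (snd c p) v = v"
proof (rule dirdI, rule has_derivative_transform_within_open[OF _ chart_image_open[OF assms(1)]])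
  show "((\<lambda>x. x) has_derivative (\<lambda>x. x)) (at (snd c p))" by (rule has_derivative_ident)
qed (use assms in \<open>auto simp: transition_apply\<close>)

lemma tvec_nth: "c \<in> atlas M \<Longrightarrow> p \<in> fst c \<Longrightarrow> tvec M c p v c = v"
  by (simp add: tvec_def charts_at_def transition_same)

lemma tvec_in: "c \<in> atlas M \<Longrightarrow> p \<in> fst c \<Longrightarrow> tvec M c p v \<in> tangent_space M p"
  unfolding tangent_space_def
  by (intro CollectI conjI ballI allI impI) (auto simp: tvec_def charts_at_def transition_chain)

lemma tvec_eq: 
  assumes "W \<in> tangent_space M p" "c \<in> atlas M" "p \<in> fst c" shows "tvec M c p (W c) = W"
proof
  fix d
  have c: "c \<in> charts_at M p" using assms by (simp add: charts_at_def)
  have "d \<in> charts_at M p \<Longrightarrow> W d = dird (transition c d) (snd c p) (W c)" "d \<notin> charts_at M p \<Longrightarrow> W d = 0"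
    using assms(1) c unfolding tangent_space_def by blast+
  then show "tvec M c p (W c) d = W d"
    unfolding tvec_def by (cases "d \<in> charts_at M p") simp_all
qed

lemma tvec_smult: "c \<in> atlas M \<Longrightarrow> p \<in> fst c \<Longrightarrow> tvec M c p (a *s v) = tscale a (tvec M c p v)"
  by (auto simp: tvec_def tscale_def fun_eq_iff transition_smult charts_at_def)

lemma tvec_add: "c \<in> atlas M \<Longrightarrow> p \<in> fst c \<Longrightarrow> tvec M c p (u + v) = tadd (tvec M c p u) (tvec M c p v)"
  by (auto simp: tvec_def tadd_def fun_eq_iff transition_add charts_at_def)

lemma tvec_eq_0_iff:
  assumes "c \<in> atlas M" "p \<in> fst c" shows "tvec M c p v = (\<lambda>_. 0) \<longleftrightarrow> v = 0"
proof
  assume "tvec M c p v = (\<lambda>_. 0)"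
  then have "tvec M c p v c = 0" by simp
  then show "v = 0" by (simp add: tvec_nth[OF assms])
next
  show "tvec M c p v = (\<lambda>_. 0)" if "v = 0"
    using tvec_smult[OF assms, of 0 v] that by (simp add: tscale_def)
qed

lemma tscale_in:
  assumes "W \<in> tangent_space M p" "p \<in> points M" shows "tscale a W \<in> tangent_space M p"
proof -
  obtain c where c: "c \<in> atlas M" "p \<in> fst c" using ex_chart assms(2) by blast
  show ?thesis using tvec_in[OF c, of "a *s W c"] tvec_eq[OF assms(1) c] by (simp add: tvec_smult[OF c])
qed

lemma tangent_component_nonzero:
  assumes "W \<in> tangent_space M p" "c \<in> atlas M" "p \<in> fst c" "W \<noteq> (\<lambda>_. 0)" shows "W c \<noteq> 0"
  using tvec_eq[OF assms(1-3)] tvec_eq_0_iff[OF assms(2,3), of "W c"] assms(4) by auto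

end


section \<open>Kaehler metrics in a chart\<close>

text \<open>Transfers regularity of the metric from its matrix entries, which are what
  \<open>hermitian_metric\<close> takes to be smooth, to arbitrary constant arguments.\<close>

lemma sesquilinear_expand:
  fixes h :: "complex^'n \<Rightarrow> complex^'n \<Rightarrow> complex"
  assumes add: "\<And>u v w. h (u + v) w = h u w + h v w" and smult: "\<And>a u w. h (a *s u) w = a * h u w"
    and cnj: "\<And>u v. h v u = cnj (h u v)"
  shows "h u v = (\<Sum>k\<in>UNIV. \<Sum>l\<in>UNIV. (u $ k * cnj (v $ l)) * h (axis k 1) (axis l 1))"
proof -
  have z: "h 0 w = 0" for w using smult[of 0 0 w] by simp
  have l: "h u w = (\<Sum>k\<in>UNIV. u $ k * h (axis k 1) w)" for u w
    using additive_sum[of "\<lambda>u. h u w" UNIV "\<lambda>k. u $ k *s axis k 1"]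
    by (simp add: basis_expansion add z smult)
  have r: "h w v = (\<Sum>k\<in>UNIV. cnj (v $ k) * h w (axis k 1))" for w
    by (subst cnj, subst l[of v]) (simp add: cnj[of "axis _ 1" w])
  show ?thesis by (subst l, subst r) (simp add: sum_distrib_left mult_ac)
qed

locale kaehler_manifold = complex_manifold_charts N for N :: "('b, 'n::finite) manifold" +
  fixes g :: "('b, 'n) metric"
  assumes kaehler: "kaehler_metric N g"
begin

lemma g_add:
  assumes "p \<in> points N" "V \<in> tangent_space N p" "W \<in> tangent_space N p" "V' \<in> tangent_space N p"
  shows "g p (tadd V V') W = g p V W + g p V' W"
  using kaehler assms unfolding kaehler_metric_def hermitian_metric_def by blast

lemma g_scale:
  assumes "p \<in> points N" "V \<in> tangent_space N p" "W \<in> tangent_space N p"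
  shows "g p (tscale a V) W = a * g p V W"
  using kaehler assms unfolding kaehler_metric_def hermitian_metric_def by blast

lemma g_cnj:
  assumes "p \<in> points N" "V \<in> tangent_space N p" "W \<in> tangent_space N p"
  shows "g p W V = cnj (g p V W)"
  using kaehler assms unfolding kaehler_metric_def hermitian_metric_def by blast

lemma g_pos:
  assumes "p \<in> points N" "V \<in> tangent_space N p" "V \<noteq> (\<lambda>_. 0)"
  shows "Re (g p V V) > 0"
  using kaehler assms unfolding kaehler_metric_def hermitian_metric_def by blast

lemma kaehler_chart:
  assumes c: "c \<in> atlas N" shows "kaehler_domain (snd c ` fst c) (local_metric N g c)"
proof -
  have in1: "chart_inv c q \<in> fst c" "chart_inv c q \<in> points N" if "q \<in> snd c ` fst c" for q
    using chart_inv_in[OF that] chart_subset[OF c] by auto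
  note lm = local_metric_def Let_def
  have add: "local_metric N g c q (u + v) w = local_metric N g c q u w + local_metric N g c q v w"
    if "q \<in> snd c ` fst c" for q u v w
    using in1[OF that] c by (simp add: lm tvec_add g_add tvec_in)
  have smult: "local_metric N g c q (a *s u) w = a * local_metric N g c q u w"
    if "q \<in> snd c ` fst c" for q u w a
    using in1[OF that] c by (simp add: lm tvec_smult g_scale tvec_in)
  have cnj: "local_metric N g c q v u = cnj (local_metric N g c q u v)"
    if "q \<in> snd c ` fst c" for q u v
    unfolding lm using in1[OF that] c by (intro g_cnj) (simp_all add: tvec_in)
  show ?thesis
  proof
    show "open (snd c ` fst c)" by (rule chart_image_open[OF c])
    fix q u v w x a assume q: "q \<in> snd c ` fst c"
    show "local_metric N g c q (u + v) w = local_metric N g c q u w + local_metric N g c q v w" by (rule add[OF q])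
    show "local_metric N g c q (a *s u) w = a * local_metric N g c q u w" by (rule smult[OF q])
    show "local_metric N g c q v u = cnj (local_metric N g c q u v)" by (rule cnj[OF q])
    show "0 < Re (local_metric N g c q u u)" if "u \<noteq> 0"
      using in1[OF q] c that by (simp add: lm g_pos tvec_in tvec_eq_0_iff)
    show "ext_deriv2 (\<lambda>q u v. - Im (local_metric N g c q u v)) q u v x = 0"
      using kaehler c q unfolding kaehler_metric_def fundamental_form_def[abs_def] by blast
  next
    fix u v
    have sm: "Ck_on (Suc (Suc 0)) (\<lambda>q. metric_matrix N g c q $ k $ l) (snd c ` fst c)" for k l
      using kaehler c unfolding kaehler_metric_def hermitian_metric_def smooth_on_def by blast
    show "twice_differentiable_on (\<lambda>q. local_metric N g c q u v) (snd c ` fst c)"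
    proof (rule Ck_on_twice_differentiable, rule Ck_on_cong[OF chart_image_open[OF c]])
      show "Ck_on (Suc (Suc 0)) (\<lambda>q. \<Sum>k\<in>UNIV. \<Sum>l\<in>UNIV. (u $ k * cnj (v $ l)) * metric_matrix N g c q $ k $ l) (snd c ` fst c)"
        by (intro Ck_on_sum Ck_on_linear_compose[OF _ bounded_linear_mult_right] sm chart_image_open[OF c]) auto
      show "(\<Sum>k\<in>UNIV. \<Sum>l\<in>UNIV. (u $ k * cnj (v $ l)) * metric_matrix N g c q $ k $ l) = local_metric N g c q u v"
        if "q \<in> snd c ` fst c" for q
        using sesquilinear_expand[of "local_metric N g c q" u v, OF add[OF that] smult[OF that] cnj[OF that]]
        by (simp add: metric_matrix_def)
    qed
  qed
qed

lemma gm_chart: "c \<in> atlas N \<Longrightarrow> kaehler_domain.gm (local_metric N g c) = metric_matrix N g c"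
  by (simp add: kaehler_domain.gm_def[OF kaehler_chart] metric_matrix_def fun_eq_iff)

lemma christoffel_chart:
  "c \<in> atlas N \<Longrightarrow> kaehler_domain.christoffel (local_metric N g c) = chern_christoffel N g c"
  by (simp add: kaehler_domain.christoffel_def[OF kaehler_chart] chern_christoffel_def fun_eq_iff gm_chart)

lemma G_chart: "c \<in> atlas N \<Longrightarrow> kaehler_domain.G (local_metric N g c) = riemannian_local N g c"
  by (simp add: kaehler_domain.G_def[OF kaehler_chart] riemannian_local_def fun_eq_iff)

end


section \<open>The energy density of a map\<close>

locale pluriharmonic_map = M: complex_manifold_charts M + N: kaehler_manifold N g
  for M :: "('a, 'm::finite) manifold" and N :: "('b, 'n::finite) manifold" and g :: "('b, 'n) metric" +
  fixes f :: "'a \<Rightarrow> 'b"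
  assumes pluriharmonic: "pluriharmonic M N g f"
begin

definition loc :: "('a, 'm) chart \<Rightarrow> ('b, 'n) chart \<Rightarrow> complex^'m \<Rightarrow> complex^'n" where
  "loc c e = snd e \<circ> f \<circ> chart_inv c"

definition locdom :: "('a, 'm) chart \<Rightarrow> ('b, 'n) chart \<Rightarrow> (complex^'m) set" where
  "locdom c e = snd c ` (fst c \<inter> f -` fst e)"

lemma smooth: "smooth_map M N f"
  using pluriharmonic unfolding pluriharmonic_def by blast

lemma f_in: "p \<in> points M \<Longrightarrow> f p \<in> points N"
  using smooth unfolding smooth_map_def continuous_map_def by auto

lemma loc_Ck: "c \<in> atlas M \<Longrightarrow> e \<in> atlas N \<Longrightarrow> Ck_on k (loc c e) (locdom c e)"
  using smooth unfolding smooth_map_def smooth_on_def loc_def locdom_def by blast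

lemma locdom_open:
  assumes "c \<in> atlas M" "e \<in> atlas N" shows "open (locdom c e)"
proof -
  have "openin (mtop M) {x \<in> points M. f x \<in> fst e}"
    using smooth N.chart_openin[OF assms(2)] unfolding smooth_map_def
    by (blast intro: openin_continuous_map_preimage)
  from M.chart_open_image[OF assms(1) this]
  moreover have "fst c \<inter> {x \<in> points M. f x \<in> fst e} = fst c \<inter> f -` fst e"
    using M.chart_subset[OF assms(1)] by auto
  ultimately show ?thesis unfolding locdom_def by simp
qed

lemma loc_in: "c \<in> atlas M \<Longrightarrow> z \<in> locdom c e \<Longrightarrow> loc c e z \<in> snd e ` fst e"
  unfolding loc_def locdom_def by auto

lemma loc_apply: "c \<in> atlas M \<Longrightarrow> p \<in> fst c \<Longrightarrow> loc c e (snd c p) = snd e (f p)"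
  by (simp add: loc_def)

lemma loc_differentiable:
  "c \<in> atlas M \<Longrightarrow> e \<in> atlas N \<Longrightarrow> z \<in> locdom c e \<Longrightarrow> loc c e differentiable (at z)"
  using loc_Ck[of c e "Suc 0"] by simp

lemma loc_pluriharmonic:
  assumes ce: "c \<in> atlas M" "e \<in> atlas N" and z: "z \<in> locdom c e"
  shows "dird (\<lambda>y. dird (loc c e) y w) z v + dird (\<lambda>y. dird (loc c e) y (\<i> *s w)) z (\<i> *s v)
    + kaehler_domain.chern (local_metric N g e) (loc c e z) (dird (loc c e) z v) (dird (loc c e) z w)
    + kaehler_domain.chern (local_metric N g e) (loc c e z) (dird (loc c e) z (\<i> *s v)) (dird (loc c e) z (\<i> *s w)) = 0"
proof -
  interpret K: kaehler_domain "snd e ` fst e" "local_metric N g e" by (rule N.kaehler_chart[OF ce(2)])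
  obtain p where p: "p \<in> fst c" "f p \<in> fst e" "z = snd c p" using z unfolding locdom_def by auto
  show ?thesis
  proof (rule K.pluriharmonic_real[OF Ck_on_twice_differentiable[OF loc_Ck[OF ce]] locdom_open[OF ce] z loc_in[OF ce(1) z]])
    fix i \<alpha> \<beta>
    have "dz \<alpha> (dzbar \<beta> (\<lambda>z. snd e (f (chart_inv c z)) $ i)) (snd c p)
          + (\<Sum>j\<in>UNIV. \<Sum>k\<in>UNIV. chern_christoffel N g e i j k (snd e (f p))
               * dz \<alpha> (\<lambda>z. snd e (f (chart_inv c z)) $ j) (snd c p) * dzbar \<beta> (\<lambda>z. snd e (f (chart_inv c z)) $ k) (snd c p)) = 0"
      using pluriharmonic ce p unfolding pluriharmonic_def Let_def by blast
    then show "dz \<alpha> (dzbar \<beta> (\<lambda>y. loc c e y $ i)) z + (\<Sum>j\<in>UNIV. \<Sum>k\<in>UNIV. K.christoffel i j k (loc c e z)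
      * dz \<alpha> (\<lambda>y. loc c e y $ j) z * dzbar \<beta> (\<lambda>y. loc c e y $ k) z) = 0"
      by (simp add: N.christoffel_chart[OF ce(2)] p loc_apply[OF ce(1)]) (simp add: loc_def)
  qed
qed

text \<open>The real differential under the identification of real tangent vectors with (1,0)
  vectors, not its (1,0) part; it is only real-linear in \<open>W\<close>. By
  \<open>pushfwd_eq\<close> the chosen chart does not matter.\<close>

definition pushfwd :: "'a \<Rightarrow> ('a, 'm) tvector \<Rightarrow> ('b, 'n) tvector" where
  "pushfwd p W = (\<lambda>e. if e \<in> charts_at N (f p)
     then let c = SOME c. c \<in> charts_at M p in dird (loc c e) (snd c p) (W c) else 0)"

lemma pushfwd_eq:
  assumes W: "W \<in> tangent_space M p" and c: "c \<in> atlas M" "p \<in> fst c" and e: "e \<in> atlas N" "f p \<in> fst e"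
  shows "pushfwd p W = tvec N e (f p) (dird (loc c e) (snd c p) (W c))"
proof
  fix e'
  show "pushfwd p W e' = tvec N e (f p) (dird (loc c e) (snd c p) (W c)) e'"
  proof (cases "e' \<in> charts_at N (f p)")
    case True
    then have e': "e' \<in> atlas N" "f p \<in> fst e'" by (auto simp: charts_at_def)
    define d where "d = (SOME c. c \<in> charts_at M p)"
    have "d \<in> charts_at M p" unfolding d_def by (rule someI[of _ c]) (simp add: charts_at_def c)
    then have d: "d \<in> atlas M" "p \<in> fst d" by (auto simp: charts_at_def)
    have Wd: "W d = dird (transition c d) (snd c p) (W c)"
      using W c d unfolding tangent_space_def charts_at_def by blast
    have dom: "snd x p \<in> locdom x y" if "p \<in> fst x" "f p \<in> fst y" for x y using that unfolding locdom_def by auto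
    have "pushfwd p W e' = dird (loc d e') (snd d p) (W d)"
      using True by (simp add: pushfwd_def d_def[symmetric])
    also have "\<dots> = dird (loc c e') (snd c p) (W c)"
      unfolding Wd loc_def
      by (rule M.local_expression_chain(1)[OF c(1) d(1) c(2) d(2), symmetric])
        (use loc_differentiable[OF d(1) e'(1) dom] d e' in \<open>simp add: loc_def\<close>)
    also have "\<dots> = dird (transition e e') (snd e (f p)) (dird (loc c e) (snd c p) (W c))"
    proof -
      have S: "open (locdom c e)" "snd c p \<in> locdom c e" using locdom_open[OF c(1) e(1)] dom c e by auto
      have "(transition e e' has_derivative dird (transition e e') (snd e (f p))) (at (loc c e (snd c p)))"
        unfolding loc_apply[OF c] by (rule has_dird[OF N.transition_differentiable[OF e(1) e'(1) e(2) e'(2)]])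
      from diff_chain_at[OF has_dird[OF loc_differentiable[OF c(1) e(1) S(2)]] this]
      have "(transition e e' \<circ> loc c e has_derivative
        dird (transition e e') (snd e (f p)) \<circ> dird (loc c e) (snd c p)) (at (snd c p))" .
      then have "(loc c e' has_derivative
        dird (transition e e') (snd e (f p)) \<circ> dird (loc c e) (snd c p)) (at (snd c p))"
        by (rule has_derivative_transform_within_open[OF _ S])
          (use c e in \<open>auto simp: locdom_def loc_def N.transition_apply\<close>)
      from dirdI[OF this] show ?thesis by simp
    qed
    finally show ?thesis using True by (simp add: tvec_def)
  next
    case False
    then show ?thesis by (simp add: pushfwd_def tvec_def)
  qed
qed

definition energy_density :: "'a \<Rightarrow> ('a, 'm) tvector \<Rightarrow> real" where
  "energy_density p W = Re (g (f p) (pushfwd p W) (pushfwd p W))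
     + Re (g (f p) (pushfwd p (tscale \<i> W)) (pushfwd p (tscale \<i> W)))"

lemma energy_density_local:
  assumes W: "W \<in> tangent_space M p" and c: "c \<in> atlas M" "p \<in> fst c" and e: "e \<in> atlas N" "f p \<in> fst e"
  shows "energy_density p W =
    riemannian_local N g e (loc c e (snd c p)) (dird (loc c e) (snd c p) (W c)) (dird (loc c e) (snd c p) (W c))
    + riemannian_local N g e (loc c e (snd c p)) (dird (loc c e) (snd c p) (\<i> *s W c)) (dird (loc c e) (snd c p) (\<i> *s W c))"
proof -
  have p: "p \<in> points M" using M.chart_subset[OF c(1)] c(2) by blast
  have "tscale \<i> W c = \<i> *s W c" by (simp add: tscale_def)
  then show ?thesis
    unfolding energy_density_def pushfwd_eq[OF W c e] pushfwd_eq[OF M.tscale_in[OF W p] c e]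
    by (simp add: riemannian_local_def local_metric_def Let_def loc_apply[OF c] e)
qed

lemma energy_density_nonneg:
  assumes W: "W \<in> tangent_space M p" and p: "p \<in> points M"
  shows "energy_density p W \<ge> 0"
proof -
  obtain c where c: "c \<in> atlas M" "p \<in> fst c" using M.ex_chart p by blast
  obtain e where e: "e \<in> atlas N" "f p \<in> fst e" using N.ex_chart f_in[OF p] by blast
  interpret K: kaehler_domain "snd e ` fst e" "local_metric N g e" by (rule N.kaehler_chart[OF e(1)])
  have "loc c e (snd c p) \<in> snd e ` fst e" using e by (simp add: loc_apply[OF c])
  then show ?thesis
    unfolding energy_density_local[OF W c e] N.G_chart[OF e(1), symmetric]
    by (intro add_nonneg_nonneg K.G_nonneg)
qed

text \<open>Passing from \<open>W\<close> to \<open>a W\<close> changes the pair df(W), df(iW) by a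
  rotation scaled by \<open>cmod a\<close>; the cross terms of the two squared norms cancel.\<close>

lemma energy_density_scale:
  assumes W: "W \<in> tangent_space M p" and p: "p \<in> points M"
  shows "energy_density p (tscale a W) = (cmod a)\<^sup>2 * energy_density p W"
proof -
  obtain c where c: "c \<in> atlas M" "p \<in> fst c" using M.ex_chart p by blast
  obtain e where e: "e \<in> atlas N" "f p \<in> fst e" using N.ex_chart f_in[OF p] by blast
  interpret K: kaehler_domain "snd e ` fst e" "local_metric N g e" by (rule N.kaehler_chart[OF e(1)])
  define q where "q = loc c e (snd c p)"
  have q: "q \<in> snd e ` fst e" using e by (simp add: q_def loc_apply[OF c])
  define L where "L = dird (loc c e) (snd c p)"
  have L: "linear L" unfolding L_def
    by (intro dird_linear loc_differentiable c e) (use c e in \<open>auto simp: locdom_def\<close>)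
  define P where "P = L (W c)"
  define Q where "Q = L (\<i> *s W c)"
  have 1: "L (a *s W c) = Re a *\<^sub>R P + Im a *\<^sub>R Q"
    by (subst smult_complex_split) (simp add: linear_add[OF L] linear_scale[OF L] P_def Q_def)
  have "\<i> *s (a *s W c) = Re a *\<^sub>R (\<i> *s W c) - Im a *\<^sub>R W c"
    by (simp add: vec_eq_iff complex_eq_iff)
  then have 2: "L (\<i> *s (a *s W c)) = Re a *\<^sub>R Q - Im a *\<^sub>R P"
    by (simp add: linear_diff[OF L] linear_scale[OF L] P_def Q_def)
  have t: "tscale a W c = a *s W c" by (simp add: tscale_def)
  have "energy_density p (tscale a W) = K.G q (Re a *\<^sub>R P + Im a *\<^sub>R Q) (Re a *\<^sub>R P + Im a *\<^sub>R Q)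
      + K.G q (Re a *\<^sub>R Q - Im a *\<^sub>R P) (Re a *\<^sub>R Q - Im a *\<^sub>R P)"
    unfolding energy_density_local[OF M.tscale_in[OF W p] c e] N.G_chart[OF e(1), symmetric] t
      q_def[symmetric] L_def[symmetric] 1 2 ..
  also have "\<dots> = (cmod a)\<^sup>2 * (K.G q P P + K.G q Q Q)"
    unfolding cmod_power2 by (simp add: K.G_simps[OF q] K.G_sym[OF q, of Q P]) (simp add: algebra_simps power2_eq_square)
  also have "K.G q P P + K.G q Q Q = energy_density p W"
    unfolding energy_density_local[OF W c e] N.G_chart[OF e(1), symmetric]
      q_def[symmetric] L_def[symmetric] P_def Q_def ..
  finally show ?thesis .
qed

text \<open>Positive definiteness makes the differential vanish in charts, so \<open>f\<close> is
  constant on small coordinate balls. Each level set is therefore open and closed in the connected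
  space.\<close>

lemma constant_if_energy_zero:
  assumes zero: "\<And>p W. p \<in> points M \<Longrightarrow> W \<in> tangent_space M p \<Longrightarrow> energy_density p W = 0"
  shows "f constant_on points M"
proof -
  have locally: "\<exists>U. openin (mtop M) U \<and> p \<in> U \<and> (\<forall>q\<in>U. f q = f p)" if p: "p \<in> points M" for p
  proof -
    obtain c where c: "c \<in> atlas M" "p \<in> fst c" using M.ex_chart p by blast
    obtain e where e: "e \<in> atlas N" "f p \<in> fst e" using N.ex_chart f_in[OF p] by blast
    interpret K: kaehler_domain "snd e ` fst e" "local_metric N g e" by (rule N.kaehler_chart[OF e(1)])
    have "snd c p \<in> locdom c e" using c e by (auto simp: locdom_def)
    then obtain r where r: "r > 0" "ball (snd c p) r \<subseteq> locdom c e"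
      using locdom_open[OF c(1) e(1)] open_contains_ball by blast
    have d0: "dird (loc c e) z v = 0" if z: "z \<in> locdom c e" for z v
    proof -
      obtain q where q: "q \<in> fst c" "f q \<in> fst e" "z = snd c q" using z unfolding locdom_def by auto
      have "loc c e z \<in> snd e ` fst e" by (rule loc_in[OF c(1) z])
      moreover have "energy_density q (tvec M c q v) = 0"
        using zero M.tvec_in[OF c(1) q(1)] M.chart_subset[OF c(1)] q(1) by blast
      ultimately show ?thesis
        unfolding energy_density_local[OF M.tvec_in[OF c(1) q(1)] c(1) q(1) e(1) q(2)]
          N.G_chart[OF e(1), symmetric] M.tvec_nth[OF c(1) q(1)] q(3)[symmetric]
        using K.G_pos K.G_nonneg by (smt (verit))
    qed
    have const: "loc c e z = loc c e (snd c p)" if "z \<in> ball (snd c p) r" for z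
    proof (rule has_derivative_zero_unique[of "ball (snd c p) r"])
      fix y assume y: "y \<in> ball (snd c p) r"
      have "(loc c e has_derivative dird (loc c e) y) (at y)"
        using r y by (intro has_dird loc_differentiable[OF c(1) e(1)]) auto
      moreover have "dird (loc c e) y = (\<lambda>_. 0)" using d0 r y by auto
      ultimately show "(loc c e has_derivative (\<lambda>h. 0)) (at y within ball (snd c p) r)"
        by (metis has_derivative_at_withinI)
    qed (use that r in auto)
    define U where "U = fst c \<inter> snd c -` ball (snd c p) r"
    have "openin (mtop M) U" unfolding U_def by (rule M.chart_open_preimage[OF c(1)]) simp
    moreover have "p \<in> U" using c r by (simp add: U_def)
    moreover have "f q = f p" if q: "q \<in> U" for q
    proof -
      have "snd c q \<in> locdom c e" using q r by (auto simp: U_def)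
      then have "f q \<in> fst e" using q M.chart_inj[OF c(1)] by (auto simp: locdom_def U_def dest: inj_onD)
      moreover have "snd e (f q) = snd e (f p)"
        using const[of "snd c q"] q c loc_apply[OF c(1)] by (simp add: U_def)
      ultimately show ?thesis using N.chart_inj[OF e(1)] e by (auto dest: inj_onD)
    qed
    ultimately show ?thesis by blast
  qed
  show ?thesis
  proof (cases "points M = {}")
    case True
    then show ?thesis by (simp add: constant_on_def)
  next
    case False
    then obtain p0 where p0: "p0 \<in> points M" by blast
    define A where "A = {p \<in> points M. f p = f p0}"
    have "openin (mtop M) A"
      unfolding openin_subopen[of _ A]
    proof
      fix p assume p: "p \<in> A"
      then obtain U where "openin (mtop M) U" "p \<in> U" "\<forall>q\<in>U. f q = f p" using locally[of p] unfolding A_def by blast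
      then show "\<exists>T. openin (mtop M) T \<and> p \<in> T \<and> T \<subseteq> A"
        using p openin_subset unfolding A_def by (intro exI[of _ U]) fastforce
    qed
    moreover have "openin (mtop M) (points M - A)"
      unfolding openin_subopen[of _ "points M - A"]
    proof
      fix p assume p: "p \<in> points M - A"
      then obtain U where "openin (mtop M) U" "p \<in> U" "\<forall>q\<in>U. f q = f p" using locally[of p] by blast
      then show "\<exists>T. openin (mtop M) T \<and> p \<in> T \<and> T \<subseteq> points M - A"
        using p openin_subset unfolding A_def by (intro exI[of _ U]) fastforce
    qed
    then have "closedin (mtop M) A" unfolding closedin_def A_def by auto
    ultimately have "A = {} \<or> A = points M"
      using M.complex_manifold unfolding complex_manifold_def connected_space_clopen_in by blast
    then have "A = points M" using p0 by (auto simp: A_def)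
    then show ?thesis unfolding constant_on_def A_def by blast
  qed
qed

end


section \<open>Coordinates on the projectivized tangent bundle\<close>

definition line :: "('a, 'm::finite) tvector \<Rightarrow> ('a, 'm) tvector set" where
  "line W = range (\<lambda>a. tscale a W)"

lemma tscale_tscale: "tscale a (tscale b W) = tscale (a * b) W"
  by (simp add: tscale_def vector_smult_assoc)

lemma tscale_one [simp]: "tscale 1 W = W"
  by (simp add: tscale_def)

lemma tscale_in_line: "tscale a W \<in> line W"
  by (simp add: line_def)

lemma in_line: "W \<in> line W"
  using tscale_in_line[of 1 W] by simp

lemma line_tscale:
  assumes "a \<noteq> 0" shows "line (tscale a W) = line W"
proof -
  have "tscale b W = tscale (b * inverse a) (tscale a W)" for b
    using assms by (simp add: tscale_tscale mult.assoc)
  then show ?thesis unfolding line_def by (auto simp: tscale_tscale)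
qed

lemma tscale_nonzero: "a \<noteq> 0 \<Longrightarrow> W \<noteq> (\<lambda>_. 0) \<Longrightarrow> tscale a W \<noteq> (\<lambda>_. 0)"
  by (auto simp: tscale_def fun_eq_iff)

definition ptz :: "complex^'m pindex \<Rightarrow> complex^'m" where
  "ptz y = (\<chi> j. y $ Abs_pindex (Inl j))"

text \<open>Component \<open>k\<close> is normalized and has no coordinate, while the index type has
  no slot \<open>Inr base_index\<close>; hence component \<open>base_index\<close> is stored in the
  slot of \<open>k\<close>. The constant component 1 is separated off, because the derivative
  calculus is applied to affine maps with a given linear part.\<close>

definition ptw_linear :: "'m \<Rightarrow> complex^'m pindex \<Rightarrow> complex^'m" where
  "ptw_linear k y = (\<chi> j. if j = k then 0 else y $ Abs_pindex (Inr (if j = base_index then k else j)))"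

definition ptw :: "'m \<Rightarrow> complex^'m pindex \<Rightarrow> complex^'m" where
  "ptw k y = ptw_linear k y + axis k 1"

definition mkpt :: "'m \<Rightarrow> complex^'m \<Rightarrow> complex^'m \<Rightarrow> complex^'m pindex" where
  "mkpt k z \<xi> = (\<chi> i. case Rep_pindex i of Inl j \<Rightarrow> z $ j | Inr j \<Rightarrow> \<xi> $ (if j = k then base_index else j))"

lemma Rep_Abs_Inl [simp]: "Rep_pindex (Abs_pindex (Inl j)) = Inl j"
  by (simp add: Abs_pindex_inverse)

lemma Rep_Abs_Inr: "j \<noteq> base_index \<Longrightarrow> Rep_pindex (Abs_pindex (Inr j)) = Inr j"
  by (simp add: Abs_pindex_inverse)

lemma ptz_mkpt [simp]: "ptz (mkpt k z \<xi>) = z"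
  by (simp add: ptz_def mkpt_def vec_eq_iff)

lemma ptw_mkpt: "\<xi> $ k = 1 \<Longrightarrow> ptw k (mkpt k z \<xi>) = \<xi>"
  by (auto simp: ptw_def ptw_linear_def mkpt_def vec_eq_iff axis_def Rep_Abs_Inr)

lemma ptw_nth [simp]: "ptw k y $ k = 1"
  by (simp add: ptw_def ptw_linear_def axis_def)

lemma mkpt_ptz_ptw: "mkpt k (ptz y) (ptw k y) = y"
proof -
  have "mkpt k (ptz y) (ptw k y) $ i = y $ i" for i
  proof (cases "Rep_pindex i")
    case (Inl j)
    then have "Abs_pindex (Inl j) = i" by (simp add: Rep_pindex_inverse flip: Inl)
    then show ?thesis by (simp add: mkpt_def ptz_def Inl)
  next
    case (Inr j)
    then have "j \<noteq> base_index" using Rep_pindex[of i] by auto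
    moreover have "Abs_pindex (Inr j) = i" by (simp add: Rep_pindex_inverse flip: Inr)
    ultimately show ?thesis by (auto simp: mkpt_def Inr ptw_def ptw_linear_def axis_def)
  qed
  then show ?thesis by (simp add: vec_eq_iff)
qed

lemma bounded_linear_ptz: "bounded_linear (ptz :: complex^'m::finite pindex \<Rightarrow> complex^'m)"
  by (intro linear_conv_bounded_linear[THEN iffD1] linearI) (simp_all add: ptz_def vec_eq_iff)

lemma bounded_linear_ptw_linear: "bounded_linear (ptw_linear k :: complex^'m::finite pindex \<Rightarrow> complex^'m)"
  by (intro linear_conv_bounded_linear[THEN iffD1] linearI) (simp_all add: ptw_linear_def vec_eq_iff)

lemma ptz_smult: "ptz (a *s v) = a *s ptz v"
  by (simp add: ptz_def vec_eq_iff)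

lemma ptw_linear_smult: "ptw_linear k (a *s v) = a *s ptw_linear k v"
  by (simp add: ptw_linear_def vec_eq_iff)

abbreviation PT_chart :: "('a, 'm::finite) manifold \<Rightarrow> ('a, 'm) chart \<Rightarrow> 'm \<Rightarrow> (('a, 'm) ppoint, 'm pindex) chart" where
  "PT_chart M c k \<equiv> (PT_dom M c k, PT_coord c k)"

lemma PT_chart_in_atlas: "c \<in> atlas M \<Longrightarrow> PT_chart M c k \<in> atlas (PT M)"
  unfolding PT_def PT_atlas_def by simp (metis prod.collapse)

lemma taut_frame_in_frames: "c \<in> atlas M \<Longrightarrow> (PT_dom M c k, taut_frame c k) \<in> frames (taut_bundle M)"
  unfolding taut_bundle_def by simp (metis prod.collapse)

context complex_manifold_charts
begin

lemma line_in_PT_points: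
  "p \<in> points M \<Longrightarrow> W \<in> tangent_space M p \<Longrightarrow> W \<noteq> (\<lambda>_. 0) \<Longrightarrow> (p, line W) \<in> PT_points M"
  unfolding PT_points_def line_def by blast

lemma line_in_PT_dom:
  assumes "c \<in> atlas M" "p \<in> fst c" "W \<in> tangent_space M p" "W c $ k \<noteq> 0"
  shows "(p, line W) \<in> PT_dom M c k"
proof -
  have "W \<noteq> (\<lambda>_. 0)" using assms(4) by auto
  moreover have "p \<in> points M" using chart_subset assms(1,2) by blast
  ultimately show ?thesis
    unfolding PT_dom_def using line_in_PT_points assms in_line[of W] by auto
qed

lemma taut_frame_line:
  assumes "W c $ k = 1" shows "taut_frame c k (p, line W) = W"
  unfolding taut_frame_def
proof (rule the_equality)
  show "W \<in> snd (p, line W) \<and> W c $ k = 1" using assms in_line[of W] by simp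
  fix V assume "V \<in> snd (p, line W) \<and> V c $ k = 1"
  then obtain a where "V = tscale a W" "V c $ k = 1" by (auto simp: line_def)
  then show "V = W" using assms by (auto simp: tscale_def)
qed

lemma PT_coord_line:
  "W c $ k = 1 \<Longrightarrow> PT_coord c k (p, line W) = mkpt k (snd c p) (W c)"
  by (auto simp: PT_coord_def mkpt_def taut_frame_line vec_eq_iff split: sum.split)

lemma PT_domE:
  assumes "x \<in> PT_dom M c k"
  obtains p W where "p \<in> fst c" "W \<in> tangent_space M p" "W c $ k = 1" "x = (p, line W)"
proof -
  obtain p V where V: "x = (p, line V)" "p \<in> points M" "V \<in> tangent_space M p"
    using assms by (auto simp: PT_dom_def PT_points_def line_def)
  then have k: "V c $ k \<noteq> 0" and p: "p \<in> fst c"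
    using assms by (auto simp: PT_dom_def line_def tscale_def)
  show ?thesis
  proof (rule that[of p "tscale (inverse (V c $ k)) V"])
    show "tscale (inverse (V c $ k)) V c $ k = 1" using k by (simp add: tscale_def)
    show "x = (p, line (tscale (inverse (V c $ k)) V))" using k by (simp add: V line_tscale)
  qed (use p V tscale_in in auto)
qed

lemma PT_coord_inj:
  assumes c: "c \<in> atlas M" shows "inj_on (PT_coord c k) (PT_dom M c k)"
proof (rule inj_onI)
  fix x x' assume x: "x \<in> PT_dom M c k" "x' \<in> PT_dom M c k" and eq: "PT_coord c k x = PT_coord c k x'"
  obtain p W where W: "p \<in> fst c" "W \<in> tangent_space M p" "W c $ k = 1" "x = (p, line W)" by (rule PT_domE[OF x(1)])
  obtain p' W' where W': "p' \<in> fst c" "W' \<in> tangent_space M p'" "W' c $ k = 1" "x' = (p', line W')" by (rule PT_domE[OF x(2)])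
  have e: "mkpt k (snd c p) (W c) = mkpt k (snd c p') (W' c)"
    using eq W W' by (simp add: PT_coord_line)
  have "snd c p = snd c p'" using arg_cong[OF e, of ptz] by simp
  then have p: "p = p'" using chart_inj[OF c] W(1) W'(1) by (auto dest: inj_onD)
  have "W c = W' c" using arg_cong[OF e, of "ptw k"] by (simp add: ptw_mkpt W W')
  then have "W = W'" using tvec_eq[OF W(2) c W(1)] tvec_eq[OF W'(2) c W'(1)] unfolding p by metis
  then show "x = x'" using W(4) W'(4) p by simp
qed

text \<open>The inhomogeneous fibre coordinates are unrestricted, so the only condition on
  \<open>y\<close> concerns its base part.\<close>

lemma PT_chart_inv:
  assumes c: "c \<in> atlas M" and y: "ptz y \<in> snd c ` fst c"
  defines "p \<equiv> chart_inv c (ptz y)"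
  shows "chart_inv (PT_chart M c k) y = (p, line (tvec M c p (ptw k y)))"
    and "y \<in> PT_coord c k ` PT_dom M c k"
proof -
  have p: "p \<in> fst c" "snd c p = ptz y" unfolding p_def using chart_inv_in[OF y] chart_inv_right[OF y] by simp_all
  have x: "(p, line (tvec M c p (ptw k y))) \<in> PT_dom M c k"
    by (rule line_in_PT_dom[OF c p(1) tvec_in[OF c p(1)]]) (simp add: tvec_nth[OF c p(1)])
  have co: "PT_coord c k (p, line (tvec M c p (ptw k y))) = y"
    by (simp add: PT_coord_line tvec_nth[OF c p(1)] p mkpt_ptz_ptw)
  show "y \<in> PT_coord c k ` PT_dom M c k" using x co by (metis imageI)
  show "chart_inv (PT_chart M c k) y = (p, line (tvec M c p (ptw k y)))"
    unfolding chart_inv_def using inv_into_f_f[OF PT_coord_inj[OF c] x] by (simp add: co)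
qed

end


section \<open>The maximum principle\<close>

lemma twice_differentiable_on_subset: "twice_differentiable_on f U \<Longrightarrow> V \<subseteq> U \<Longrightarrow> twice_differentiable_on f V"
  by (auto simp: twice_differentiable_on_def)

lemma twice_differentiable_on_cong:
  assumes "twice_differentiable_on f U" "open U" "\<And>x. x \<in> U \<Longrightarrow> f x = g x"
  shows "twice_differentiable_on g U"
  unfolding twice_differentiable_on_def
proof (intro ballI conjI allI)
  fix z v assume z: "z \<in> U"
  note d = twice_differentiable_onD[OF assms(1)]
  show "g differentiable at z" by (rule differentiable_cong_open[OF assms(2) z assms(3) d(1)[OF z]])
  show "(\<lambda>z. dird g z v) differentiable at z"
    by (rule differentiable_cong_open[OF assms(2) z _ d(2)[OF z]]) (rule dird_cong[OF assms(2) _ assms(3) d(1)])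
qed

lemma twice_differentiable_on_ln:
  assumes r: "twice_differentiable_on r U" "open U" "\<And>x. x \<in> U \<Longrightarrow> r x > (0::real)"
  shows "twice_differentiable_on (\<lambda>x. ln (r x)) U"
  unfolding twice_differentiable_on_def
proof (intro ballI conjI allI)
  have d: "((\<lambda>x. ln (r x)) has_derivative (\<lambda>v. dird r y v * inverse (r y))) (at y)" if "y \<in> U" for y
    using has_derivative_ln[OF r(3)[OF that] has_dird[OF twice_differentiable_onD(1)[OF r(1) that]]] .
  fix z v assume z: "z \<in> U"
  show "(\<lambda>x. ln (r x)) differentiable at z" using d[OF z] by (auto simp: differentiable_def)
  have "(\<lambda>y. dird r y v * inverse (r y)) differentiable at z"
    using r(3)[OF z] by (intro differentiable_mult differentiable_inverse twice_differentiable_onD[OF r(1) z]) simp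
  then show "(\<lambda>y. dird (\<lambda>x. ln (r x)) y v) differentiable at z"
    by (rule differentiable_cong_open[OF r(2) z, rotated]) (rule dirdI[OF d, symmetric])
qed

lemma of_real_second_derivative:
  assumes t: "twice_differentiable_on \<phi> U" and U: "open U"
  shows "twice_differentiable_on (\<lambda>x. complex_of_real (\<phi> x)) U"
    and "z \<in> U \<Longrightarrow> dird (\<lambda>y. dird (\<lambda>x. complex_of_real (\<phi> x)) y v) z u = of_real (dird (\<lambda>y. dird \<phi> y v) z u)"
proof -
  have d: "((\<lambda>x. complex_of_real (\<phi> x)) has_derivative (\<lambda>v. of_real (dird \<phi> y v))) (at y)" if "y \<in> U" for y
    by (intro derivative_intros has_dird twice_differentiable_onD(1)[OF t that])
  have d2: "((\<lambda>y. dird (\<lambda>x. complex_of_real (\<phi> x)) y v) has_derivative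
      (\<lambda>u. of_real (dird (\<lambda>y. dird \<phi> y v) z u))) (at z)" if "z \<in> U" for z v
  proof (rule has_derivative_transform_within_open[OF _ U that])
    show "((\<lambda>y. complex_of_real (dird \<phi> y v)) has_derivative (\<lambda>u. of_real (dird (\<lambda>y. dird \<phi> y v) z u))) (at z)"
      by (intro derivative_intros has_dird twice_differentiable_onD(2)[OF t that])
    show "complex_of_real (dird \<phi> y v) = dird (\<lambda>x. complex_of_real (\<phi> x)) y v" if "y \<in> U" for y
      using dirdI[OF d[OF that]] by simp
  qed
  show "twice_differentiable_on (\<lambda>x. complex_of_real (\<phi> x)) U"
    using d d2 unfolding twice_differentiable_on_def differentiable_def by blast
  show "z \<in> U \<Longrightarrow> dird (\<lambda>y. dird (\<lambda>x. complex_of_real (\<phi> x)) y v) z u = of_real (dird (\<lambda>y. dird \<phi> y v) z u)"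
    using dirdI[OF d2] by simp
qed

text \<open>The assumption \<open>positive\<close> states RC-positivity for a frame and a chart that
  belong to the same \<open>c\<close> and \<open>k\<close>; there the frame is the normalized
  generator \<open>ptw k y\<close>.\<close>

locale rc_setting = pluriharmonic_map M N g f
  for M :: "('a, 'm::finite) manifold" and N :: "('b, 'n::finite) manifold"
    and g :: "('b, 'n) metric" and f :: "'a \<Rightarrow> 'b" +
  fixes h :: "('a, 'm) ppoint \<Rightarrow> ('a, 'm) tvector \<Rightarrow> ('a, 'm) tvector \<Rightarrow> complex"
  assumes compact: "compact_space (mtop M)"
    and nonpos: "nonpositive_sectional_curvature N g"
    and bundle_metric: "bundle_metric (PT M) (taut_bundle M) h"
    and positive: "\<And>c k x. c \<in> atlas M \<Longrightarrow> x \<in> PT_dom M c k \<Longrightarrow>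
      \<exists>\<mu>>0. \<exists>v. v \<noteq> 0 \<and> chern_curvature h (taut_frame c k) (PT_chart M c k) (PT_coord c k x) *v v = of_real \<mu> *s v"
begin

lemma h_hermitian:
  assumes "x \<in> PT_points M" "v \<in> snd x" "w \<in> snd x"
  shows "h x (tscale a v) w = a * h x v w" "h x w v = cnj (h x v w)"
    "v \<noteq> tscale 0 v \<Longrightarrow> Re (h x v v) > 0"
proof -
  have "(\<forall>a. h x (tscale a v) w = a * h x v w) \<and> h x w v = cnj (h x v w) \<and> (v \<noteq> tscale 0 v \<longrightarrow> Re (h x v v) > 0)"
    using bundle_metric assms unfolding bundle_metric_def points_PT[OF M.complex_manifold]
    unfolding taut_bundle_def line_bundle.simps by blast
  then show "h x (tscale a v) w = a * h x v w" "h x w v = cnj (h x v w)"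
    "v \<noteq> tscale 0 v \<Longrightarrow> Re (h x v v) > 0" by blast+
qed

lemma h_scale:
  assumes W: "p \<in> points M" "W \<in> tangent_space M p" "W \<noteq> (\<lambda>_. 0)"
  shows "h (p, line W) (tscale a W) (tscale a W) = of_real ((cmod a)\<^sup>2) * h (p, line W) W W"
proof -
  have x: "(p, line W) \<in> PT_points M" by (rule M.line_in_PT_points[OF W])
  have l: "h (p, line W) (tscale a v) w = a * h (p, line W) v w" and c: "h (p, line W) w v = cnj (h (p, line W) v w)"
    if "v \<in> line W" "w \<in> line W" for a v w
    using h_hermitian(1,2)[OF x, of v w] that by simp_all
  have i: "tscale a W \<in> line W" for a by (rule tscale_in_line)
  have "h (p, line W) (tscale a W) (tscale a W) = a * cnj (a * h (p, line W) W W)"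
    using l[OF in_line i] c[OF i in_line] l[OF in_line in_line] by metis
  also have "\<dots> = (a * cnj a) * h (p, line W) W W" using c[OF in_line in_line] by simp
  finally show ?thesis unfolding complex_norm_square .
qed

lemma h_pos:
  assumes W: "p \<in> points M" "W \<in> tangent_space M p" "W \<noteq> (\<lambda>_. 0)"
  shows "Re (h (p, line W) W W) > 0"
proof -
  have x: "(p, line W) \<in> PT_points M" by (rule M.line_in_PT_points[OF W])
  have "W \<noteq> tscale 0 W" using W(3) by (simp add: tscale_def)
  then show ?thesis using h_hermitian(3)[OF x] in_line[of W] by simp
qed

text \<open>A function on the projectivized bundle by \<open>ratio_scale\<close>. It is kept as a
  function of nonzero tangent vectors, so that compactness of \<open>M\<close> and of unit spheres
  yields its maximum.\<close>

definition ratio :: "'a \<Rightarrow> ('a, 'm) tvector \<Rightarrow> real" where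
  "ratio p W = energy_density p W / Re (h (p, line W) W W)"

lemma ratio_scale:
  assumes W: "p \<in> points M" "W \<in> tangent_space M p" "W \<noteq> (\<lambda>_. 0)" and a: "a \<noteq> 0"
  shows "ratio p (tscale a W) = ratio p W"
  using a by (simp add: ratio_def energy_density_scale[OF W(2,1)] line_tscale[OF a] h_scale[OF W])

section \<open>The ratio in coordinates of the projectivized bundle\<close>

definition hloc :: "('a, 'm) chart \<Rightarrow> 'm \<Rightarrow> complex^'m pindex \<Rightarrow> complex" where
  "hloc c k y = (let x = chart_inv (PT_chart M c k) y in h x (taut_frame c k x) (taut_frame c k x))"

definition eloc :: "('a, 'm) chart \<Rightarrow> 'm \<Rightarrow> complex^'m pindex \<Rightarrow> real" where
  "eloc c k y = energy_density (chart_inv c (ptz y)) (tvec M c (chart_inv c (ptz y)) (ptw k y))"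

lemma hloc_eq:
  fixes k :: 'm
  assumes c: "c \<in> atlas M" and y: "ptz y \<in> snd c ` fst c"
  defines "p \<equiv> chart_inv c (ptz y)"
  defines "T \<equiv> tvec M c p (ptw k y)"
  shows "hloc c k y = h (p, line T) T T"
proof -
  have p: "p \<in> fst c" unfolding p_def by (rule M.chart_inv_in[OF y])
  have "T c $ k = 1" by (simp add: T_def M.tvec_nth[OF c p])
  then show ?thesis
    unfolding hloc_def M.PT_chart_inv(1)[OF c y] p_def[symmetric] T_def[symmetric]
    by (simp add: M.taut_frame_line)
qed

lemma hloc_pos:
  assumes c: "c \<in> atlas M" and y: "ptz y \<in> snd c ` fst c" shows "Re (hloc c k y) > 0"
proof -
  have p: "chart_inv c (ptz y) \<in> fst c" by (rule M.chart_inv_in[OF y])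
  have "ptw k y \<noteq> 0" using ptw_nth[of k y] by (metis zero_index zero_neq_one)
  then show ?thesis
    unfolding hloc_eq[OF c y] using p c M.chart_subset[OF c]
    by (intro h_pos) (auto simp: M.tvec_in M.tvec_eq_0_iff)
qed

lemma ratio_eq:
  assumes "c \<in> atlas M" "ptz y \<in> snd c ` fst c"
  shows "ratio (chart_inv c (ptz y)) (tvec M c (chart_inv c (ptz y)) (ptw k y)) = eloc c k y / Re (hloc c k y)"
  unfolding ratio_def eloc_def hloc_eq[OF assms] ..

lemma continuous_ptz: "continuous_on S ptz"
  by (rule linear_continuous_on[OF bounded_linear_ptz])

lemma hloc_twice_differentiable:
  assumes c: "c \<in> atlas M" shows "twice_differentiable_on (\<lambda>y. Re (hloc c k y)) (ptz -` (snd c ` fst c))"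
proof -
  have o: "open (ptz -` (snd c ` fst c))"
    by (rule open_vimage[OF M.chart_image_open[OF c] continuous_ptz])
  have "smooth_on (\<lambda>z. let x = chart_inv (PT_chart M c k) z in h x (taut_frame c k x) (taut_frame c k x))
    (snd (PT_chart M c k) ` (fst (PT_chart M c k) \<inter> PT_dom M c k))"
  proof -
    have "PT_chart M c k \<in> atlas (PT M)" "(PT_dom M c k, taut_frame c k) \<in> frames (taut_bundle M)"
      by (rule PT_chart_in_atlas[OF c], rule taut_frame_in_frames[OF c])
    then show ?thesis using bundle_metric unfolding bundle_metric_def by blast
  qed
  then have "Ck_on (Suc (Suc 0)) (hloc c k) (PT_coord c k ` PT_dom M c k)"
    unfolding smooth_on_def hloc_def[abs_def] by simp
  then have "Ck_on (Suc (Suc 0)) (hloc c k) (ptz -` (snd c ` fst c))"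
    by (rule Ck_on_subset) (use M.PT_chart_inv(2)[OF c] in auto)
  then show ?thesis by (intro Ck_on_twice_differentiable Ck_on_linear_compose[OF o bounded_linear_Re])
qed

lemma locdom_subset: "locdom c e \<subseteq> snd c ` fst c"
  by (auto simp: locdom_def)

lemma ptz_surj_direction: "\<exists>B. ptz B = w"
  using ptz_mkpt by blast

text \<open>In these coordinates base point and tangent vector depend on \<open>y\<close> by
  \<open>ptz\<close> and \<open>ptw k\<close>, which are complex affine, so the energy is that of a
  push-forward. The summand 0 after \<open>ptz y\<close> only matches the affine pattern.\<close>

lemma eloc_log_subharmonic:
  assumes ce: "c \<in> atlas M" "e \<in> atlas N"
  shows "twice_differentiable_on (eloc c k) (ptz -` locdom c e)"
    and "y \<in> ptz -` locdom c e \<Longrightarrow> (dird (eloc c k) y A)\<^sup>2 + (dird (eloc c k) y (\<i> *s A))\<^sup>2 \<le>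
      eloc c k y * (dird (\<lambda>y. dird (eloc c k) y A) y A + dird (\<lambda>y. dird (eloc c k) y (\<i> *s A)) y (\<i> *s A))"
proof -
  interpret K: kaehler_domain "snd e ` fst e" "local_metric N g e" by (rule N.kaehler_chart[OF ce(2)])
  define U where "U = ptz -` locdom c e"
  have U: "open U" unfolding U_def by (rule open_vimage[OF locdom_open[OF ce] continuous_ptz])
  define E where "E = K.energy (\<lambda>y. loc c e (ptz y + 0)) (\<lambda>y. dird (loc c e) (ptz y + 0) (ptw_linear k y + axis k 1))
    (\<lambda>y. dird (loc c e) (ptz y + 0) (\<i> *s (ptw_linear k y + axis k 1)))"
  have Ee: "E y = eloc c k y" if y: "y \<in> U" for y
  proof -
    have z: "ptz y \<in> locdom c e" using y by (simp add: U_def)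
    then obtain p where p: "p \<in> fst c" "f p \<in> fst e" "snd c p = ptz y" unfolding locdom_def by auto
    then have pi: "chart_inv c (ptz y) = p" using ce(1) by (metis M.chart_inv_left)
    show ?thesis
      unfolding eloc_def pi energy_density_local[OF M.tvec_in[OF ce(1) p(1)] ce(1) p(1) ce(2) p(2)]
      unfolding E_def K.energy_def unfolding N.G_chart[OF ce(2)] by (simp add: p ptw_def M.tvec_nth[OF ce(1) p(1)])
  qed
  have main: "twice_differentiable_on E U \<and> (dird E y A)\<^sup>2 + (dird E y (\<i> *s A))\<^sup>2 \<le>
      E y * (dird (\<lambda>y. dird E y A) y A + dird (\<lambda>y. dird E y (\<i> *s A)) y (\<i> *s A))" if y: "y \<in> U" for y
  proof -
    \<comment> \<open>A direction on the projectivized bundle that projects to the tautological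
      vector at \<open>y\<close>.\<close>
    obtain B where B: "ptz B = ptw_linear k y + axis k 1" using ptz_surj_direction by blast
    have np: "sectional_curvature K.G (loc c e (ptz y + 0)) u v \<le> 0" if "u \<noteq> v" "independent {u, v}" for u v
    proof -
      have "loc c e (ptz y + 0) \<in> snd e ` fst e" using loc_in[OF ce(1), of "ptz y" e] y by (simp add: U_def)
      then show ?thesis
        unfolding N.G_chart[OF ce(2)]
        using nonpos ce(2) that unfolding nonpositive_sectional_curvature_def by blast
    qed
    have in_dom: "ptz x + 0 \<in> locdom c e" if "x \<in> U" for x using that by (simp add: U_def)
    note * = K.pushforward_energy_log_subharmonic[OF loc_Ck[OF ce] locdom_open[OF ce] loc_in[OF ce(1)]
        loc_pluriharmonic[OF ce] bounded_linear_ptz bounded_linear_ptw_linear ptz_smult ptw_linear_smult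
        U in_dom y B np, folded E_def]
    show ?thesis using * by blast
  qed
  have t: "twice_differentiable_on E U"
    using main by (cases "U = {}") (auto simp: twice_differentiable_on_def)
  from twice_differentiable_on_cong[OF t U Ee]
  show "twice_differentiable_on (eloc c k) (ptz -` locdom c e)" by (simp add: U_def)
  assume "y \<in> ptz -` locdom c e"
  then have y: "y \<in> U" by (simp add: U_def)
  have d1: "dird (eloc c k) x v = dird E x v" if "x \<in> U" for x v
    by (rule dird_cong[OF U that Ee, symmetric]) (use t that in \<open>auto simp: twice_differentiable_on_def\<close>)
  have d2: "dird (\<lambda>x. dird (eloc c k) x v) y u = dird (\<lambda>x. dird E x v) y u" for v u
    by (rule dird_cong[OF U y, symmetric]) (use t y d1 in \<open>auto simp: twice_differentiable_on_def\<close>)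
  show "(dird (eloc c k) y A)\<^sup>2 + (dird (eloc c k) y (\<i> *s A))\<^sup>2 \<le>
      eloc c k y * (dird (\<lambda>y. dird (eloc c k) y A) y A + dird (\<lambda>y. dird (eloc c k) y (\<i> *s A)) y (\<i> *s A))"
    using main[OF y] by (simp add: d1[OF y] d2 Ee[OF y])
qed

text \<open>At a maximum point, \<open>ln h - ln E\<close> has a minimum, although \<open>ln h\<close> is strictly superharmonic and
  \<open>ln E\<close> is subharmonic in the direction of the conjugate of a positive eigenvector.\<close>

lemma no_positive_maximum:
  assumes p: "p \<in> points M" and W: "W \<in> tangent_space M p" "W \<noteq> (\<lambda>_. 0)"
    and max: "\<And>q V. q \<in> points M \<Longrightarrow> V \<in> tangent_space M q \<Longrightarrow> V \<noteq> (\<lambda>_. 0) \<Longrightarrow> ratio q V \<le> ratio p W"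
  shows "ratio p W \<le> 0"
proof (rule ccontr)
  assume pos: "\<not> ratio p W \<le> 0"
  obtain c where c: "c \<in> atlas M" "p \<in> fst c" using M.ex_chart p by blast
  obtain e where e: "e \<in> atlas N" "f p \<in> fst e" using N.ex_chart f_in[OF p] by blast
  have "W c \<noteq> 0" by (rule M.tangent_component_nonzero[OF W(1) c W(2)])
  then obtain k where k: "W c $ k \<noteq> 0" by (auto simp: vec_eq_iff)
  define V where "V = tscale (inverse (W c $ k)) W"
  have V: "V \<in> tangent_space M p" "V c $ k = 1" "V \<noteq> (\<lambda>_. 0)" "ratio p V = ratio p W"
    unfolding V_def using k W p by (auto simp: M.tscale_in ratio_scale tscale_nonzero) (simp add: tscale_def)
  define y where "y = mkpt k (snd c p) (V c)"
  define U where "U = ptz -` locdom c e"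
  have U: "open U" "y \<in> U" unfolding U_def
    using open_vimage[OF locdom_open[OF c(1) e(1)] continuous_ptz] c e by (auto simp: y_def locdom_def)
  have Uc: "ptz x \<in> snd c ` fst c" if "x \<in> U" for x
    using that subsetD[OF locdom_subset[of c e]] by (simp add: U_def)
  have py: "chart_inv c (ptz y) = p" "tvec M c p (ptw k y) = V"
    using c V by (simp_all add: y_def ptw_mkpt M.tvec_eq)
  have ry: "eloc c k y / Re (hloc c k y) = ratio p W"
    using ratio_eq[OF c(1) Uc[OF U(2)], of k] by (simp add: py V)
  then have E0: "eloc c k y > 0" using pos hloc_pos[OF c(1) Uc[OF U(2)], of k]
    by (metis divide_le_0_iff linorder_not_less order_less_imp_le)
  have le: "eloc c k x / Re (hloc c k x) \<le> eloc c k y / Re (hloc c k y)" if x: "x \<in> U" for x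
  proof -
    have q: "chart_inv c (ptz x) \<in> fst c" by (rule M.chart_inv_in[OF Uc[OF x]])
    have "ptw k x \<noteq> 0" using ptw_nth[of k x] by (metis zero_index zero_neq_one)
    then have "ratio (chart_inv c (ptz x)) (tvec M c (chart_inv c (ptz x)) (ptw k x)) \<le> ratio p W"
      using q c(1) M.chart_subset[OF c(1)] by (intro max) (auto simp: M.tvec_in M.tvec_eq_0_iff)
    then show ?thesis unfolding ratio_eq[OF c(1) Uc[OF x]] ry .
  qed
  define \<phi> where "\<phi> x = ln (Re (hloc c k x))" for x
  have "twice_differentiable_on (\<lambda>y. Re (hloc c k y)) U"
    by (rule twice_differentiable_on_subset[OF hloc_twice_differentiable[OF c(1)]]) (use Uc in auto)
  then have \<phi>: "twice_differentiable_on \<phi> U"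
    unfolding \<phi>_def by (rule twice_differentiable_on_ln[OF _ U(1)]) (rule hloc_pos[OF c(1) Uc])
  have min: "\<phi> y - ln (eloc c k y) \<le> \<phi> x - ln (eloc c k x)" if x: "x \<in> U" "eloc c k x > 0" for x
  proof -
    have hp: "Re (hloc c k x) > 0" "Re (hloc c k y) > 0" using hloc_pos[OF c(1) Uc] x U by auto
    have "ln (eloc c k x / Re (hloc c k x)) \<le> ln (eloc c k y / Re (hloc c k y))"
      using le[OF x(1)] hp x(2) E0 by (subst ln_le_cancel_iff) auto
    then show ?thesis using hp x(2) E0 by (simp add: \<phi>_def ln_div)
  qed
  have lap: "dird (\<lambda>y. dird \<phi> y A) y A + dird (\<lambda>y. dird \<phi> y (\<i> *s A)) y (\<i> *s A) \<ge> 0" for A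
    using eloc_log_subharmonic[OF c(1) e(1), where k = k] U unfolding U_def[symmetric]
    by (intro log_minimum_laplacian[OF _ \<phi> U E0 min]) auto
  define \<Phi> where "\<Phi> x = complex_of_real (\<phi> x)" for x
  have \<Phi>: "twice_differentiable_on \<Phi> U"
    unfolding \<Phi>_def by (rule of_real_second_derivative(1)[OF \<phi> U(1)])
  have "(p, line V) \<in> PT_dom M c k" using M.line_in_PT_dom[OF c V(1)] V(2) by simp
  from positive[OF c(1) this] M.PT_coord_line[of V c k p, OF V(2)]
  obtain \<mu> v where \<mu>: "\<mu> > 0" "v \<noteq> 0"
      and ev: "chern_curvature h (taut_frame c k) (PT_chart M c k) y *v v = of_real \<mu> *s v"
    unfolding y_def by auto
  have cc: "chern_curvature h (taut_frame c k) (PT_chart M c k) y $ \<alpha> $ \<beta> = - dz \<alpha> (dzbar \<beta> \<Phi>) y" for \<alpha> \<beta>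
    unfolding chern_curvature_def \<Phi>_def \<phi>_def hloc_def Let_def by simp
  \<comment> \<open>Matrix multiplication contracts the barred index with \<open>v\<close>, whereas
    the complex Hessian pairs that index with \<open>cnj (A $ \<beta>)\<close>. The conjugate
    therefore turns it into the Hermitian form of the curvature matrix at \<open>v\<close>, with the
    sign reversed.\<close>
  define A where "A = (\<chi> \<alpha>. cnj (v $ \<alpha>))"
  have "(\<Sum>\<alpha>\<in>UNIV. \<Sum>\<beta>\<in>UNIV. A $ \<alpha> * cnj (A $ \<beta>) * dz \<alpha> (dzbar \<beta> \<Phi>) y)
    = - (\<Sum>\<alpha>\<in>UNIV. cnj (v $ \<alpha>) * (chern_curvature h (taut_frame c k) (PT_chart M c k) y *v v) $ \<alpha>)"
    by (simp add: A_def matrix_vector_mult_def cc sum_distrib_left sum_negf mult_ac)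
  also have "\<dots> = - of_real (\<mu> * (\<Sum>\<alpha>\<in>UNIV. (cmod (v $ \<alpha>))\<^sup>2))"
    unfolding ev by (simp add: complex_norm_square sum_distrib_left mult_ac del: of_real_power)
  finally have "Re (\<Sum>\<alpha>\<in>UNIV. \<Sum>\<beta>\<in>UNIV. A $ \<alpha> * cnj (A $ \<beta>) * dz \<alpha> (dzbar \<beta> \<Phi>) y) = - (\<mu> * (\<Sum>\<alpha>\<in>UNIV. (cmod (v $ \<alpha>))\<^sup>2))"
    by simp
  moreover have "(\<Sum>\<alpha>\<in>UNIV. (cmod (v $ \<alpha>))\<^sup>2) > 0"
  proof -
    obtain \<alpha> where "v $ \<alpha> \<noteq> 0" using \<mu>(2) by (auto simp: vec_eq_iff)
    then show ?thesis by (intro sum_pos2[of _ \<alpha>]) auto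
  qed
  moreover have "Re (\<Sum>\<alpha>\<in>UNIV. \<Sum>\<beta>\<in>UNIV. A $ \<alpha> * cnj (A $ \<beta>) * dz \<alpha> (dzbar \<beta> \<Phi>) y)
     = (dird (\<lambda>y. dird \<phi> y A) y A + dird (\<lambda>y. dird \<phi> y (\<i> *s A)) y (\<i> *s A)) / 4"
    unfolding sum_dz_dzbar[OF \<Phi> U] unfolding \<Phi>_def of_real_second_derivative(2)[OF \<phi> U] by simp
  ultimately show False using lap[of A] \<mu>(1) by (smt (verit) divide_nonneg_nonneg mult_pos_pos)
qed

section \<open>Existence of a maximum of the ratio\<close>

lemma ratio_continuous:
  assumes ce: "c \<in> atlas M" "e \<in> atlas N"
  shows "continuous_on (locdom c e \<times> - {0}) (\<lambda>x. ratio (chart_inv c (fst x)) (tvec M c (chart_inv c (fst x)) (snd x)))"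
proof -
  \<comment> \<open>Where component \<open>k\<close> does not vanish, scale invariance lets the
    ratio factor through the chart of the projectivized bundle belonging to \<open>c\<close> and
    \<open>k\<close>; there it is a quotient of differentiable functions. These open sets cover all
    nonzero vectors.\<close>
  define S where "S k = locdom c e \<times> ((\<lambda>w::complex^'m. w $ k) -` (- {0}))" for k :: 'm
  have "open (S k)" for k unfolding S_def
    by (intro open_Times locdom_open[OF ce] open_vimage continuous_intros)
  moreover have "continuous_on (S k) (\<lambda>x. ratio (chart_inv c (fst x)) (tvec M c (chart_inv c (fst x)) (snd x)))" for k
  proof -
    define m where "m x = mkpt k (fst x) (inverse (snd x $ k) *s snd x)" for x :: "(complex^'m) \<times> (complex^'m)"
    have m: "continuous_on (S k) m"
      unfolding m_def mkpt_def
    proof (rule continuous_on_vec_lambda)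
      fix i show "continuous_on (S k) (\<lambda>x. case Rep_pindex i of Inl j \<Rightarrow> fst x $ j
        | Inr j \<Rightarrow> (inverse (snd x $ k) *s snd x) $ (if j = k then base_index else j))"
        by (cases "Rep_pindex i") (auto intro!: continuous_intros simp: S_def)
    qed
    have im: "m ` S k \<subseteq> ptz -` locdom c e" by (auto simp: m_def S_def)
    have tc: "continuous_on T r" if "twice_differentiable_on r T" for r :: "_ \<Rightarrow> real" and T
      using that by (intro differentiable_imp_continuous_on)
        (auto simp: differentiable_on_def twice_differentiable_on_def intro: differentiable_at_withinI)
    have sub: "ptz -` locdom c e \<subseteq> ptz -` (snd c ` fst c)" using locdom_subset by blast
    have "continuous_on (ptz -` locdom c e) (\<lambda>y. eloc c k y / Re (hloc c k y))"
    proof (intro continuous_on_divide tc)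
      show "twice_differentiable_on (eloc c k) (ptz -` locdom c e)" by (rule eloc_log_subharmonic(1)[OF ce])
      show "twice_differentiable_on (\<lambda>y. Re (hloc c k y)) (ptz -` locdom c e)"
        by (rule twice_differentiable_on_subset[OF hloc_twice_differentiable[OF ce(1)] sub])
      show "\<forall>y\<in>ptz -` locdom c e. Re (hloc c k y) \<noteq> 0"
      proof
        fix y assume "y \<in> ptz -` locdom c e"
        then have "ptz y \<in> snd c ` fst c" using sub by auto
        from hloc_pos[OF ce(1) this, of k] show "Re (hloc c k y) \<noteq> 0" by simp
      qed
    qed
    from continuous_on_compose2[OF this m im]
    have "continuous_on (S k) (\<lambda>x. eloc c k (m x) / Re (hloc c k (m x)))" .
    then show ?thesis
    proof (rule continuous_on_cong[THEN iffD1, rotated 2])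
      fix x assume x: "x \<in> S k"
      define p where "p = chart_inv c (fst x)"
      have z: "fst x \<in> snd c ` fst c" using x subsetD[OF locdom_subset[of c e]] by (simp add: S_def mem_Times_iff)
      then have p: "p \<in> fst c" "p \<in> points M" using M.chart_inv_in[OF z] M.chart_subset[OF ce(1)] by (auto simp: p_def)
      have k: "snd x $ k \<noteq> 0" using x by (auto simp: S_def)
      then have n: "snd x \<noteq> 0" by auto
      have "ptw k (m x) = inverse (snd x $ k) *s snd x" using k by (simp add: m_def ptw_mkpt)
      moreover have "ptz (m x) = fst x" by (simp add: m_def)
      ultimately have "eloc c k (m x) / Re (hloc c k (m x)) = ratio p (tscale (inverse (snd x $ k)) (tvec M c p (snd x)))"
        using ratio_eq[OF ce(1), of "m x" k] z by (simp add: p_def[symmetric] M.tvec_smult[OF ce(1) p(1)])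
      also have "\<dots> = ratio p (tvec M c p (snd x))"
        using k n by (intro ratio_scale) (auto simp: p ce M.tvec_in M.tvec_eq_0_iff)
      finally show "eloc c k (m x) / Re (hloc c k (m x)) = ratio (chart_inv c (fst x)) (tvec M c (chart_inv c (fst x)) (snd x))"
        by (simp add: p_def)
    qed simp
  qed
  ultimately have "continuous_on (\<Union>k. S k) (\<lambda>x. ratio (chart_inv c (fst x)) (tvec M c (chart_inv c (fst x)) (snd x)))"
    by (intro continuous_on_open_UN) auto
  moreover have "(\<Union>k. S k) = locdom c e \<times> - {0}" by (auto simp: S_def vec_eq_iff)
  ultimately show ?thesis by simp
qed

text \<open>By scale invariance only unit coordinate vectors over a closed ball matter, and these
  form a compact set. The bound is itself a value of the ratio, so finitely many such bounds lead to
  an attained maximum and not merely to a supremum.\<close>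

lemma ratio_local_bound:
  assumes p: "p \<in> points M"
  shows "\<exists>U q V. openin (mtop M) U \<and> p \<in> U \<and> q \<in> points M \<and> V \<in> tangent_space M q \<and> V \<noteq> (\<lambda>_. 0) \<and>
    (\<forall>p'\<in>U. \<forall>W\<in>tangent_space M p'. W \<noteq> (\<lambda>_. 0) \<longrightarrow> ratio p' W \<le> ratio q V)"
proof -
  obtain c where c: "c \<in> atlas M" "p \<in> fst c" using M.ex_chart p by blast
  obtain e where e: "e \<in> atlas N" "f p \<in> fst e" using N.ex_chart f_in[OF p] by blast
  have "snd c p \<in> locdom c e" using c e by (auto simp: locdom_def)
  then obtain r where r: "r > 0" "cball (snd c p) r \<subseteq> locdom c e"
    using locdom_open[OF c(1) e(1)] open_contains_cball by blast
  define R where "R x = ratio (chart_inv c (fst x)) (tvec M c (chart_inv c (fst x)) (snd x))" for x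
  define K where "K = cball (snd c p) r \<times> sphere (0 :: complex^'m) 1"
  have "K \<subseteq> locdom c e \<times> - {0}" unfolding K_def using r(2) by auto
  then have cont: "continuous_on K R" unfolding R_def
    by (rule continuous_on_subset[OF ratio_continuous[OF c(1) e(1)]])
  have "compact K" unfolding K_def by (intro compact_Times compact_cball compact_sphere)
  moreover have "K \<noteq> {}"
  proof -
    obtain \<xi> :: "complex^'m" where "norm \<xi> = 1" using vector_choose_size[of 1] by auto
    then have "(snd c p, \<xi>) \<in> K" using r(1) by (simp add: K_def)
    then show ?thesis by blast
  qed
  ultimately obtain x where x: "x \<in> K" "\<And>y. y \<in> K \<Longrightarrow> R y \<le> R x"
    using continuous_attains_sup[OF _ _ cont] by blast
  define q where "q = chart_inv c (fst x)"
  have z: "fst x \<in> snd c ` fst c" using x(1) r(2) locdom_subset[of c e] by (auto simp: K_def)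
  have q: "q \<in> fst c" unfolding q_def by (rule M.chart_inv_in[OF z])
  define U where "U = fst c \<inter> snd c -` ball (snd c p) r"
  have "openin (mtop M) U" unfolding U_def by (rule M.chart_open_preimage[OF c(1)]) simp
  moreover have "p \<in> U" using c r by (simp add: U_def)
  moreover have "q \<in> points M" using q M.chart_subset[OF c(1)] by blast
  moreover have "tvec M c q (snd x) \<in> tangent_space M q" by (rule M.tvec_in[OF c(1) q])
  moreover have "tvec M c q (snd x) \<noteq> (\<lambda>_. 0)" using x(1) by (auto simp: M.tvec_eq_0_iff[OF c(1) q] K_def)
  moreover have "ratio p' W \<le> ratio q (tvec M c q (snd x))"
    if p': "p' \<in> U" and W: "W \<in> tangent_space M p'" "W \<noteq> (\<lambda>_. 0)" for p' W
  proof -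
    have pc: "p' \<in> fst c" "p' \<in> points M" using p' M.chart_subset[OF c(1)] by (auto simp: U_def)
    have n: "W c \<noteq> 0" by (rule M.tangent_component_nonzero[OF W(1) c(1) pc(1) W(2)])
    define \<xi> where "\<xi> = of_real (inverse (norm (W c))) *s W c"
    have "\<xi> = inverse (norm (W c)) *\<^sub>R W c" by (simp only: \<xi>_def scaleR_eq_smult)
    then have "norm \<xi> = 1" using n by simp
    then have "(snd c p', \<xi>) \<in> K" using p' by (auto simp: K_def U_def)
    from x(2)[OF this] have "ratio p' (tvec M c p' \<xi>) \<le> ratio q (tvec M c q (snd x))"
      using c pc by (simp add: R_def q_def)
    also have "tvec M c p' \<xi> = tscale (of_real (inverse (norm (W c)))) W"
      using M.tvec_eq[OF W(1) c(1) pc(1)] by (simp add: \<xi>_def M.tvec_smult[OF c(1) pc(1)])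
    also have "ratio p' \<dots> = ratio p' W" by (rule ratio_scale[OF pc(2) W]) (use n in simp)
    finally show ?thesis .
  qed
  ultimately show ?thesis by blast
qed

lemma ratio_attains_max:
  assumes "points M \<noteq> {}"
  shows "\<exists>p\<in>points M. \<exists>W\<in>tangent_space M p. W \<noteq> (\<lambda>_. 0) \<and>
    (\<forall>q\<in>points M. \<forall>V\<in>tangent_space M q. V \<noteq> (\<lambda>_. 0) \<longrightarrow> ratio q V \<le> ratio p W)"
proof -
  obtain U q V where UqV: "\<And>p. p \<in> points M \<Longrightarrow> openin (mtop M) (U p) \<and> p \<in> U p \<and> q p \<in> points M \<and>
      V p \<in> tangent_space M (q p) \<and> V p \<noteq> (\<lambda>_. 0) \<and>
      (\<forall>p'\<in>U p. \<forall>W\<in>tangent_space M p'. W \<noteq> (\<lambda>_. 0) \<longrightarrow> ratio p' W \<le> ratio (q p) (V p))"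
    using ratio_local_bound by metis
  have "\<exists>F. finite F \<and> F \<subseteq> U ` points M \<and> points M \<subseteq> \<Union>F"
    by (rule compact_space_alt[THEN iffD1, OF compact, rule_format]) (use UqV in blast)+
  then obtain F where F: "finite F" "F \<subseteq> points M" "points M \<subseteq> \<Union>(U ` F)"
    by (metis finite_subset_image)
  have ne: "F \<noteq> {}" using F(3) assms by auto
  obtain p where p: "p \<in> F" "\<And>p'. p' \<in> F \<Longrightarrow> ratio (q p') (V p') \<le> ratio (q p) (V p)"
  proof -
    have "Max ((\<lambda>p. ratio (q p) (V p)) ` F) \<in> (\<lambda>p. ratio (q p) (V p)) ` F" using F(1) ne by (intro Max_in) auto
    then obtain p where p: "p \<in> F" "ratio (q p) (V p) = Max ((\<lambda>p. ratio (q p) (V p)) ` F)" by auto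
    show ?thesis by (rule that[OF p(1)]) (use F(1) in \<open>simp add: p(2)\<close>)
  qed
  show ?thesis
  proof (intro bexI[of _ "q p"] bexI[of _ "V p"] conjI ballI impI)
    fix x W assume x: "x \<in> points M" "W \<in> tangent_space M x" "W \<noteq> (\<lambda>_. 0)"
    then obtain p' where p': "p' \<in> F" "x \<in> U p'" using F(3) by blast
    then have "ratio x W \<le> ratio (q p') (V p')" using UqV F(2) x by blast
    also have "\<dots> \<le> ratio (q p) (V p)" by (rule p(2)[OF p'(1)])
    finally show "ratio x W \<le> ratio (q p) (V p)" .
  qed (use UqV p(1) F(2) in blast)+
qed

text \<open>The maximal ratio is nonpositive while the energy density is nonnegative, so the energy
  density vanishes on every tangent vector.\<close>

lemma map_constant: "f constant_on points M"
proof (cases "points M = {}")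
  case True
  then show ?thesis by (simp add: constant_on_def)
next
  case False
  obtain p0 W0 where p0: "p0 \<in> points M" "W0 \<in> tangent_space M p0" "W0 \<noteq> (\<lambda>_. 0)"
    and max': "\<forall>q\<in>points M. \<forall>V\<in>tangent_space M q. V \<noteq> (\<lambda>_. 0) \<longrightarrow> ratio q V \<le> ratio p0 W0"
    using ratio_attains_max[OF False] by blast
  have max: "ratio q V \<le> ratio p0 W0" if "q \<in> points M" "V \<in> tangent_space M q" "V \<noteq> (\<lambda>_. 0)" for q V
    using max' that by blast
  have le: "ratio p0 W0 \<le> 0" by (rule no_positive_maximum[OF p0 max])
  show ?thesis
  proof (rule constant_if_energy_zero)
    fix p W assume p: "p \<in> points M" and W: "W \<in> tangent_space M p"
    show "energy_density p W = 0"
    proof (cases "W = (\<lambda>_. 0)")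
      case True
      then have "tscale 0 W = W" by (simp add: tscale_def)
      then show ?thesis using energy_density_scale[OF W p, of 0] by simp
    next
      case False
      then have "ratio p W \<le> 0" using max[OF p W] le by auto
      then show ?thesis
        using h_pos[OF p W False] energy_density_nonneg[OF W p] by (auto simp: ratio_def divide_le_0_iff)
    qed
  qed
qed

end

theorem theorem1p11:
  fixes M :: "('a, 'm::finite) manifold" and N :: "('b, 'n::finite) manifold"
    and g :: "('b, 'n) metric" and f :: "'a \<Rightarrow> 'b"
  assumes "complex_manifold M" and "compact_space (mtop M)"
    and "complex_manifold N" and "kaehler_metric N g"
    and "nonpositive_sectional_curvature N g"
    and "pluriharmonic M N g f"
    and "RC_positive (PT M) (taut_bundle M)"
  shows "f constant_on points M"
proof -
  obtain h where h: "bundle_metric (PT M) (taut_bundle M) h"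
    and rc: "\<forall>c\<in>atlas (PT M). \<forall>(V, s)\<in>frames (taut_bundle M). \<forall>x\<in>fst c \<inter> V.
        \<exists>\<mu>>0. \<exists>v. v \<noteq> 0 \<and> chern_curvature h s c (snd c x) *v v = of_real \<mu> *s v"
    using assms(7) unfolding RC_positive_def by blast
  interpret rc_setting M N g f h
  proof unfold_locales
    fix c k x assume c: "c \<in> atlas M" and x: "x \<in> PT_dom M c k"
    have "PT_chart M c k \<in> atlas (PT M)" "(PT_dom M c k, taut_frame c k) \<in> frames (taut_bundle M)"
      by (rule PT_chart_in_atlas[OF c], rule taut_frame_in_frames[OF c])
    then show "\<exists>\<mu>>0. \<exists>v. v \<noteq> 0 \<and> chern_curvature h (taut_frame c k) (PT_chart M c k) (PT_coord c k x) *v v = of_real \<mu> *s v"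
      using rc x by fastforce
  qed (use assms h in auto)
  show ?thesis by (rule map_constant)
qed

end
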